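(* For every real number $s$ with $0<s\le 1$ there is a (deterministic) homogeneous Moran set $K$, i.e. there are integers $N_n\ge 2$ and non-empty sets $\mathcal{B}_n\subset\{0,1,\dots,N_n-1\}$ ($n\ge 1$) and $$K=\left\{\sum_{n=1}^{\infty}\frac{d_n}{N_1\cdots N_n}: d_n\in\mathcal{B}_n\right\},$$ whose associated Cantor--Moran measure $\mu$ satisfies $\dim_F\mu=\dim_H K=s$ and is a spectral measure. Consequently, $K$ is a Salem set.
   Context: The Cantor--Moran measure associated with $\{(N_n,\mathcal{B}_n)\}_{n\ge1}$ is the Borel probability measure given by the infinite convolution $$\mu=\mathop{\ast}_{n=1}^{\infty}\left(\sum_{d\in\mathcal{B}_n}\frac{1}{\#\mathcal{B}_n}\,\delta_{d\,(N_1\cdots N_n)^{-1}}\right),$$ where $\delta_a$ is the Dirac measure at $a\in\mathbb{R}$. (Equivalently, $\mu$ is the law of $\sum_{n\ge1} d_n/(N_1\cdots N_n)$ with $d_n$ independent and uniformly distributed on $\mathcal{B}_n$.) The Fourier transform of a finite Borel measure $\mu$ on $\mathbb{R}$ is $\widehat{\mu}(\xi)=\int e^{-2\pi i\xi x}\,d\mu(x)$. The Fourier dimension of a nonzero finite Borel measure $\mu$ on $\mathbb{R}$ is $$\dim_F\mu=\sup\{t\in[0,1]:\exists\,0<C<\infty\text{ such that }|\widehat{\mu}(\xi)|\le C(1+|\xi|)^{-t/2}\ \forall \xi\in\mathbb{R}\}.$$ For a Borel set $E\subset\mathbb{R}$, $\dim_F E=\sup\{\dim_F\mu:\mu\text{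 a probability measure supported on }E\}$. $\dim_H$ denotes Hausdorff dimension. $E$ is a Salem set if $\dim_F E=\dim_H E$. A Borel probability measure $\mu$ on $\mathbb{R}$ is a spectral measure if there is a countable set $\Lambda\subset\mathbb{R}$ (a spectrum of $\mu$) such that $\{e^{2\pi i\lambda x}\}_{\lambda\in\Lambda}$ is an orthonormal basis of $L^2(\mu)$. *)

theory Defs
  imports "HOL-Probability.Probability"
begin

section \<open>Infinite convolutions and Cantor--Moran measures\<close>

primrec finite_convolution :: "(nat \<Rightarrow> real measure) \<Rightarrow> nat \<Rightarrow> real measure" where
  "finite_convolution \<nu> 0 = return borel 0"
| "finite_convolution \<nu> (Suc n) = (finite_convolution \<nu> n \<star> \<nu> n)"

text \<open>
  The infinite convolution is the weak limit of the finite convolutions; like \<open>sums\<close>, it is a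
  relation between a sequence and its (unique) limit.
\<close>

definition has_infinite_convolution :: "(nat \<Rightarrow> real measure) \<Rightarrow> real measure \<Rightarrow> bool" where
  "has_infinite_convolution \<nu> \<mu> \<longleftrightarrow>
     real_distribution \<mu> \<and> weak_conv_m (finite_convolution \<nu>) \<mu>"

text \<open>
  Sequences are indexed from 0, so the customary \<open>N\<^sub>n\<close> and \<open>B\<^sub>n\<close> for \<open>n \<ge> 1\<close> are \<open>N (n - 1)\<close> and
  \<open>B (n - 1)\<close>, and the product \<open>N\<^sub>1 \<cdots> N\<^sub>n\<close> is \<open>\<Prod>i\<le>n - 1. N i\<close>.
\<close>

definition moran_set :: "(nat \<Rightarrow> nat) \<Rightarrow> (nat \<Rightarrow> nat set) \<Rightarrow> real set" where
  "moran_set N B = {(\<Sum>n. real (d n) / real (\<Prod>i\<le>n. N i)) | d. \<forall>n. d n \<in> B n}"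

definition digit_measure :: "(nat \<Rightarrow> nat) \<Rightarrow> (nat \<Rightarrow> nat set) \<Rightarrow> nat \<Rightarrow> real measure" where
  "digit_measure N B n =
     distr (measure_pmf (pmf_of_set (B n))) borel (\<lambda>d. real d / real (\<Prod>i\<le>n. N i))"

lemma emeasure_digit_measure:
  assumes "finite (B n)" "B n \<noteq> {}" "A \<in> sets borel"
  shows "emeasure (digit_measure N B n) A =
    (\<Sum>d\<in>B n. ennreal (1 / real (card (B n))) *
       emeasure (return borel (real d / real (\<Prod>i\<le>n. N i))) A)"
proof -
  let ?f = "\<lambda>d. real d / real (\<Prod>i\<le>n. N i)"
  have "emeasure (digit_measure N B n) A =
      (\<integral>\<^sup>+ d. indicator A (?f d) \<partial>measure_pmf (pmf_of_set (B n)))"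
    using assms by (subst nn_integral_distr[symmetric, of ?f _ borel])
      (auto simp: digit_measure_def simp del: of_nat_prod)
  also have "\<dots> = (\<Sum>d\<in>B n. indicator A (?f d) * ennreal (pmf (pmf_of_set (B n)) d))"
    using assms by (subst nn_integral_measure_pmf_finite) auto
  also have "\<dots> = (\<Sum>d\<in>B n. ennreal (1 / real (card (B n))) * emeasure (return borel (?f d)) A)"
    using assms by (intro sum.cong) (auto simp: mult.commute)
  finally show ?thesis .
qed

definition is_cantor_moran_measure ::
    "(nat \<Rightarrow> nat) \<Rightarrow> (nat \<Rightarrow> nat set) \<Rightarrow> real measure \<Rightarrow> bool" where
  "is_cantor_moran_measure N B \<mu> \<longleftrightarrow> has_infinite_convolution (digit_measure N B) \<mu>"


section \<open>Hausdorff dimension\<close>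

text \<open>
  \<open>diam(U)\<^sup>s\<close> with the conventions \<open>diam(\<emptyset>)\<^sup>s = 0\<close> and \<open>diam(U)\<^sup>0 = 1\<close> for \<open>U \<noteq> \<emptyset>\<close>; the
  case \<open>s = 0\<close> is separate because \<open>0 powr 0 = 0\<close>.
\<close>

definition diameter_power :: "real \<Rightarrow> 'a::metric_space set \<Rightarrow> ennreal" where
  "diameter_power s U =
     (if U = {} then 0 else if s = 0 then 1 else ennreal (diameter U powr s))"

text \<open>Boundedness of the covering sets is explicit: \<open>diameter\<close> is meaningless on unbounded sets.\<close>

definition hausdorff_premeasure :: "real \<Rightarrow> real \<Rightarrow> 'a::metric_space set \<Rightarrow> ennreal" where
  "hausdorff_premeasure s \<delta> E =
     (INF U \<in> {U :: nat \<Rightarrow> 'a set. E \<subseteq> (\<Union>i. U i) \<and> (\<forall>i. bounded (U i) \<and> diameter (U i) \<le> \<delta>)}.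
        \<Sum>i. diameter_power s (U i))"

definition hausdorff_measure :: "real \<Rightarrow> 'a::metric_space set \<Rightarrow> ennreal" where
  "hausdorff_measure s E = (SUP \<delta>\<in>{0<..}. hausdorff_premeasure s \<delta> E)"

text \<open>
  Restricted to subsets of the line, where every \<open>s > 1\<close> belongs to the set below, so that the
  real-valued infimum is the true one.
\<close>

definition hausdorff_dim :: "real set \<Rightarrow> real" where
  "hausdorff_dim E = Inf {s. 0 \<le> s \<and> hausdorff_measure s E = 0}"


section \<open>Fourier dimension and Salem sets\<close>

definition fourier_transform :: "real measure \<Rightarrow> real \<Rightarrow> complex" where
  "fourier_transform \<mu> \<xi> = (CLINT x|\<mu>. iexp (- 2 * pi * \<xi> * x))"

definition fourier_dim_measure :: "real measure \<Rightarrow> real" where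
  "fourier_dim_measure \<mu> =
     Sup {t \<in> {0..1}. \<exists>C>0. \<forall>\<xi>. cmod (fourier_transform \<mu> \<xi>) \<le> C * (1 + \<bar>\<xi>\<bar>) powr (- t / 2)}"

text \<open>
  A probability measure is supported on a Borel set \<open>E\<close> if it gives \<open>E\<close> full mass; for closed \<open>E\<close>
  this says that the topological support is contained in \<open>E\<close>.  The supremum is meaningful for
  nonempty \<open>E\<close>, which carries point masses.
\<close>

definition fourier_dim :: "real set \<Rightarrow> real" where
  "fourier_dim E = Sup {fourier_dim_measure \<mu> | \<mu>. real_distribution \<mu> \<and> emeasure \<mu> E = 1}"

definition salem_set :: "real set \<Rightarrow> bool" where
  "salem_set E \<longleftrightarrow> E \<in> sets borel \<and> fourier_dim E = hausdorff_dim E"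


section \<open>Spectral measures\<close>

definition square_integrable :: "'a measure \<Rightarrow> ('a \<Rightarrow> complex) \<Rightarrow> bool" where
  "square_integrable M f \<longleftrightarrow> f \<in> borel_measurable M \<and> integrable M (\<lambda>x. (cmod (f x))\<^sup>2)"

definition L2_inner :: "'a measure \<Rightarrow> ('a \<Rightarrow> complex) \<Rightarrow> ('a \<Rightarrow> complex) \<Rightarrow> complex" where
  "L2_inner M f g = (CLINT x|M. f x * cnj (g x))"

text \<open>
  An orthonormal basis of \<open>L\<^sup>2(M)\<close>, as an indexed family: orthonormal, with linear span dense in
  the \<open>L\<^sup>2\<close> norm.  Elements of \<open>L\<^sup>2(M)\<close> are represented by functions, not by classes modulo null sets.
\<close>

definition orthonormal_basis_L2 :: "'a measure \<Rightarrow> 'i set \<Rightarrow> ('i \<Rightarrow> 'a \<Rightarrow> complex) \<Rightarrow> bool" where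
  "orthonormal_basis_L2 M I e \<longleftrightarrow>
     (\<forall>i\<in>I. square_integrable M (e i)) \<and>
     (\<forall>i\<in>I. \<forall>j\<in>I. L2_inner M (e i) (e j) = (if i = j then 1 else 0)) \<and>
     (\<forall>f. square_integrable M f \<longrightarrow>
        (\<forall>\<epsilon>>0. \<exists>F c. finite F \<and> F \<subseteq> I \<and>
           sqrt (LINT x|M. (cmod (f x - (\<Sum>i\<in>F. c i * e i x)))\<^sup>2) < \<epsilon>))"

definition is_spectrum :: "real measure \<Rightarrow> real set \<Rightarrow> bool" where
  "is_spectrum \<mu> \<Lambda> \<longleftrightarrow>
     countable \<Lambda> \<and> orthonormal_basis_L2 \<mu> \<Lambda> (\<lambda>\<xi> x. iexp (2 * pi * \<xi> * x))"

definition spectral_measure :: "real measure \<Rightarrow> bool" where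
  "spectral_measure \<mu> \<longleftrightarrow> real_distribution \<mu> \<and> (\<exists>\<Lambda>. is_spectrum \<mu> \<Lambda>)"

end

theory Submission
  imports Defs "HOL-Real_Asymp.Real_Asymp"
begin

text \<open>
  Take \<open>N\<^sub>n\<close> growing so fast that \<open>N\<^sub>1 \<cdots> N\<^sub>n\<^sub>-\<^sub>1\<close> is negligible against \<open>N\<^sub>n\<close>, and let \<open>B\<^sub>n\<close> be a complete
  residue system modulo a divisor \<open>M\<^sub>n \<approx> N\<^sub>n\<^sup>s\<close> of \<open>N\<^sub>n\<close>, with representatives chosen so that the
  normalised exponential sum over \<open>B\<^sub>n\<close> (its mask) differs from that over \<open>{0, \<dots>, N\<^sub>n - 1}\<close> by
  \<open>O((log N\<^sub>n / M\<^sub>n)\<^sup>1\<^sup>/\<^sup>2)\<close> uniformly; random representatives have this property.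

  For \<open>\<bar>\<xi>\<bar>\<close> between \<open>N\<^sub>1 \<cdots> N\<^sub>n\<^sub>-\<^sub>1 / 2\<close> and \<open>N\<^sub>1 \<cdots> N\<^sub>n / 2\<close> the factors number \<open>n - 1\<close> and \<open>n\<close> of the product
  formula for the Fourier transform of \<open>\<mu>\<close> already give decay of every order below \<open>s\<close>.  Decay of order
  \<open>t\<close> of a measure on \<open>K\<close> forces \<open>t \<le> dim\<^sub>H K\<close>, and the obvious coverings give \<open>dim\<^sub>H K \<le> s\<close>; so all
  dimensions equal \<open>s\<close>.

  Being a residue system, \<open>B\<^sub>n\<close> forms a Hadamard triple with \<open>N\<^sub>n\<close> and the multiples of \<open>N\<^sub>n / M\<^sub>n\<close> in
  \<open>[-N\<^sub>n / 2, N\<^sub>n / 2)\<close>.  Since the tails of the convolution are close to Lebesgue measure on \<open>[0, 1]\<close>,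
  whose transform does not vanish on \<open>[-2 / 3, 2 / 3]\<close>, the Parseval identities of the finite levels
  survive in the limit and the frequencies generated by these triples form a spectrum.
\<close>

text \<open>Decay and spectrality pull in opposite directions: decay wants irregular digits, a
  spectrum wants arithmetic structure. They are compatible because the orthogonality relations see a
  digit only modulo M_n, so the representative of each residue remains free.

  A single factor cannot give decay, since a mask is periodic and returns to 1 at every integer;
  hence the use of two consecutive factors. The error of the choice at level n has order sqrt (log
  N_n) N_n^(-s/2), whereas decay is measured against the whole product N_1 ... N_n. With N_n =
  2^(n!) the earlier factors cost an arbitrarily small power only. Powers of 2 offer suitable
  divisors for every s; for s = 1 the digit sets are complete and \<mu> is Lebesgue measure on
  [0, 1].

  Hadamard triples alone give orthogonality but not completeness, because Parseval mass may escape
  to high frequencies. Centred frequencies keep every level inside a fixed window, on which the rest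
  of the product has a uniform lower bound.\<close>

section \<open>Fourier decay and Hausdorff measure\<close>

text \<open>The Gaussian kernel is itself the characteristic function of the standard normal law, so
  Fubini alone turns the energy into an average of |char|^2, without Fourier inversion or a singular
  Riesz kernel.\<close>

lemma gaussian_energy_eq:
  fixes a :: real
  assumes "real_distribution \<nu>"
  shows "(\<integral>\<^sup>+x. \<integral>\<^sup>+y. ennreal (exp (- (a * (x - y))\<^sup>2 / 2)) \<partial>\<nu> \<partial>\<nu>) =
    (\<integral>\<^sup>+\<eta>. ennreal ((cmod (char \<nu> (a * \<eta>)))\<^sup>2) \<partial>std_normal_distribution)"
proof -
  let ?N = std_normal_distribution
  interpret \<nu>: real_distribution \<nu> by fact
  interpret N: real_distribution ?N by (rule real_dist_normal_dist)
  interpret P: pair_sigma_finite \<nu> ?N ..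
  interpret PP: prob_space "\<nu> \<Otimes>\<^sub>M ?N"
    by (intro prob_space_pair) unfold_locales
  have [measurable_cong]: "sets ?N = sets borel" by simp
  let ?f = "\<lambda>x y. exp (- (a * (x - y))\<^sup>2 / 2)"
  have f_char: "complex_of_real (?f x y) = (CLINT \<eta>|?N. iexp (a * x * \<eta>) * iexp (- a * y * \<eta>))" for x y
  proof -
    have "complex_of_real (?f x y) = char ?N (a * (x - y))"
      by (simp add: char_std_normal_distribution)
    also have "\<dots> = (CLINT \<eta>|?N. iexp (a * x * \<eta>) * iexp (- a * y * \<eta>))"
      unfolding char_def by (intro Bochner_Integration.integral_cong) (auto simp: exp_add[symmetric] algebra_simps)
    finally show ?thesis .
  qed
  have int1: "integrable (\<nu> \<Otimes>\<^sub>M ?N) (\<lambda>(y, \<eta>). iexp (a * x * \<eta>) * iexp (- a * y * \<eta>))" for x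
    by (rule PP.integrable_const_bound[where B = 1]) (auto simp: norm_mult split_beta)
  have inner: "(CLINT y|\<nu>. complex_of_real (?f x y)) = (CLINT \<eta>|?N. iexp (a * x * \<eta>) * char \<nu> (- a * \<eta>))" for x
  proof -
    have "(CLINT y|\<nu>. complex_of_real (?f x y)) =
        (CLINT y|\<nu>. CLINT \<eta>|?N. iexp (a * x * \<eta>) * iexp (- a * y * \<eta>))"
      by (simp only: f_char)
    also have "\<dots> = (CLINT \<eta>|?N. CLINT y|\<nu>. iexp (a * x * \<eta>) * iexp (- a * y * \<eta>))"
      by (rule P.Fubini_integral[OF int1, symmetric])
    also have "\<dots> = (CLINT \<eta>|?N. iexp (a * x * \<eta>) * char \<nu> (- a * \<eta>))"
      unfolding char_def by (simp add: mult_ac)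
    finally show ?thesis .
  qed
  have int2: "integrable (\<nu> \<Otimes>\<^sub>M ?N) (\<lambda>(x, \<eta>). iexp (a * x * \<eta>) * char \<nu> (- a * \<eta>))"
    by (rule PP.integrable_const_bound[where B = 1])
       (use \<nu>.cmod_char_le_1 in \<open>auto simp: norm_mult split_beta\<close>)
  have "(CLINT x|\<nu>. CLINT y|\<nu>. complex_of_real (?f x y)) =
      (CLINT x|\<nu>. CLINT \<eta>|?N. iexp (a * x * \<eta>) * char \<nu> (- a * \<eta>))"
    by (simp only: inner)
  also have "\<dots> = (CLINT \<eta>|?N. CLINT x|\<nu>. iexp (a * x * \<eta>) * char \<nu> (- a * \<eta>))"
    by (rule P.Fubini_integral[OF int2, symmetric])
  also have "\<dots> = (CLINT \<eta>|?N. char \<nu> (a * \<eta>) * char \<nu> (- a * \<eta>))"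
    unfolding char_def by (simp add: mult_ac)
  also have "\<dots> = (CLINT \<eta>|?N. complex_of_real ((cmod (char \<nu> (a * \<eta>)))\<^sup>2))"
  proof (intro Bochner_Integration.integral_cong refl)
    fix \<eta> :: real
    have "char \<nu> (- a * \<eta>) = cnj (char \<nu> (a * \<eta>))"
    proof -
      have "iexp (- a * \<eta> * x) = cnj (iexp (a * \<eta> * x))" for x by (simp add: exp_cnj)
      then show ?thesis unfolding char_def by (simp only: Bochner_Integration.integral_cnj)
    qed
    then show "char \<nu> (a * \<eta>) * char \<nu> (- a * \<eta>) = complex_of_real ((cmod (char \<nu> (a * \<eta>)))\<^sup>2)"
      by (simp only: complex_norm_square)
  qed
  finally have eq: "(LINT x|\<nu>. LINT y|\<nu>. ?f x y) = (LINT \<eta>|?N. (cmod (char \<nu> (a * \<eta>)))\<^sup>2)"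
    by (simp only: integral_complex_of_real of_real_eq_iff)
  have inty: "integrable \<nu> (\<lambda>y. ?f x y)" for x
    by (rule \<nu>.integrable_const_bound[where B = 1]) auto
  have intx: "integrable \<nu> (\<lambda>x. LINT y|\<nu>. ?f x y)"
  proof (rule \<nu>.integrable_const_bound[where B = 1])
    show "AE x in \<nu>. norm (LINT y|\<nu>. ?f x y) \<le> 1"
    proof (rule AE_I2)
      fix x
      have "norm (LINT y|\<nu>. ?f x y) \<le> (LINT y|\<nu>. norm (?f x y))"
        by (rule integral_norm_bound)
      also have "\<dots> \<le> (LINT y|\<nu>. 1)"
        by (rule integral_mono) (use inty in auto)
      finally show "norm (LINT y|\<nu>. ?f x y) \<le> 1" using \<nu>.prob_space by simp
    qed
  qed measurable
  have "(\<integral>\<^sup>+x. \<integral>\<^sup>+y. ennreal (?f x y) \<partial>\<nu> \<partial>\<nu>) = (\<integral>\<^sup>+x. ennreal (LINT y|\<nu>. ?f x y) \<partial>\<nu>)"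
    by (intro nn_integral_cong nn_integral_eq_integral inty) auto
  also have "\<dots> = ennreal (LINT x|\<nu>. LINT y|\<nu>. ?f x y)"
    by (intro nn_integral_eq_integral intx) auto
  also have "\<dots> = (\<integral>\<^sup>+\<eta>. ennreal ((cmod (char \<nu> (a * \<eta>)))\<^sup>2) \<partial>?N)"
    unfolding eq
  proof (intro nn_integral_eq_integral[symmetric] N.integrable_const_bound[where B = 1])
    show "AE \<eta> in ?N. norm ((cmod (char \<nu> (a * \<eta>)))\<^sup>2) \<le> 1"
      using \<nu>.cmod_char_le_1 by (auto simp: power_le_one)
  qed auto
  finally show ?thesis .
qed

text \<open>This is the finiteness needed when |char|^2 in the Gaussian average is bounded by a
  multiple of |\<eta>|^(-t); t < 1 gives integrability at 0.\<close>

lemma std_normal_negative_moment_finite: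
  fixes t :: real
  assumes "0 \<le> t" "t < 1"
  shows "(\<integral>\<^sup>+\<eta>. ennreal (\<bar>\<eta>\<bar> powr (- t)) \<partial>std_normal_distribution) < \<infinity>"
proof -
  \<comment> \<open>\<open>g\<close> and its reflection dominate on |x| \<le> 1, where the density
    is at most 1; the density itself dominates on |x| > 1, where |x|^(-t) \<le> 1.\<close>
  define g where "g x = (if x \<in> {0..1} then x powr (- t) else 0)" for x :: real
  have [measurable]: "g \<in> borel_measurable borel" unfolding g_def by measurable
  have g_nonneg: "0 \<le> g x" for x by (simp add: g_def)
  have "((\<lambda>x. x powr (- t)) has_integral (1 powr (- t + 1) / (- t + 1))) {0..1}"
    by (rule has_integral_powr_from_0) (use assms in auto)
  then have "(g has_integral (1 powr (- t + 1) / (- t + 1))) UNIV"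
    unfolding g_def by (simp only: has_integral_restrict_UNIV)
  then have g: "(\<integral>\<^sup>+x. ennreal (g x) \<partial>lborel) = ennreal (1 powr (- t + 1) / (- t + 1))"
    using nn_integral_has_integral_lborel[of g] g_nonneg by simp
  have g': "(\<integral>\<^sup>+x. ennreal (g (- x)) \<partial>lborel) = (\<integral>\<^sup>+x. ennreal (g x) \<partial>lborel)"
    using nn_integral_real_affine[of "\<lambda>x. ennreal (g x)" "-1" 0] by simp
  have "std_normal_density x \<le> 1" for x
  proof -
    have "exp (- x\<^sup>2 / 2) \<le> 1" "sqrt (2 * pi) \<ge> 1" using pi_gt3 by auto
    then show ?thesis unfolding std_normal_density_def
      by (metis (no_types, opaque_lifting) div_by_1 divide_right_mono frac_le mult.right_neutral mult_left_le
        mult_le_one one_le_numeral order_trans real_sqrt_ge_zero times_divide_eq_left zero_le_one zero_le_divide_1_iff exp_ge_zero less_eq_real_def zero_less_one)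
  qed
  then have le: "ennreal (std_normal_density x) * ennreal (\<bar>x\<bar> powr (- t)) \<le>
      ennreal (g x) + ennreal (g (- x)) + ennreal (std_normal_density x)" for x
  proof (cases "\<bar>x\<bar> \<le> 1")
    case True
    have "std_normal_density x * \<bar>x\<bar> powr (- t) \<le> \<bar>x\<bar> powr (- t)"
      using \<open>\<And>x. std_normal_density x \<le> 1\<close>[of x] by (simp add: mult_left_le_one_le)
    also have "\<dots> \<le> g x + g (- x)"
      using True by (cases "x \<ge> 0") (auto simp: g_def abs_if)
    also have "\<dots> \<le> g x + g (- x) + std_normal_density x" by simp
    finally show ?thesis
      by (simp add: g_nonneg flip: ennreal_mult' ennreal_plus)
  next
    case False
    then have "\<bar>x\<bar> powr (- t) \<le> 1" using assms by (auto simp: powr_minus inverse_le_1_iff ge_one_powr_ge_zero)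
    then have "std_normal_density x * \<bar>x\<bar> powr (- t) \<le> std_normal_density x"
      by (simp add: mult_left_le)
    then have "std_normal_density x * \<bar>x\<bar> powr (- t) \<le> g x + g (- x) + std_normal_density x" by (simp add: g_def add_increasing)
    then show ?thesis
      by (simp add: g_nonneg flip: ennreal_mult' ennreal_plus)
  qed
  have "(\<integral>\<^sup>+\<eta>. ennreal (\<bar>\<eta>\<bar> powr (- t)) \<partial>std_normal_distribution) =
      (\<integral>\<^sup>+x. ennreal (std_normal_density x) * ennreal (\<bar>x\<bar> powr (- t)) \<partial>lborel)"
    by (subst nn_integral_density) auto
  also have "\<dots> \<le> (\<integral>\<^sup>+x. ennreal (g x) + ennreal (g (- x)) + ennreal (std_normal_density x) \<partial>lborel)"
    by (intro nn_integral_mono le)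
  also have "\<dots> = (\<integral>\<^sup>+x. ennreal (g x) \<partial>lborel) + (\<integral>\<^sup>+x. ennreal (g x) \<partial>lborel) + (\<integral>\<^sup>+x. ennreal (std_normal_density x) \<partial>lborel)"
    by (subst nn_integral_add; simp add: g')+
  also have "(\<integral>\<^sup>+x. ennreal (std_normal_density x) \<partial>lborel) = 1"
    using prob_space.emeasure_space_1[OF prob_space_normal_density[of 1 0]]
    by (simp add: emeasure_density)
  finally show ?thesis unfolding g by (auto simp: ennreal_add_eq_top top.not_eq_extremum order_le_less_trans simp flip: ennreal_plus)
qed

lemma fourier_transform_eq_char: "fourier_transform \<mu> \<xi> = char \<mu> (- 2 * pi * \<xi>)"
  unfolding fourier_transform_def char_def by simp

text \<open>
  A Frostman-type estimate: Fourier decay of order \<open>t\<close> makes the sum of Gaussian energies of \<open>\<nu>\<close> at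
  the scales \<open>2\<^sup>-\<^sup>k\<close>, weighted by \<open>2\<^sup>k\<^sup>s\<close>, finite whenever \<open>s < t\<close>; hence the corresponding potential
  is bounded on a set of positive measure.
\<close>
lemma fourier_decay_imp_frostman:
  assumes \<nu>: "real_distribution \<nu>"
    and st: "0 < s" "s < t" "t < 1"
    and decay: "\<And>\<xi>. cmod (fourier_transform \<nu> \<xi>) \<le> C * (1 + \<bar>\<xi>\<bar>) powr (- t / 2)"
  obtains G A where "G \<in> sets borel" "emeasure \<nu> G > 0" "A \<ge> 0"
    "\<And>x r. x \<in> G \<Longrightarrow> 0 \<le> r \<Longrightarrow> r \<le> 1 \<Longrightarrow> emeasure \<nu> (cball x r) \<le> ennreal (A * r powr s)"
proof -
  let ?N = std_normal_distribution
  interpret \<nu>: real_distribution \<nu> by fact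
  interpret N: real_distribution ?N by (rule real_dist_normal_dist)
  define M where "M = (\<integral>\<^sup>+\<eta>. ennreal (\<bar>\<eta>\<bar> powr (- t)) \<partial>?N)"
  have M: "M < \<infinity>" unfolding M_def by (rule std_normal_negative_moment_finite) (use st in auto)
  define g where "g k x = (\<integral>\<^sup>+y. ennreal (exp (- (2 ^ k * (x - y))\<^sup>2 / 2)) \<partial>\<nu>)" for k :: nat and x :: real
  define h where "h x = (\<Sum>k. ennreal (2 powr (s * k)) * g k x)" for x
  have [measurable]: "g k \<in> borel_measurable borel" for k
    unfolding g_def by measurable
  have [measurable]: "h \<in> borel_measurable borel"
    unfolding h_def by measurable
  have C: "C \<ge> 0" using decay[of 0] by (simp add: order_trans[OF norm_ge_zero])
  \<comment> \<open>The factor (2 \<pi>)^t converts the frequency of \<open>char\<close> into that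
    of \<open>fourier_transform\<close>.\<close>
  define C' where "C' = C\<^sup>2 * (2 * pi) powr t"
  have C': "C' \<ge> 0" by (simp add: C'_def)
  have energy: "(\<integral>\<^sup>+x. g k x \<partial>\<nu>) \<le> ennreal (C' * 2 powr (- t * k)) * M" for k
  proof -
    have "(\<integral>\<^sup>+x. g k x \<partial>\<nu>) = (\<integral>\<^sup>+\<eta>. ennreal ((cmod (char \<nu> (2 ^ k * \<eta>)))\<^sup>2) \<partial>?N)"
      unfolding g_def by (rule gaussian_energy_eq[OF \<nu>])
    also have "\<dots> \<le> (\<integral>\<^sup>+\<eta>. ennreal (C' * 2 powr (- t * k)) * ennreal (\<bar>\<eta>\<bar> powr (- t)) \<partial>?N)"
    proof (rule nn_integral_mono_AE)
      have "AE \<eta> in lborel. \<eta> \<noteq> (0::real)" by (rule AE_lborel_singleton)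
      then have "AE \<eta> in ?N. \<eta> \<noteq> 0" by (subst AE_density) auto
      then show "AE \<eta> in ?N. ennreal ((cmod (char \<nu> (2 ^ k * \<eta>)))\<^sup>2) \<le>
          ennreal (C' * 2 powr (- t * k)) * ennreal (\<bar>\<eta>\<bar> powr (- t))"
      proof eventually_elim
        case (elim \<eta>)
        define u where "u = 2 ^ k * \<bar>\<eta>\<bar> / (2 * pi)"
        have u: "u > 0" using elim by (simp add: u_def)
        have "cmod (char \<nu> (2 ^ k * \<eta>)) \<le> C * (1 + u) powr (- t / 2)"
          using decay[of "- (2 ^ k * \<eta>) / (2 * pi)"] by (simp add: fourier_transform_eq_char u_def abs_mult)
        also have "\<dots> \<le> C * u powr (- t / 2)"
          using u st C by (intro mult_left_mono powr_mono2') auto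
        finally have "(cmod (char \<nu> (2 ^ k * \<eta>)))\<^sup>2 \<le> (C * u powr (- t / 2))\<^sup>2"
          by (intro power_mono) auto
        also have "\<dots> = C\<^sup>2 * u powr (- t)"
          by (simp add: power_mult_distrib power2_eq_square flip: powr_add)
        also have "u powr (- t) = 2 powr (- t * k) * \<bar>\<eta>\<bar> powr (- t) * (2 * pi) powr t"
        proof -
          have "u powr (- t) = (2 ^ k) powr (- t) * \<bar>\<eta>\<bar> powr (- t) / (2 * pi) powr (- t)"
            unfolding u_def by (simp add: powr_divide powr_mult)
          also have "(2 ^ k) powr (- t) = (2 :: real) powr (- t * k)"
            by (simp add: powr_powr mult.commute flip: powr_realpow)
          also have "\<dots> * \<bar>\<eta>\<bar> powr (- t) / (2 * pi) powr (- t) = \<dots> * \<bar>\<eta>\<bar> powr (- t) * (2 * pi) powr t"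
            by (simp add: powr_minus divide_simps)
          finally show ?thesis .
        qed
        finally show ?case using C'
          by (simp add: C'_def mult_ac flip: ennreal_mult' )
      qed
    qed
    also have "\<dots> = ennreal (C' * 2 powr (- t * k)) * M"
      unfolding M_def by (subst nn_integral_cmult) auto
    finally show ?thesis .
  qed
  have "(\<integral>\<^sup>+x. h x \<partial>\<nu>) = (\<Sum>k. ennreal (2 powr (s * k)) * (\<integral>\<^sup>+x. g k x \<partial>\<nu>))"
    unfolding h_def by (subst nn_integral_suminf) (auto simp: nn_integral_cmult)
  also have "\<dots> \<le> (\<Sum>k. ennreal (C' * (2 powr (s - t)) ^ k) * M)"
  proof (intro suminf_le allI summableI)
    fix k
    have "ennreal (2 powr (s * k)) * (\<integral>\<^sup>+x. g k x \<partial>\<nu>) \<le>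
        ennreal (2 powr (s * k)) * (ennreal (C' * 2 powr (- t * k)) * M)"
      by (intro mult_left_mono energy) auto
    also have "\<dots> = ennreal (2 powr (s * k) * (C' * 2 powr (- t * k))) * M"
      using C' by (simp add: ennreal_mult mult.assoc)
    also have "2 powr (s * k) * (C' * 2 powr (- t * k)) = C' * (2 powr (s - t)) ^ k"
      by (simp add: powr_realpow[symmetric] powr_powr powr_add[symmetric] right_diff_distrib mult.left_commute[of _ C'] mult.commute[of _ "real k"])
    finally show "ennreal (2 powr (s * k)) * (\<integral>\<^sup>+x. g k x \<partial>\<nu>) \<le> ennreal (C' * (2 powr (s - t)) ^ k) * M" .
  qed
  also have "\<dots> = (\<Sum>k. ennreal (C' * (2 powr (s - t)) ^ k)) * M"
    by simp
  also have "(\<Sum>k. ennreal (C' * (2 powr (s - t)) ^ k)) < \<infinity>"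
  proof -
    have "2 powr (s - t) < 2 powr 0" using st by (subst powr_less_cancel_iff) auto
    then have "summable (\<lambda>k. C' * (2 powr (s - t)) ^ k)"
      by (intro summable_mult summable_geometric) auto
    then have "(\<Sum>k. ennreal (C' * (2 powr (s - t)) ^ k)) = ennreal (\<Sum>k. C' * (2 powr (s - t)) ^ k)"
      using C' by (intro suminf_ennreal2) auto
    then show ?thesis by simp
  qed
  then have "(\<Sum>k. ennreal (C' * (2 powr (s - t)) ^ k)) * M < \<infinity>"
    using M by (simp add: ennreal_mult_less_top)
  finally have "(\<integral>\<^sup>+x. h x \<partial>\<nu>) \<noteq> \<infinity>" by simp
  then have fin: "AE x in \<nu>. h x \<noteq> \<infinity>"
    by (intro nn_integral_PInf_AE) auto
  \<comment> \<open>\<open>h\<close> is finite almost everywhere, so its sublevel sets exhaust \<nu>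
    up to a null set and one of them has positive mass.\<close>
  define G where "G n = {x. h x \<le> of_nat n}" for n :: nat
  have [measurable]: "G n \<in> sets borel" for n unfolding G_def by measurable
  have "\<exists>n. emeasure \<nu> (G n) > 0"
  proof (rule ccontr)
    assume "\<not> ?thesis"
    then have "AE x in \<nu>. x \<notin> G n" for n
      by (intro AE_not_in) (auto simp: null_sets_def)
    then have "AE x in \<nu>. \<forall>n. x \<notin> G n" by (simp add: AE_all_countable)
    with fin have "AE x in \<nu>. False"
    proof eventually_elim
      case (elim x)
      then obtain n where "h x < of_nat n" using ennreal_Ex_less_of_nat[of "h x"] by (auto simp: less_top)
      with elim show ?case by (auto simp: G_def dest: less_imp_le)
    qed
    then show False by simp
  qed
  then obtain n where n: "emeasure \<nu> (G n) > 0" by blast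
  \<comment> \<open>On the ball of radius 2^(-k) the Gaussian of scale 2^(-k) is at least exp
    (-1/2).\<close>
  define A0 where "A0 = exp (1 / 2) * real n"
  have dyadic: "emeasure \<nu> (cball x (1 / 2 ^ k)) \<le> ennreal (A0 * 2 powr (- s * k))" if "x \<in> G n" for x k
  proof -
    have "emeasure \<nu> (cball x (1 / 2 ^ k)) = (\<integral>\<^sup>+y. indicator (cball x (1 / 2 ^ k)) y \<partial>\<nu>)"
      by simp
    also have "\<dots> \<le> (\<integral>\<^sup>+y. ennreal (exp (1 / 2)) * ennreal (exp (- (2 ^ k * (x - y))\<^sup>2 / 2)) \<partial>\<nu>)"
    proof (intro nn_integral_mono)
      fix y
      show "indicator (cball x (1 / 2 ^ k)) y \<le>
          ennreal (exp (1 / 2)) * ennreal (exp (- (2 ^ k * (x - y))\<^sup>2 / 2))"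
      proof (cases "y \<in> cball x (1 / 2 ^ k)")
        case True
        then have "\<bar>2 ^ k * (x - y)\<bar> \<le> 1"
          by (simp add: dist_real_def abs_mult pos_le_divide_eq mult.commute)
        then have "(2 ^ k * (x - y))\<^sup>2 \<le> 1" by (simp add: abs_square_le_1)
        then have "1 \<le> exp (1 / 2) * exp (- (2 ^ k * (x - y))\<^sup>2 / 2)"
          by (simp flip: exp_add)
        with True show ?thesis by (simp flip: ennreal_mult')
      qed simp
    qed
    also have "\<dots> = ennreal (exp (1 / 2)) * g k x"
      unfolding g_def by (subst nn_integral_cmult) auto
    also have "g k x = ennreal (2 powr (- s * k)) * (ennreal (2 powr (s * k)) * g k x)"
      by (simp add: mult.assoc[symmetric] ennreal_mult'[symmetric] powr_add[symmetric])
    also have "ennreal (2 powr (s * k)) * g k x \<le> of_nat n"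
    proof -
      have "ennreal (2 powr (s * k)) * g k x \<le> h x"
        unfolding h_def using sum_le_suminf[of "\<lambda>k. ennreal (2 powr (s * k)) * g k x" "{k}"] by auto
      also have "h x \<le> of_nat n" using that by (simp add: G_def)
      finally show ?thesis .
    qed
    then have "ennreal (exp (1 / 2)) * (ennreal (2 powr (- s * k)) * (ennreal (2 powr (s * k)) * g k x)) \<le>
        ennreal (exp (1 / 2)) * (ennreal (2 powr (- s * k)) * of_nat n)"
      by (intro mult_left_mono) auto
    also have "\<dots> = ennreal (A0 * 2 powr (- s * k))"
      by (simp add: A0_def mult_ac ennreal_mult' flip: ennreal_of_nat_eq_real_of_nat)
    finally show ?thesis .
  qed
  have A0: "A0 \<ge> 0" by (simp add: A0_def)
  show ?thesis
  proof
    show "G n \<in> sets borel" "emeasure \<nu> (G n) > 0" using n by auto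
    show "A0 * 2 powr s \<ge> 0" using A0 by simp
    fix x r :: real
    assume x: "x \<in> G n" and r: "0 \<le> r" "r \<le> 1"
    show "emeasure \<nu> (cball x r) \<le> ennreal (A0 * 2 powr s * r powr s)"
    \<comment> \<open>As \<open>0 powr s = 0\<close>, radius 0 demands that points of
      \<open>G n\<close> carry no mass; this is the limit of the dyadic estimate.\<close>
    proof (cases "r = 0")
      case True
      have "emeasure \<nu> (cball x r) \<le> 0"
      proof (rule LIMSEQ_le_const)
        have "2 powr (- s) < 2 powr 0" using st by (subst powr_less_cancel_iff) auto
        then have "(\<lambda>k. A0 * (2 powr (- s)) ^ k) \<longlonglongrightarrow> A0 * 0"
          by (intro tendsto_intros LIMSEQ_power_zero) auto
        then have "(\<lambda>k. ennreal (A0 * (2 powr (- s)) ^ k)) \<longlonglongrightarrow> ennreal (A0 * 0)"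
          by (rule tendsto_ennrealI)
        then show "(\<lambda>k. ennreal (A0 * 2 powr (- s * real k))) \<longlonglongrightarrow> 0"
          by (simp add: powr_realpow[symmetric] powr_powr)
        have "emeasure \<nu> (cball x r) \<le> emeasure \<nu> (cball x (1 / 2 ^ k))" for k
          using True by (intro emeasure_mono) auto
        then have "emeasure \<nu> (cball x r) \<le> ennreal (A0 * 2 powr (- s * k))" for k :: nat
          using dyadic[OF x, of k] order_trans by blast
        then show "\<exists>N. \<forall>k\<ge>N. emeasure \<nu> (cball x r) \<le> ennreal (A0 * 2 powr (- s * real k))"
          by blast
      qed
      then show ?thesis by simp
    next
      case False
      then have r0: "0 < r" using r by simp
      \<comment> \<open>Rounding r up to the dyadic radius 2^(-k) \<le> 2 r costs the factor
        2^s.\<close>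
      define k where "k = nat \<lfloor>log 2 (1 / r)\<rfloor>"
      have "0 \<le> log 2 (1 / r)" using r r0 by simp
      then have k: "real k \<le> log 2 (1 / r)" "log 2 (1 / r) \<le> real k + 1"
        unfolding k_def by linarith+
      have "2 powr real k \<le> 2 powr log 2 (1 / r)" by (rule powr_mono) (use k in auto)
      then have k1: "2 ^ k \<le> 1 / r" using r0 by (simp add: powr_realpow)
      have "2 powr log 2 (1 / r) \<le> 2 powr (real k + 1)" by (rule powr_mono) (use k in auto)
      then have k2: "1 / r \<le> 2 * 2 ^ k" using r0 by (simp add: powr_realpow powr_add)
      have "emeasure \<nu> (cball x r) \<le> emeasure \<nu> (cball x (1 / 2 ^ k))"
      proof (intro emeasure_mono subset_cball)
        show "r \<le> 1 / 2 ^ k" using k1 r0 by (simp add: field_simps)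
      qed simp
      also have "\<dots> \<le> ennreal (A0 * 2 powr (- s * k))" by (rule dyadic[OF x])
      also have "\<dots> \<le> ennreal (A0 * 2 powr s * r powr s)"
      proof -
        have "2 powr (- s * k) = (1 / 2 ^ k) powr s"
          by (simp add: powr_realpow[symmetric] powr_powr powr_divide powr_minus divide_simps mult.commute)
        also have "\<dots> \<le> (2 * r) powr s"
          using k2 r0 st by (intro powr_mono2) (auto simp: field_simps)
        also have "\<dots> = 2 powr s * r powr s" using r0 by (simp add: powr_mult)
        finally show ?thesis using A0 by (intro ennreal_leI) (simp add: mult.assoc mult_left_mono)
      qed
      finally show ?thesis .
    qed
  qed
qed


text \<open>Mass distribution principle with the ball estimate available only at centres in
  \<open>G\<close>: covering sets that miss \<open>G\<close> are dropped, and the others are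
  replaced by closed balls centred in \<open>G\<close>, which are also measurable.\<close>

lemma frostman_imp_hausdorff_measure_pos:
  assumes \<nu>: "real_distribution \<nu>" and E: "emeasure \<nu> E = 1" and s: "0 < s"
    and G: "G \<in> sets borel" "emeasure \<nu> G > 0"
    and A: "\<And>x r. x \<in> G \<Longrightarrow> 0 \<le> r \<Longrightarrow> r \<le> 1 \<Longrightarrow> emeasure \<nu> (cball x r) \<le> ennreal (A * r powr s)" "A \<ge> 0"
  shows "hausdorff_measure s E \<noteq> 0"
proof
  interpret \<nu>: real_distribution \<nu> by fact
  assume "hausdorff_measure s E = 0"
  have Em: "E \<in> sets \<nu>" using E emeasure_notin_sets by fastforce
  have EG: "emeasure \<nu> (E \<inter> G) = emeasure \<nu> G"
    using \<nu>.prob_space Em E G(1)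
    by (subst Int_commute, intro emeasure_eq_AE)
       (use \<nu>.AE_in_set_eq_1[OF Em] in \<open>auto simp: \<nu>.emeasure_eq_measure\<close>)
  have "hausdorff_premeasure s 1 E \<le> hausdorff_measure s E"
    unfolding hausdorff_measure_def by (rule SUP_upper) simp
  then have pre: "hausdorff_premeasure s 1 E = 0"
    using \<open>hausdorff_measure s E = 0\<close> by simp
  have le: "emeasure \<nu> G \<le> ennreal A * e" if "e > 0" for e
  proof -
    have "hausdorff_premeasure s 1 E < e" using pre that by simp
    then obtain U :: "nat \<Rightarrow> real set" where U: "E \<subseteq> (\<Union>i. U i)"
        "\<And>i. bounded (U i)" "\<And>i. diameter (U i) \<le> 1" "(\<Sum>i. diameter_power s (U i)) < e"
      unfolding hausdorff_premeasure_def INF_less_iff by blast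
    define x where "x i = (SOME x. x \<in> U i \<inter> G)" for i
    define V where "V i = (if U i \<inter> G = {} then {} else cball (x i) (diameter (U i)))" for i
    have x: "x i \<in> U i" "x i \<in> G" if "U i \<inter> G \<noteq> {}" for i
      using someI_ex[of "\<lambda>x. x \<in> U i \<inter> G"] that unfolding x_def by blast+
    have Vm: "V i \<in> sets \<nu>" for i unfolding V_def by auto
    have "E \<inter> G \<subseteq> (\<Union>i. V i)"
    proof
      fix y assume y: "y \<in> E \<inter> G"
      then obtain i where i: "y \<in> U i" using U(1) by blast
      with y have ne: "U i \<inter> G \<noteq> {}" by blast
      have "dist (x i) y \<le> diameter (U i)"
        using diameter_bounded_bound[OF U(2) x(1)[OF ne] i] .
      then show "y \<in> (\<Union>i. V i)" using ne by (auto simp: V_def)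
    qed
    moreover have "(\<Union>i. V i) \<in> sets \<nu>" using Vm by (intro sets.countable_UN) auto
    ultimately have "emeasure \<nu> (E \<inter> G) \<le> emeasure \<nu> (\<Union>i. V i)"
      by (rule emeasure_mono)
    also have "\<dots> \<le> (\<Sum>i. emeasure \<nu> (V i))"
      using Vm by (intro emeasure_subadditive_countably) auto
    also have "\<dots> \<le> (\<Sum>i. ennreal A * diameter_power s (U i))"
    proof (intro suminf_le allI summableI)
      fix i
      show "emeasure \<nu> (V i) \<le> ennreal A * diameter_power s (U i)"
        using A(1)[OF x(2) diameter_ge_0[OF U(2)] U(3)] s A(2)
        by (auto simp: V_def diameter_power_def ennreal_mult')
    qed
    also have "\<dots> = ennreal A * (\<Sum>i. diameter_power s (U i))"
      by simp
    also have "\<dots> \<le> ennreal A * e" using U(4) by (intro mult_left_mono) auto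
    finally show ?thesis by (simp add: EG)
  qed
  have "emeasure \<nu> G \<le> 0"
  proof (rule LIMSEQ_le_const)
    have "(\<lambda>n. ennreal (A * inverse (real (Suc n)))) \<longlonglongrightarrow> ennreal (A * 0)"
      by (intro tendsto_ennrealI tendsto_intros LIMSEQ_inverse_real_of_nat)
    then show "(\<lambda>n. ennreal A * ennreal (inverse (real (Suc n)))) \<longlonglongrightarrow> 0"
      using A(2) by (simp add: ennreal_mult' del: of_nat_Suc)
    show "\<exists>N. \<forall>n\<ge>N. emeasure \<nu> G \<le> ennreal A * ennreal (inverse (real (Suc n)))"
      by (intro exI allI impI le) simp
  qed
  with G(2) show False by simp
qed

text \<open>At exponent 0 every non-empty covering set counts 1, so a total below 1 leaves none.
  This settles the exponent that the Frostman estimate does not cover.\<close>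

lemma hausdorff_measure_0_eq_0D:
  assumes "hausdorff_measure 0 E = 0"
  shows "E = {}"
proof -
  have "hausdorff_premeasure 0 1 E \<le> hausdorff_measure 0 E"
    unfolding hausdorff_measure_def by (rule SUP_upper) simp
  then have "hausdorff_premeasure 0 1 E < 1" using assms by simp
  then obtain U :: "nat \<Rightarrow> _ set" where U: "E \<subseteq> (\<Union>i. U i)" "(\<Sum>i. diameter_power 0 (U i)) < 1"
    unfolding hausdorff_premeasure_def INF_less_iff by blast
  have "U i = {}" for i
  proof (rule ccontr)
    assume "U i \<noteq> {}"
    then have "1 = diameter_power 0 (U i)" by (simp add: diameter_power_def)
    also have "\<dots> \<le> (\<Sum>i. diameter_power 0 (U i))"
      using sum_le_suminf[of "\<lambda>i. diameter_power 0 (U i)" "{i}"] by auto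
    finally show False using U(2) by simp
  qed
  then show ?thesis using U(1) by auto
qed

lemma fourier_decay_le_hausdorff_exponent:
  assumes \<nu>: "real_distribution \<nu>" and E: "emeasure \<nu> E = 1"
    and t: "t \<le> 1"
    and decay: "\<And>\<xi>. cmod (fourier_transform \<nu> \<xi>) \<le> C * (1 + \<bar>\<xi>\<bar>) powr (- t / 2)"
    and s: "0 \<le> s" "hausdorff_measure s E = 0"
  shows "t \<le> s"
proof (rule ccontr)
  assume "\<not> t \<le> s"
  have "E \<noteq> {}" using E by auto
  then have s0: "0 < s" using hausdorff_measure_0_eq_0D[of E] s by (cases "s = 0") auto
  \<comment> \<open>The Frostman estimate wants an order above s but below 1, while t may equal
    1.\<close>
  define u where "u = (s + t) / 2"
  have u: "s < u" "u < 1" "u \<le> t" using \<open>\<not> t \<le> s\<close> t by (auto simp: u_def)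
  have "C \<ge> 0" using decay[of 0] by (simp add: order_trans[OF norm_ge_zero])
  have "cmod (fourier_transform \<nu> \<xi>) \<le> C * (1 + \<bar>\<xi>\<bar>) powr (- u / 2)" for \<xi>
    using u \<open>C \<ge> 0\<close> by (intro order_trans[OF decay] mult_left_mono powr_mono) auto
  from fourier_decay_imp_frostman[OF \<nu> s0 u(1,2) this]
  obtain G A where "G \<in> sets borel" "emeasure \<nu> G > 0" "A \<ge> 0"
    "\<And>x r. x \<in> G \<Longrightarrow> 0 \<le> r \<Longrightarrow> r \<le> 1 \<Longrightarrow> emeasure \<nu> (cball x r) \<le> ennreal (A * r powr s)"
    by blast
  then have "hausdorff_measure s E \<noteq> 0"
    by (intro frostman_imp_hausdorff_measure_pos[OF \<nu> E s0])
  with s show False by simp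
qed

text \<open>Comparing a supremum with an infimum requires both sets to be non-empty:
  \<open>u\<close> belongs to one, and order 0, with the trivial bound 1, to the other.\<close>

lemma fourier_dim_measure_le_hausdorff_dim:
  assumes "real_distribution \<nu>" "emeasure \<nu> E = 1"
    and "0 \<le> u" "hausdorff_measure u E = 0"
  shows "fourier_dim_measure \<nu> \<le> hausdorff_dim E"
proof -
  interpret \<nu>: real_distribution \<nu> by fact
  have *: "\<exists>C>0. \<forall>\<xi>. cmod (fourier_transform \<nu> \<xi>) \<le> C * (1 + \<bar>\<xi>\<bar>) powr (- 0 / 2)"
    using \<nu>.cmod_char_le_1 by (intro exI[of _ 1]) (auto simp: fourier_transform_eq_char)
  show ?thesis unfolding fourier_dim_measure_def hausdorff_dim_def
  proof (rule cSup_least)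
    show "{t \<in> {0..1}. \<exists>C>0. \<forall>\<xi>. cmod (fourier_transform \<nu> \<xi>) \<le> C * (1 + \<bar>\<xi>\<bar>) powr (- t / 2)} \<noteq> {}"
    proof -
      have "0 \<in> {t \<in> {0..1}. \<exists>C>0. \<forall>\<xi>. cmod (fourier_transform \<nu> \<xi>) \<le> C * (1 + \<bar>\<xi>\<bar>) powr (- t / 2)}"
        unfolding mem_Collect_eq by (intro conjI *) simp
      then show ?thesis by blast
    qed
  next
    fix t assume "t \<in> {t \<in> {0..1}. \<exists>C>0. \<forall>\<xi>. cmod (fourier_transform \<nu> \<xi>) \<le> C * (1 + \<bar>\<xi>\<bar>) powr (- t / 2)}"
    then obtain C where t: "t \<le> 1" and C: "\<And>\<xi>. cmod (fourier_transform \<nu> \<xi>) \<le> C * (1 + \<bar>\<xi>\<bar>) powr (- t / 2)"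
      by auto
    show "t \<le> Inf {s. 0 \<le> s \<and> hausdorff_measure s E = 0}"
    proof (rule cInf_greatest)
      show "{s. 0 \<le> s \<and> hausdorff_measure s E = 0} \<noteq> {}" using assms by blast
    qed (use fourier_decay_le_hausdorff_exponent[OF assms(1,2) t C] in auto)
  qed
qed

section \<open>Digit sets with small exponential sums\<close>

text \<open>The Fourier transform of the uniform distribution on \<open>B\<close>.\<close>

definition digit_mask :: "nat set \<Rightarrow> real \<Rightarrow> complex" where
  "digit_mask B x = (\<Sum>d\<in>B. iexp (- 2 * pi * x * real d)) / of_nat (card B)"

lemma norm_iexp_diff_le: "cmod (iexp a - iexp b) \<le> \<bar>a - b\<bar>"
proof -
  have "iexp a - iexp b = iexp b * (iexp (a - b) - 1)"
    by (simp add: algebra_simps flip: exp_add)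
  then have "cmod (iexp a - iexp b) = cmod (iexp (a - b) - 1)"
    by (simp add: norm_mult)
  also have "\<dots> \<le> \<bar>a - b\<bar>" using iexp_approx1[of "a - b" 0] by simp
  finally show ?thesis .
qed

lemma iexp_add: "iexp (a + b) = iexp a * iexp b"
  by (simp add: distrib_left exp_add)

lemma digit_mask_0: "finite B \<Longrightarrow> B \<noteq> {} \<Longrightarrow> digit_mask B 0 = 1"
  by (simp add: digit_mask_def)

lemma norm_digit_mask_le_1: "cmod (digit_mask B x) \<le> 1"
proof (cases "card B = 0")
  case False
  have "cmod (\<Sum>d\<in>B. iexp (- 2 * pi * x * real d)) \<le> (\<Sum>d\<in>B. 1)"
    by (rule sum_norm_le) simp
  with False show ?thesis by (simp add: digit_mask_def norm_divide)
qed (simp add: digit_mask_def)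

lemma iexp_2pi_int: "iexp (2 * pi * of_int n) = 1"
  by (auto simp add: exp_eq_1 mult.commute)

lemma digit_mask_add_int: "digit_mask B (x + of_int n) = digit_mask B x"
proof -
  have "iexp (- 2 * pi * (x + of_int n) * real d) = iexp (- 2 * pi * x * real d)" for d
  proof -
    have "- 2 * pi * (x + of_int n) * real d = - 2 * pi * x * real d + 2 * pi * of_int (- n * int d)"
      by (simp add: algebra_simps)
    then show ?thesis by (simp only: iexp_add iexp_2pi_int mult_1_right)
  qed
  then show ?thesis unfolding digit_mask_def by presburger
qed

lemma digit_mask_lipschitz:
  assumes "B \<subseteq> {..<N}"
  shows "cmod (digit_mask B x - digit_mask B y) \<le> 2 * pi * real N * \<bar>x - y\<bar>"
proof (cases "card B = 0")
  case False
  have "cmod (\<Sum>d\<in>B. iexp (- 2 * pi * x * real d) - iexp (- 2 * pi * y * real d)) \<le>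
      (\<Sum>d\<in>B. 2 * pi * real N * \<bar>x - y\<bar>)"
  proof (rule sum_norm_le)
    fix d assume "d \<in> B"
    then have "real d \<le> real N" using assms by auto
    have "cmod (iexp (- 2 * pi * x * real d) - iexp (- 2 * pi * y * real d)) \<le>
        \<bar>- 2 * pi * x * real d - (- 2 * pi * y * real d)\<bar>"
      by (rule norm_iexp_diff_le)
    also have "\<dots> = \<bar>(2 * pi * real d) * (y - x)\<bar>" by (simp add: algebra_simps)
    also have "\<dots> = 2 * pi * real d * \<bar>x - y\<bar>" unfolding abs_mult by (simp add: abs_minus_commute)
    also have "\<dots> \<le> 2 * pi * real N * \<bar>x - y\<bar>"
      using \<open>real d \<le> real N\<close> by (intro mult_right_mono mult_left_mono) auto
    finally show "cmod (iexp (- 2 * pi * x * real d) - iexp (- 2 * pi * y * real d)) \<le> 2 * pi * real N * \<bar>x - y\<bar>" .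
  qed
  with False show ?thesis
    by (simp add: digit_mask_def norm_divide sum_subtractf divide_le_eq mult.commute flip: diff_divide_distrib)
qed (simp add: digit_mask_def)

text \<open>The Dirichlet kernel, multiplied out so that integers x, where the quotient of sines is
  undefined, need no exception.\<close>

lemma norm_digit_mask_lessThan:
  "cmod (digit_mask {..<N} x) * (real N * \<bar>sin (pi * x)\<bar>) = \<bar>sin (pi * real N * x)\<bar>"
proof (cases "N = 0")
  case False
  define z where "z = iexp (- 2 * pi * x)"
  have norm: "cmod (iexp t - 1) = 2 * \<bar>sin (t / 2)\<bar>" for t
    by (rule dist_exp_i_1)
  have pow: "z ^ k = iexp (- 2 * pi * x * real k)" for k
    unfolding z_def by (simp add: mult_ac flip: exp_of_nat_mult)
  have "digit_mask {..<N} x * of_nat N * (1 - z) = 1 - z ^ N"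
    unfolding digit_mask_def pow[symmetric] using False by (simp add: one_diff_power_eq mult.commute)
  then have "cmod (digit_mask {..<N} x) * real N * cmod (z - 1) = cmod (z ^ N - 1)"
    by (metis norm_minus_commute norm_mult norm_of_nat)
  then show ?thesis
    unfolding pow unfolding z_def norm by (simp add: mult_ac)
qed simp

section \<open>Choosing digits by an exponential potential\<close>

lemma exp_le_quadratic:
  fixes y :: real
  assumes "\<bar>y\<bar> \<le> 1"
  shows "exp y \<le> 1 + y + y\<^sup>2"
proof (cases "y \<ge> 0")
  case True
  then show ?thesis using exp_bound[of y] assms by simp
next
  case False
  \<comment> \<open>The product is 1 - y^3; afterwards 1 - y is replaced by the larger exp
    (-y).\<close>
  have "1 \<le> (1 + y + y\<^sup>2) * (1 - y)"
  proof -
    have "y ^ 3 \<le> 0" using False by (simp add: power_le_zero_eq)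
    then show ?thesis by (simp add: algebra_simps power3_eq_cube power2_eq_square)
  qed
  also have "\<dots> \<le> (1 + y + y\<^sup>2) * exp (- y)"
    using exp_ge_add_one_self[of "- y"] assms by (intro mult_left_mono) auto
  finally show ?thesis by (simp add: exp_minus field_simps)
qed

text \<open>
  Derandomised Chernoff bound: choosing each \<open>c j\<close> so that the exponential potential does not exceed
  its average over all choices.
\<close>
lemma exponential_potential_choice:
  fixes g :: "'t \<Rightarrow> nat \<Rightarrow> nat \<Rightarrow> real"
  assumes "finite T" "K > 0" and \<theta>: "0 \<le> \<theta>" "\<theta> \<le> 1"
    and mean: "\<And>t j. t \<in> T \<Longrightarrow> (\<Sum>c<K. g t j c) = 0"
    and bound: "\<And>t j c. t \<in> T \<Longrightarrow> c < K \<Longrightarrow> \<bar>g t j c\<bar> \<le> 1"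
  shows "\<exists>c. (\<forall>j. c j < K) \<and>
    (\<Sum>t\<in>T. exp (\<theta> * (\<Sum>j<M. g t j (c j)))) \<le> real (card T) * exp (\<theta>\<^sup>2 * real M)"
proof (induction M)
  case 0
  then show ?case using \<open>K > 0\<close> by auto
next
  case (Suc M)
  then obtain c where c: "\<And>j. c j < K"
    and le: "(\<Sum>t\<in>T. exp (\<theta> * (\<Sum>j<M. g t j (c j)))) \<le> real (card T) * exp (\<theta>\<^sup>2 * real M)"
    by blast
  define a where "a t = exp (\<theta> * (\<Sum>j<M. g t j (c j)))" for t
  \<comment> \<open>The linear term averages to 0, which leaves the factor 1 + \<theta>^2 \<le> exp
    (\<theta>^2) per step.\<close>
  have avg: "(\<Sum>k<K. exp (\<theta> * g t M k)) \<le> real K * exp (\<theta>\<^sup>2)" if t: "t \<in> T" for t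
  proof -
    have "(\<Sum>k<K. exp (\<theta> * g t M k)) \<le> (\<Sum>k<K. 1 + \<theta>\<^sup>2 + \<theta> * g t M k)"
    proof (rule sum_mono)
      fix k assume "k \<in> {..<K}"
      then have b: "\<bar>g t M k\<bar> \<le> 1" using bound t by simp
      then have "\<bar>\<theta> * g t M k\<bar> \<le> 1 * 1"
        unfolding abs_mult using \<theta> by (intro mult_mono) auto
      then have "exp (\<theta> * g t M k) \<le> 1 + \<theta> * g t M k + (\<theta> * g t M k)\<^sup>2"
        by (intro exp_le_quadratic) simp
      also have "(\<theta> * g t M k)\<^sup>2 \<le> \<theta>\<^sup>2 * 1"
        unfolding power_mult_distrib using b by (intro mult_left_mono) (auto simp: abs_square_le_1)
      finally show "exp (\<theta> * g t M k) \<le> 1 + \<theta>\<^sup>2 + \<theta> * g t M k" by simp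
    qed
    also have "\<dots> = real K * (1 + \<theta>\<^sup>2)"
      using mean[OF t] by (simp add: sum.distrib algebra_simps flip: sum_distrib_left)
    also have "\<dots> \<le> real K * exp (\<theta>\<^sup>2)"
      using exp_ge_add_one_self[of "\<theta>\<^sup>2"] by (intro mult_left_mono) auto
    finally show ?thesis .
  qed
  have "\<exists>k<K. (\<Sum>t\<in>T. a t * exp (\<theta> * g t M k)) \<le> (\<Sum>t\<in>T. a t) * exp (\<theta>\<^sup>2)"
  proof (rule ccontr)
    assume "\<not> ?thesis"
    then have "(\<Sum>k<K. (\<Sum>t\<in>T. a t) * exp (\<theta>\<^sup>2)) < (\<Sum>k<K. \<Sum>t\<in>T. a t * exp (\<theta> * g t M k))"
      using \<open>K > 0\<close> by (intro sum_strict_mono) auto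
    also have "\<dots> = (\<Sum>t\<in>T. a t * (\<Sum>k<K. exp (\<theta> * g t M k)))"
      by (subst sum.swap) (simp add: sum_distrib_left)
    also have "\<dots> \<le> (\<Sum>t\<in>T. a t * (real K * exp (\<theta>\<^sup>2)))"
      by (intro sum_mono mult_left_mono avg) (auto simp: a_def)
    also have "\<dots> = (\<Sum>k<K. (\<Sum>t\<in>T. a t) * exp (\<theta>\<^sup>2))"
      by (simp add: sum_distrib_right sum_distrib_left mult_ac)
    finally show False by simp
  qed
  then obtain k where k: "k < K" "(\<Sum>t\<in>T. a t * exp (\<theta> * g t M k)) \<le> (\<Sum>t\<in>T. a t) * exp (\<theta>\<^sup>2)"
    by blast
  have "(\<Sum>t\<in>T. exp (\<theta> * (\<Sum>j<Suc M. g t j ((c(M := k)) j)))) = (\<Sum>t\<in>T. a t * exp (\<theta> * g t M k))"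
    by (intro sum.cong) (auto simp: a_def distrib_left exp_add)
  also have "\<dots> \<le> (\<Sum>t\<in>T. a t) * exp (\<theta>\<^sup>2)" by fact
  also have "\<dots> \<le> real (card T) * exp (\<theta>\<^sup>2 * real M) * exp (\<theta>\<^sup>2)"
    using le by (intro mult_right_mono) (auto simp: a_def)
  also have "\<dots> = real (card T) * exp (\<theta>\<^sup>2 * real (Suc M))"
    by (simp add: algebra_simps exp_add)
  finally show ?case
    using c k(1) by (intro exI[of _ "c(M := k)"]) auto
qed

text \<open>The potential bounds each sum by L / \<theta> + \<theta> M, which is least at \<theta> =
  sqrt (L / M). The quadratic estimate of exp needs \<theta> \<le> 1; for L > M the trivial bound M
  \<le> sqrt (L M) is good enough.\<close>

lemma small_sums_choice:
  fixes g :: "'t \<Rightarrow> nat \<Rightarrow> nat \<Rightarrow> real"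
  assumes "finite T" "K > 0" "L > 0" "real (card T) \<le> exp L"
    and mean: "\<And>t j. t \<in> T \<Longrightarrow> (\<Sum>c<K. g t j c) = 0"
    and bound: "\<And>t j c. t \<in> T \<Longrightarrow> c < K \<Longrightarrow> \<bar>g t j c\<bar> \<le> 1"
  obtains c where "\<And>j. c j < K" "\<And>t. t \<in> T \<Longrightarrow> (\<Sum>j<M. g t j (c j)) \<le> 2 * sqrt (L * real M)"
proof (cases "L \<le> real M")
  case True
  define \<theta> where "\<theta> = sqrt (L / real M)"
  have M: "real M > 0" using True \<open>L > 0\<close> by linarith
  have \<theta>: "0 < \<theta>" "\<theta> \<le> 1" using M True \<open>L > 0\<close> by (auto simp: \<theta>_def)
  have \<theta>2: "\<theta>\<^sup>2 * real M = L" using M \<open>L > 0\<close> by (simp add: \<theta>_def)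
  have \<theta>M: "\<theta> * sqrt (L * real M) = L"
    using M \<open>L > 0\<close> by (simp add: \<theta>_def flip: real_sqrt_mult)
  from exponential_potential_choice[of T K \<theta> g M] assms \<theta>
  obtain c where c: "\<And>j. c j < K"
    and le: "(\<Sum>t\<in>T. exp (\<theta> * (\<Sum>j<M. g t j (c j)))) \<le> real (card T) * exp (\<theta>\<^sup>2 * real M)"
    by auto
  show ?thesis
  proof
    fix t assume "t \<in> T"
    then have "exp (\<theta> * (\<Sum>j<M. g t j (c j))) \<le> (\<Sum>t\<in>T. exp (\<theta> * (\<Sum>j<M. g t j (c j))))"
      using \<open>finite T\<close> by (intro member_le_sum) auto
    also have "\<dots> \<le> exp L * exp L"
      using le assms(4) unfolding \<theta>2 by (meson exp_ge_zero mult_right_mono order_trans)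
    finally have "\<theta> * (\<Sum>j<M. g t j (c j)) \<le> 2 * L" by (simp flip: exp_add)
    also have "\<dots> = \<theta> * (2 * sqrt (L * real M))" using \<theta>M by simp
    finally show "(\<Sum>j<M. g t j (c j)) \<le> 2 * sqrt (L * real M)" using \<theta> by simp
  qed (rule c)
next
  case False
  show ?thesis
  proof
    fix t assume "t \<in> T"
    have "(\<Sum>j<M. g t j 0) \<le> (\<Sum>j<M. 1)"
      using bound[OF \<open>t \<in> T\<close> \<open>K > 0\<close>] by (intro sum_mono) (auto simp: abs_le_iff)
    also have "\<dots> = sqrt (real M * real M)" by simp
    also have "\<dots> \<le> sqrt (L * real M)" using False by (intro real_sqrt_le_mono mult_right_mono) auto
    also have "\<dots> \<le> 2 * sqrt (L * real M)" using \<open>L > 0\<close> by simp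
    finally show "(\<Sum>j<M. g t j 0) \<le> 2 * sqrt (L * real M)" .
  qed (rule \<open>K > 0\<close>)
qed


text \<open>The potential controls real sums from above only; testing four directions recovers the
  modulus.\<close>

lemma norm_le_sum_quarter_turns:
  fixes z :: complex
  assumes "\<And>q. q < 4 \<Longrightarrow> Re (\<i> ^ q * z) \<le> b"
  shows "cmod z \<le> 2 * b"
proof -
  have "Re z \<le> b" "- Im z \<le> b" "- Re z \<le> b" "Im z \<le> b"
    using assms[of 0] assms[of 1] assms[of 2] assms[of 3] by (auto simp: power3_eq_cube)
  then show ?thesis using cmod_le[of z] by linarith
qed

text \<open>
  The mask of \<open>{0, \<dots>, M K - 1}\<close> is the average of the masks over all choices of the \<open>c\<^sub>j\<close>, and by
  the Lipschitz bound it suffices to control the deviation on the multiples of \<open>1 / N\<^sup>2\<close>.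
\<close>
lemma digit_set_small_deviation:
  assumes M: "M > 0" and K: "K > 0" and N: "N = M * K" "N \<ge> 2"
  obtains c where "\<And>j. c j < K"
    "\<And>x. cmod (digit_mask ((\<lambda>j. j + M * c j) ` {..<M}) x - digit_mask {..<N} x) \<le>
       8 * sqrt (ln (4 * real N ^ 2) / real M) + 4 * pi / real N"
proof -
  define E where "E x j k = iexp (- 2 * pi * x * real (j + M * k))" for x :: real and j k :: nat
  define avg where "avg x j = (\<Sum>k<K. E x j k) / of_nat K" for x j
  \<comment> \<open>A test is a grid point i / N^2 together with a quarter turn. There are 4 N^2 of
    them, whence \<open>L\<close>; \<open>g\<close> is halved as the difference of two numbers of
    modulus at most 1.\<close>
  define T where "T = {..<N\<^sup>2} \<times> {..<4::nat}"
  define g where "g t j k = Re (\<i> ^ snd t * (E (real (fst t) / real N ^ 2) j k - avg (real (fst t) / real N ^ 2) j)) / 2"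
    for t :: "nat \<times> nat" and j k
  define L where "L = ln (4 * real N ^ 2)"
  have "real N ^ 2 \<ge> 2 ^ 2" by (rule power_mono) (use N(2) in linarith)+
  then have N2: "real N ^ 2 \<ge> 4" by simp
  have L: "L > 0" unfolding L_def using N2 by (intro ln_gt_zero) auto
  have cardT: "real (card T) \<le> exp L"
  proof -
    have "exp L = 4 * real N ^ 2" unfolding L_def by (rule exp_ln) (use N2 in linarith)
    then show ?thesis by (simp add: T_def card_cartesian_product)
  qed
  have normE: "cmod (E x j k) = 1" for x j k by (simp add: E_def)
  have norm_avg: "cmod (avg x j) \<le> 1" for x j
  proof -
    have "cmod (\<Sum>k<K. E x j k) \<le> (\<Sum>k<K. 1)" by (rule sum_norm_le) (simp add: normE)
    then show ?thesis using K by (simp add: avg_def norm_divide)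
  qed
  have mean: "(\<Sum>k<K. g t j k) = 0" for t j
  proof -
    define x where "x = real (fst t) / real N ^ 2"
    have "(\<Sum>k<K. g t j k) = Re (\<i> ^ snd t * (\<Sum>k<K. E x j k - avg x j)) / 2"
      unfolding g_def x_def by (simp only: sum_divide_distrib Re_sum sum_distrib_left)
    also have "(\<Sum>k<K. E x j k - avg x j) = 0"
      using K by (simp add: sum_subtractf avg_def)
    finally show ?thesis by simp
  qed
  have half: "\<bar>Re z / 2\<bar> \<le> cmod z / 2" for z using abs_Re_le_cmod[of z] by simp
  have bound: "\<bar>g t j k\<bar> \<le> 1" for t j k
  proof -
    have "\<bar>g t j k\<bar> \<le> cmod (\<i> ^ snd t * (E (real (fst t) / real N ^ 2) j k - avg (real (fst t) / real N ^ 2) j)) / 2"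
      unfolding g_def by (rule half)
    also have "\<dots> \<le> (cmod (E (real (fst t) / real N ^ 2) j k) + cmod (avg (real (fst t) / real N ^ 2) j)) / 2"
      using norm_triangle_ineq4 by (simp add: norm_mult norm_power)
    also have "\<dots> \<le> 1" using norm_avg by (simp add: normE)
    finally show ?thesis .
  qed
  have "finite T" by (simp add: T_def)
  from small_sums_choice[of T K L g M, OF this K L cardT mean bound]
  obtain c where c: "\<And>j. c j < K" and small: "\<And>t. t \<in> T \<Longrightarrow> (\<Sum>j<M. g t j (c j)) \<le> 2 * sqrt (L * real M)"
    by auto
  define B where "B = (\<lambda>j. j + M * c j) ` {..<M}"
  have inj: "inj_on (\<lambda>j. j + M * c j) {..<M}"
    by (rule inj_on_inverseI[where g = "\<lambda>d. d mod M"]) simp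
  have cardB: "card B = M" unfolding B_def using card_image[OF inj] by simp
  have BN: "B \<subseteq> {..<N}"
  proof
    fix d assume "d \<in> B"
    then obtain j where j: "j < M" "d = j + M * c j" by (auto simp: B_def)
    have "Suc (c j) \<le> K" using c[of j] by simp
    then have "M * Suc (c j) \<le> M * K" by (rule mult_le_mono2)
    then show "d \<in> {..<N}" using j N by simp
  qed
  have maskB: "digit_mask B x = (\<Sum>j<M. E x j (c j)) / of_nat M" for x
    unfolding digit_mask_def cardB unfolding B_def E_def by (subst sum.reindex[OF inj]) simp
  have maskN: "digit_mask {..<N} x = (\<Sum>j<M. avg x j) / of_nat M" for x
  proof -
    \<comment> \<open>Every d < N is j + M k for a unique residue j and a unique k, so averaging
      each residue class over k gives back the full digit set.\<close>
    have "bij_betw (\<lambda>(j, k). j + M * k) ({..<M} \<times> {..<K}) {..<N}"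
    proof (rule bij_betw_byWitness[where f' = "\<lambda>d. (d mod M, d div M)"])
      show "(\<lambda>(j, k). j + M * k) ` ({..<M} \<times> {..<K}) \<subseteq> {..<N}"
      proof safe
        fix j k assume "j < M" "k < K"
        then have "M * Suc k \<le> M * K" by (intro mult_le_mono2) simp
        then show "j + M * k < N" using \<open>j < M\<close> N by simp
      qed
      show "(\<lambda>d. (d mod M, d div M)) ` {..<N} \<subseteq> {..<M} \<times> {..<K}"
        using M N by (auto simp: less_mult_imp_div_less mult.commute)
    qed (use M in auto)
    then have "(\<Sum>d<N. iexp (- 2 * pi * x * real d)) = (\<Sum>(j, k)\<in>{..<M} \<times> {..<K}. E x j k)"
      unfolding E_def by (subst sum.reindex_bij_betw[symmetric]) (auto simp: split_beta)
    also have "\<dots> = (\<Sum>j<M. avg x j * of_nat K)"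
      unfolding avg_def using K by (simp add: sum.cartesian_product)
    finally show ?thesis
      using K N(1) by (simp add: digit_mask_def flip: sum_distrib_right)
  qed
  have grid: "cmod (digit_mask B (real i / real N ^ 2) - digit_mask {..<N} (real i / real N ^ 2)) \<le> 8 * sqrt (L / real M)"
    if "i < N\<^sup>2" for i
  proof -
    define z where "z = (\<Sum>j<M. E (real i / real N ^ 2) j (c j) - avg (real i / real N ^ 2) j)"
    have "cmod z \<le> 2 * (4 * sqrt (L * real M))"
    proof (rule norm_le_sum_quarter_turns)
      fix q :: nat assume "q < 4"
      with that have "(i, q) \<in> T" by (simp add: T_def)
      from small[OF this] have "Re (\<i> ^ q * z) / 2 \<le> 2 * sqrt (L * real M)"
        unfolding g_def z_def by (simp only: fst_conv snd_conv sum_distrib_left Re_sum sum_divide_distrib)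
      then show "Re (\<i> ^ q * z) \<le> 4 * sqrt (L * real M)" by simp
    qed
    moreover have "digit_mask B (real i / real N ^ 2) - digit_mask {..<N} (real i / real N ^ 2) = z / of_nat M"
      unfolding maskB maskN z_def by (simp add: sum_subtractf diff_divide_distrib)
    moreover have "sqrt (L * real M) / real M = sqrt (L / real M)"
      using M by (simp add: real_sqrt_mult real_sqrt_divide field_simps)
    moreover have "cmod z / real M \<le> 8 * (sqrt (L * real M) / real M)"
      using \<open>cmod z \<le> 2 * (4 * sqrt (L * real M))\<close> by (simp add: divide_right_mono)
    ultimately show ?thesis by (simp only: norm_divide norm_of_nat)
  qed
  show ?thesis
  proof
    fix x :: real
    \<comment> \<open>By periodicity x is reduced to [0, 1) and then rounded down to the grid of
      mesh 1 / N^2. The Lipschitz constant 2 \<pi> N costs 2 \<pi> / N for each of the two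
      masks.\<close>
    define y where "y = frac x"
    define i where "i = nat \<lfloor>y * real N ^ 2\<rfloor>"
    have y: "0 \<le> y" "y < 1" by (auto simp: y_def frac_lt_1)
    have iy: "real i \<le> y * real N ^ 2" "y * real N ^ 2 < real i + 1"
      unfolding i_def using y N2 by (auto simp: of_nat_nat) 
    have "real i < real N ^ 2"
      using iy(1) y N2 by (smt (verit) mult_less_cancel_right2 zero_less_power)
    then have i: "i < N\<^sup>2" by (simp flip: of_nat_power)
    define v where "v = real i / real N ^ 2"
    have "real N \<noteq> 0" using N(2) by auto
    then have "y - v = (y * real N ^ 2 - real i) / real N ^ 2"
      by (simp add: v_def diff_divide_distrib)
    also have "\<bar>\<dots>\<bar> \<le> 1 / real N ^ 2"
      unfolding abs_divide abs_power2 by (rule divide_right_mono) (use iy N2 in linarith)+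
    finally have "\<bar>y - v\<bar> \<le> 1 / real N ^ 2" .
    then have "2 * pi * real N * \<bar>y - v\<bar> \<le> 2 * pi * real N * (1 / real N ^ 2)"
      by (intro mult_left_mono) auto
    then have lip: "2 * pi * real N * \<bar>y - v\<bar> \<le> 2 * pi / real N"
      using \<open>real N \<noteq> 0\<close> by (simp add: power2_eq_square)
    have "digit_mask B x = digit_mask B y" "digit_mask {..<N} x = digit_mask {..<N} y"
      using digit_mask_add_int[of _ y "\<lfloor>x\<rfloor>"] by (simp_all add: y_def frac_def)
    then have "digit_mask B x - digit_mask {..<N} x =
        (digit_mask B y - digit_mask B v) + (digit_mask B v - digit_mask {..<N} v) - (digit_mask {..<N} y - digit_mask {..<N} v)"
      by simp
    also have "cmod \<dots> \<le> cmod (digit_mask B y - digit_mask B v) + cmod (digit_mask B v - digit_mask {..<N} v) + cmod (digit_mask {..<N} y - digit_mask {..<N} v)"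
      by (meson norm_triangle_ineq norm_triangle_ineq4 add_mono order_refl order_trans)
    also have "\<dots> \<le> 2 * pi / real N + 8 * sqrt (L / real M) + 2 * pi / real N"
      using digit_mask_lipschitz[OF BN, of y v] digit_mask_lipschitz[of "{..<N}" N y v] lip grid[OF i]
      by (intro add_mono) (auto simp: v_def)
    finally show "cmod (digit_mask ((\<lambda>j. j + M * c j) ` {..<M}) x - digit_mask {..<N} x) \<le>
        8 * sqrt (ln (4 * real N ^ 2) / real M) + 4 * pi / real N"
      by (simp add: L_def B_def add_divide_distrib)
  qed (rule c)
qed

section \<open>The Cantor--Moran measure\<close>

lemma real_distribution_convolution:
  assumes "real_distribution M" "real_distribution N"
  shows "real_distribution (M \<star> N)"
proof -
  interpret M: real_distribution M by fact
  interpret N: real_distribution N by fact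
  interpret MN: pair_prob_space M N ..
  show ?thesis
    unfolding convolution_def by (intro MN.real_distribution_distr) measurable
qed

lemma char_convolution:
  assumes "real_distribution M" "real_distribution N"
  shows "char (M \<star> N) t = char M t * char N t"
proof -
  interpret M: real_distribution M by fact
  interpret N: real_distribution N by fact
  interpret MN: pair_prob_space M N ..
  have "char (M \<star> N) t = (CLINT z|M \<Otimes>\<^sub>M N. iexp (t * (fst z + snd z)))"
    unfolding char_def convolution_def by (subst integral_distr) (auto simp: split_beta)
  also have "\<dots> = (CLINT z|M \<Otimes>\<^sub>M N. case z of (x, y) \<Rightarrow> iexp (t * x) * iexp (t * y))"
    by (simp add: split_beta distrib_left exp_add)
  also have "\<dots> = (CLINT x|M. CLINT y|N. iexp (t * x) * iexp (t * y))"
    by (rule MN.integral_fst[symmetric], rule MN.integrable_const_bound[where B = 1])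
      (auto simp: split_beta norm_mult)
  also have "\<dots> = char M t * char N t"
    unfolding char_def by simp
  finally show ?thesis .
qed

lemma char_finite_convolution:
  assumes "\<And>n. real_distribution (\<nu> n)"
  shows "real_distribution (finite_convolution \<nu> n)"
    and "char (finite_convolution \<nu> n) t = (\<Prod>k<n. char (\<nu> k) t)"
proof (induction n)
  case 0
  interpret R: prob_space "return borel (0::real)" by (rule prob_space_return) simp
  show "real_distribution (finite_convolution \<nu> 0)"
    by (simp add: real_distribution_def real_distribution_axioms_def R.prob_space_axioms)
  show "char (finite_convolution \<nu> 0) t = (\<Prod>k<0. char (\<nu> k) t)"
    by (simp add: char_def integral_return)
next
  case (Suc n)
  show "real_distribution (finite_convolution \<nu> (Suc n))"
    using Suc(1) assms by (simp add: real_distribution_convolution)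
  show "char (finite_convolution \<nu> (Suc n)) t = (\<Prod>k<Suc n. char (\<nu> k) t)"
    using Suc assms by (simp add: char_convolution)
qed

section \<open>Digit sequences, their sums and the law of a random sum\<close>

locale moran_digits =
  fixes N :: "nat \<Rightarrow> nat" and B :: "nat \<Rightarrow> nat set"
  assumes N_ge_2: "2 \<le> N n" and B_nonempty: "B n \<noteq> {}" and B_subset: "B n \<subseteq> {..<N n}"
begin

lemma B_finite: "finite (B n)"
  using B_subset finite_subset by blast

definition Q :: "nat \<Rightarrow> nat" where "Q n = (\<Prod>i<n. N i)"

lemma Q_0 [simp]: "Q 0 = 1" and Q_Suc: "Q (Suc n) = Q n * N n"
  by (simp_all add: Q_def)

lemma prod_atMost_eq_Q: "(\<Prod>i\<le>n. N i) = Q (Suc n)"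
  by (simp add: Q_def lessThan_Suc_atMost)

lemma N_pos: "0 < N n"
  using N_ge_2[of n] by linarith

lemma Q_pos [simp]: "0 < Q n"
  by (simp add: Q_def N_pos prod_pos)

lemma Q_ge_power: "2 ^ n \<le> Q n"
  by (induction n) (use N_ge_2 in \<open>auto simp: Q_Suc mult.commute intro: mult_le_mono\<close>)

lemma inverse_Q_tendsto_0: "(\<lambda>n. 1 / real (Q n)) \<longlonglongrightarrow> 0"
proof (rule tendsto_sandwich)
  show "eventually (\<lambda>n. 0 \<le> 1 / real (Q n)) sequentially" by simp
  have "1 / real (Q n) \<le> (1 / 2) ^ n" for n
  proof -
    have "2 ^ n \<le> real (Q n)" using Q_ge_power[of n] by (metis of_nat_le_iff of_nat_numeral of_nat_power)
    then show ?thesis by (simp add: power_divide frac_le)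
  qed
  then show "eventually (\<lambda>n. 1 / real (Q n) \<le> (1 / 2) ^ n) sequentially" by simp
qed (auto intro: LIMSEQ_power_zero)

definition moran_sum :: "(nat \<Rightarrow> nat) \<Rightarrow> real" where
  "moran_sum d = (\<Sum>n. real (d n) / real (Q (Suc n)))"

lemma moran_set_eq: "moran_set N B = moran_sum ` {d. \<forall>n. d n \<in> B n}"
  by (auto simp: moran_set_def moran_sum_def prod_atMost_eq_Q simp del: of_nat_prod)

text \<open>The largest digit N_k - 1 contributes 1 / Q_k - 1 / Q_(k+1), which telescopes.\<close>

lemma partial_sum_upper:
  assumes "\<And>k. d k < N k" "n \<le> m"
  shows "(\<Sum>k<m. real (d k) / real (Q (Suc k))) \<le> (\<Sum>k<n. real (d k) / real (Q (Suc k))) + 1 / real (Q n) - 1 / real (Q m)"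
  using assms(2)
proof (induction m rule: dec_induct)
  case (step m)
  have "real (d m) / real (Q (Suc m)) \<le> (real (N m) - 1) / real (Q (Suc m))"
    using assms(1)[of m] by (intro divide_right_mono) auto
  also have "\<dots> = 1 / real (Q m) - 1 / real (Q (Suc m))"
    using N_pos[of m] by (simp add: Q_Suc field_simps)
  finally show ?case using step by simp
qed simp

lemma moran_sum_bounds:
  assumes d: "\<And>k. d k < N k"
  shows summable_moran: "summable (\<lambda>n. real (d n) / real (Q (Suc n)))"
    and moran_sum_ge: "(\<Sum>k<n. real (d k) / real (Q (Suc k))) \<le> moran_sum d"
    and moran_sum_le: "moran_sum d \<le> (\<Sum>k<n. real (d k) / real (Q (Suc k))) + 1 / real (Q n)"
proof -
  have le: "(\<Sum>k<m. real (d k) / real (Q (Suc k))) \<le> (\<Sum>k<n. real (d k) / real (Q (Suc k))) + 1 / real (Q n)" for n m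
  proof (cases "n \<le> m")
    case True
    have "0 \<le> 1 / real (Q m)" by simp
    then show ?thesis using partial_sum_upper[of d n m, OF d True] by linarith
  next
    case False
    then have "(\<Sum>k<m. real (d k) / real (Q (Suc k))) \<le> (\<Sum>k<n. real (d k) / real (Q (Suc k)))"
      by (intro sum_mono2) auto
    then show ?thesis by (simp add: add_increasing2)
  qed
  show s: "summable (\<lambda>n. real (d n) / real (Q (Suc n)))"
    using le[of _ 0] by (intro summableI_nonneg_bounded[where x = 1]) auto
  show "(\<Sum>k<n. real (d k) / real (Q (Suc k))) \<le> moran_sum d"
    unfolding moran_sum_def by (rule sum_le_suminf[OF s]) auto
  show "moran_sum d \<le> (\<Sum>k<n. real (d k) / real (Q (Suc k))) + 1 / real (Q n)"
    unfolding moran_sum_def by (rule suminf_le_const[OF s le])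
qed

text \<open>The admissible digit sequences form a product of finite sets, hence a compact space, and
  \<open>moran_sum\<close> is a uniform limit of functions of finitely many digits.\<close>

lemma compact_moran_set: "compact (moran_set N B)"
proof -
  let ?D = "{d. \<forall>n. d n \<in> B n}"
  have "compactin (product_topology (\<lambda>i. euclidean) UNIV) (PiE UNIV B)"
    by (subst compactin_PiE) (auto simp: B_finite finite_imp_compact)
  then have "compact ?D"
    by (simp add: euclidean_product_topology PiE_def Pi_def extensional_def)
  moreover have "continuous_on ?D moran_sum"
  proof (rule uniform_limit_theorem)
    have d: "d k < N k" if "d \<in> ?D" for d k
      using that B_subset by blast
    \<comment> \<open>The largest digits form a digit sequence themselves, so their series is a
      convergent majorant for the M-test.\<close>
    have "summable (\<lambda>n. real (N n - 1) / real (Q (Suc n)))"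
      by (rule summable_moran) (simp add: N_pos)
    then show "uniform_limit ?D (\<lambda>n d. \<Sum>k<n. real (d k) / real (Q (Suc k))) moran_sum sequentially"
      unfolding moran_sum_def
    proof (rule Weierstrass_m_test[rotated])
      fix n d assume "d \<in> ?D"
      from d[OF this, of n] show "norm (real (d n) / real (Q (Suc n))) \<le> real (N n - 1) / real (Q (Suc n))"
        by (simp add: divide_right_mono)
    qed
    have "continuous_on ?D (\<lambda>d. real (d k))" for k
    proof -
      have "continuous_on ?D (\<lambda>d. d k)" by (rule continuous_on_subset[OF continuous_on_product_coordinates]) simp
      moreover have "continuous_on UNIV (real :: nat \<Rightarrow> real)" by (simp add: continuous_on_open_vimage open_discrete)
      ultimately show ?thesis
        using continuous_on_compose2[of UNIV real ?D "\<lambda>d. d k"] by simp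
    qed
    then show "eventually (\<lambda>n. continuous_on ?D (\<lambda>d. \<Sum>k<n. real (d k) / real (Q (Suc k)))) sequentially"
      by (intro always_eventually allI continuous_on_sum continuous_on_divide) auto
  qed simp
  ultimately show ?thesis
    unfolding moran_set_eq by (rule compact_continuous_image[rotated])
qed

definition digit_seq_measure :: "(nat \<Rightarrow> nat) measure" where
  "digit_seq_measure = PiM UNIV (\<lambda>n. measure_pmf (pmf_of_set (B n)))"

sublocale D: prob_space digit_seq_measure
  unfolding digit_seq_measure_def by (rule prob_space_PiM) (rule prob_space_measure_pmf)

lemma measurable_digit [measurable]: "(\<lambda>\<omega>. real (\<omega> n)) \<in> borel_measurable digit_seq_measure"
proof -
  have "(\<lambda>\<omega>. \<omega> n) \<in> measurable digit_seq_measure (measure_pmf (pmf_of_set (B n)))"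
    unfolding digit_seq_measure_def by (rule measurable_component_singleton) simp
  then show ?thesis by (rule measurable_compose) simp
qed

lemma measurable_moran_sum [measurable]: "moran_sum \<in> borel_measurable digit_seq_measure"
  unfolding moran_sum_def by measurable

lemma AE_digits: "AE \<omega> in digit_seq_measure. \<forall>n. \<omega> n \<in> B n"
  unfolding AE_all_countable digit_seq_measure_def
  by (intro allI AE_PiM_component) (auto simp: AE_measure_pmf_iff B_finite B_nonempty prob_space_measure_pmf)

text \<open>Taken as the law of the random series, so that full mass on the Moran set is immediate;
  the identification with the infinite convolution goes through characteristic functions.\<close>

definition moran_measure :: "real measure" where
  "moran_measure = distr digit_seq_measure borel moran_sum"

sublocale real_distribution moran_measure
  unfolding moran_measure_def by (rule D.real_distribution_distr) measurable

lemma AE_moran_measure: "AE x in moran_measure. x \<in> moran_set N B"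
  unfolding moran_measure_def
proof (subst AE_distr_iff)
  show "{x \<in> space borel. x \<in> moran_set N B} \<in> sets borel"
    using compact_moran_set by (simp add: borel_compact)
  show "AE \<omega> in digit_seq_measure. moran_sum \<omega> \<in> moran_set N B"
    using AE_digits by eventually_elim (auto simp: moran_set_eq)
qed measurable

lemma emeasure_moran_set: "emeasure moran_measure (moran_set N B) = 1"
  using AE_moran_measure compact_moran_set by (intro emeasure_eq_1_AE) (auto simp: borel_compact)

text \<open>\<open>char\<close> has phase t x whereas the mask has phase -2 \<pi> x d; hence the
  frequency -t / (2 \<pi>).\<close>

lemma char_digit:
  "(CLINT d|measure_pmf (pmf_of_set (B n)). iexp (t * (real d / real (Q (Suc n))))) =
     digit_mask (B n) (- t / (2 * pi) / real (Q (Suc n)))"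
  unfolding digit_mask_def using B_finite[of n] B_nonempty[of n]
  by (subst integral_measure_pmf[of "B n"])
     (auto simp: divide_simps scaleR_conv_of_real simp flip: sum_divide_distrib intro!: sum.cong)

lemma char_digit_measure:
  "real_distribution (digit_measure N B n)"
  "char (digit_measure N B n) t = digit_mask (B n) (- t / (2 * pi) / real (Q (Suc n)))"
proof -
  show "real_distribution (digit_measure N B n)"
    unfolding digit_measure_def by (intro prob_space.real_distribution_distr prob_space_measure_pmf) simp
  show "char (digit_measure N B n) t = digit_mask (B n) (- t / (2 * pi) / real (Q (Suc n)))"
    unfolding digit_measure_def char_def prod_atMost_eq_Q char_digit[symmetric]
    by (subst integral_distr) auto
qed

lemma char_partial_sum:
  "char (distr digit_seq_measure borel (\<lambda>\<omega>. \<Sum>k<n. real (\<omega> k) / real (Q (Suc k)))) t =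
     (\<Prod>k<n. digit_mask (B k) (- t / (2 * pi) / real (Q (Suc k))))"
proof -
  let ?p = "\<lambda>n. measure_pmf (pmf_of_set (B n))"
  have comp: "distr digit_seq_measure (?p k) (\<lambda>\<omega>. \<omega> k) = ?p k" for k
    unfolding digit_seq_measure_def by (rule distr_PiM_component) (auto simp: prob_space_measure_pmf)
  have m: "(\<lambda>\<omega>. \<omega> k) \<in> measurable digit_seq_measure (?p k)" for k
    unfolding digit_seq_measure_def by (rule measurable_component_singleton) simp
  have "D.indep_vars ?p (\<lambda>k \<omega>. \<omega> k) UNIV"
  proof (subst D.indep_vars_iff_distr_eq_PiM)
    show "distr digit_seq_measure (PiM UNIV ?p) (\<lambda>x. \<lambda>i\<in>UNIV. x i) =
        PiM UNIV (\<lambda>i. distr digit_seq_measure (?p i) (\<lambda>\<omega>. \<omega> i))"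
      unfolding comp restrict_UNIV by (simp add: digit_seq_measure_def distr_id2)
  qed (use m in auto)
  then have "D.indep_vars (\<lambda>_. borel) (\<lambda>k. (\<lambda>d. real d / real (Q (Suc k))) \<circ> (\<lambda>\<omega>. \<omega> k)) UNIV"
    by (rule D.indep_vars_compose) auto
  then have "D.indep_vars (\<lambda>_. borel) (\<lambda>k \<omega>. real (\<omega> k) / real (Q (Suc k))) {..<n}"
    unfolding comp_def by (rule D.indep_vars_subset) simp
  then have "char (distr digit_seq_measure borel (\<lambda>\<omega>. \<Sum>k<n. real (\<omega> k) / real (Q (Suc k)))) t =
      (\<Prod>k<n. char (distr digit_seq_measure borel (\<lambda>\<omega>. real (\<omega> k) / real (Q (Suc k)))) t)"
    by (rule D.char_distr_sum)
  also have "\<dots> = (\<Prod>k<n. digit_mask (B k) (- t / (2 * pi) / real (Q (Suc k))))"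
  proof (intro prod.cong refl)
    fix k
    have "distr digit_seq_measure borel (\<lambda>\<omega>. real (\<omega> k) / real (Q (Suc k))) =
        distr (distr digit_seq_measure (?p k) (\<lambda>\<omega>. \<omega> k)) borel (\<lambda>d. real d / real (Q (Suc k)))"
      using m by (subst distr_distr) (auto simp: comp_def)
    then show "char (distr digit_seq_measure borel (\<lambda>\<omega>. real (\<omega> k) / real (Q (Suc k)))) t =
        digit_mask (B k) (- t / (2 * pi) / real (Q (Suc k)))"
      unfolding comp char_def char_digit[symmetric] by (simp add: integral_distr)
  qed
  finally show ?thesis .
qed

lemma char_moran_measure:
  "(\<lambda>n. \<Prod>k<n. digit_mask (B k) (- t / (2 * pi) / real (Q (Suc k)))) \<longlonglongrightarrow> char moran_measure t"
proof -
  have "(\<lambda>n. CLINT \<omega>|digit_seq_measure. iexp (t * (\<Sum>k<n. real (\<omega> k) / real (Q (Suc k))))) \<longlonglongrightarrow>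
      (CLINT \<omega>|digit_seq_measure. iexp (t * moran_sum \<omega>))"
  proof (rule integral_dominated_convergence[where w = "\<lambda>_. 1"])
    show "AE \<omega> in digit_seq_measure. (\<lambda>n. iexp (t * (\<Sum>k<n. real (\<omega> k) / real (Q (Suc k))))) \<longlonglongrightarrow> iexp (t * moran_sum \<omega>)"
      using AE_digits
    proof eventually_elim
      case (elim \<omega>)
      then have "\<omega> k < N k" for k using B_subset by blast
      then have "(\<lambda>n. \<Sum>k<n. real (\<omega> k) / real (Q (Suc k))) \<longlonglongrightarrow> moran_sum \<omega>"
        unfolding moran_sum_def by (intro summable_LIMSEQ summable_moran)
      then show ?case by (intro tendsto_intros)
    qed
    show "(\<lambda>\<omega>. iexp (t * moran_sum \<omega>)) \<in> borel_measurable digit_seq_measure"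
      "(\<lambda>\<omega>. iexp (t * (\<Sum>k<n. real (\<omega> k) / real (Q (Suc k))))) \<in> borel_measurable digit_seq_measure" for n
      by measurable
    show "AE \<omega> in digit_seq_measure. cmod (iexp (t * (\<Sum>k<n. real (\<omega> k) / real (Q (Suc k))))) \<le> 1" for n
      by (simp only: norm_exp_i_times) simp
  qed simp
  moreover have "(CLINT \<omega>|digit_seq_measure. iexp (t * (\<Sum>k<n. real (\<omega> k) / real (Q (Suc k))))) =
      (\<Prod>k<n. digit_mask (B k) (- t / (2 * pi) / real (Q (Suc k))))" for n
    unfolding char_partial_sum[symmetric] char_def by (subst integral_distr) auto
  moreover have "(CLINT \<omega>|digit_seq_measure. iexp (t * moran_sum \<omega>)) = char moran_measure t"
    unfolding char_def moran_measure_def by (subst integral_distr) auto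
  ultimately show ?thesis by simp
qed

text \<open>Levy's continuity theorem: the finite convolutions have as characteristic functions the
  very partial products that converge to \<open>char moran_measure\<close>.\<close>

lemma is_cantor_moran_moran_measure: "is_cantor_moran_measure N B moran_measure"
  unfolding is_cantor_moran_measure_def has_infinite_convolution_def
proof
  show "weak_conv_m (finite_convolution (digit_measure N B)) moran_measure"
    using char_moran_measure
    by (intro levy_continuity)
       (simp_all add: char_finite_convolution char_digit_measure real_distribution_axioms)
qed (rule real_distribution_axioms)

text \<open>The Fourier transform of the n-th finite convolution, in the normalisation of
  \<open>fourier_transform\<close>.\<close>

definition mask_prod :: "nat \<Rightarrow> real \<Rightarrow> complex" where
  "mask_prod n \<xi> = (\<Prod>k<n. digit_mask (B k) (\<xi> / real (Q (Suc k))))"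

lemma mask_prod_tendsto: "(\<lambda>n. mask_prod n \<xi>) \<longlonglongrightarrow> fourier_transform moran_measure \<xi>"
  using char_moran_measure[of "- 2 * pi * \<xi>"] by (simp add: mask_prod_def fourier_transform_eq_char)

text \<open>After n digits the remainder lies in [0, 1 / Q_n], so one interval of that length per
  digit prefix covers the set.\<close>

lemma hausdorff_measure_moran_set_eq_0:
  assumes s: "s > 0" and lim: "(\<lambda>n. real (\<Prod>k<n. card (B k)) * real (Q n) powr (- s)) \<longlonglongrightarrow> 0"
  shows "hausdorff_measure s (moran_set N B) = 0"
proof -
  define F where "F n = (\<lambda>d. \<Sum>k<n. real (d k) / real (Q (Suc k))) ` PiE {..<n} B" for n
  have fin: "finite (F n)" for n
    unfolding F_def by (intro finite_imageI finite_PiE) (auto simp: B_finite)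
  have card: "card (F n) \<le> (\<Prod>k<n. card (B k))" for n
    unfolding F_def using card_image_le[OF finite_PiE[of "{..<n}" B]] by (simp add: B_finite card_PiE)
  have "hausdorff_premeasure s \<delta> (moran_set N B) = 0" if \<delta>: "\<delta> > 0" for \<delta>
  proof -
    have "hausdorff_premeasure s \<delta> (moran_set N B) \<le> ennreal (real (\<Prod>k<n. card (B k)) * real (Q n) powr (- s))"
      if n: "1 / real (Q n) < \<delta>" for n
    proof -
      obtain f where f: "bij_betw f {..<card (F n)} (F n)"
        using ex_bij_betw_nat_finite[OF fin] by (auto simp: atLeast0LessThan)
      \<comment> \<open>The finite cover is padded to a sequence by empty sets, which
        \<open>diameter_power\<close> counts as 0.\<close>
      define U where "U i = (if i < card (F n) then {f i..f i + 1 / real (Q n)} else {})" for i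
      have "moran_set N B \<subseteq> (\<Union>i. U i)"
      proof
        fix x assume "x \<in> moran_set N B"
        then obtain d where d: "x = moran_sum d" "\<And>k. d k \<in> B k" by (auto simp: moran_set_eq)
        then have dN: "d k < N k" for k using B_subset by blast
        have "(\<Sum>k<n. real (d k) / real (Q (Suc k))) \<in> F n"
          unfolding F_def using d(2) by (intro image_eqI[of _ _ "restrict d {..<n}"]) auto
        then have "(\<Sum>k<n. real (d k) / real (Q (Suc k))) \<in> f ` {..<card (F n)}"
          using bij_betw_imp_surj_on[OF f] by (simp only:)
        then obtain i where i: "i < card (F n)" "f i = (\<Sum>k<n. real (d k) / real (Q (Suc k)))"
          by (elim imageE) simp
        with moran_sum_ge[of d n, OF dN] moran_sum_le[of d n, OF dN] have "x \<in> U i"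
          by (auto simp: U_def d(1))
        then show "x \<in> (\<Union>i. U i)" by blast
      qed
      moreover have "bounded (U i)" "diameter (U i) \<le> \<delta>" for i
        using n \<delta> by (auto simp: U_def diameter_closed_interval)
      ultimately have "hausdorff_premeasure s \<delta> (moran_set N B) \<le> (\<Sum>i. diameter_power s (U i))"
        unfolding hausdorff_premeasure_def by (intro INF_lower) auto
      also have "\<dots> = (\<Sum>i<card (F n). diameter_power s (U i))"
        by (intro suminf_finite) (auto simp: U_def diameter_power_def)
      also have "\<dots> = (\<Sum>i<card (F n). ennreal (real (Q n) powr (- s)))"
        using s by (intro sum.cong)
          (auto simp: U_def diameter_power_def diameter_closed_interval powr_divide powr_minus_divide)
      also have "\<dots> = ennreal (real (card (F n)) * real (Q n) powr (- s))"
        by (simp add: ennreal_mult' ennreal_of_nat_eq_real_of_nat)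
      also have "\<dots> \<le> ennreal (real (\<Prod>k<n. card (B k)) * real (Q n) powr (- s))"
        using card[of n] by (intro ennreal_leI mult_right_mono) (auto simp del: of_nat_prod)
      finally show ?thesis .
    qed
    moreover have "eventually (\<lambda>n. 1 / real (Q n) < \<delta>) sequentially"
      by (rule order_tendstoD(2)[OF inverse_Q_tendsto_0 \<delta>])
    ultimately have "eventually (\<lambda>n. hausdorff_premeasure s \<delta> (moran_set N B) \<le>
        ennreal (real (\<Prod>k<n. card (B k)) * real (Q n) powr (- s))) sequentially"
      by (auto elim: eventually_mono)
    moreover have "(\<lambda>n. ennreal (real (\<Prod>k<n. card (B k)) * real (Q n) powr (- s))) \<longlonglongrightarrow> ennreal 0"
      using lim by (rule tendsto_ennrealI)
    ultimately have "hausdorff_premeasure s \<delta> (moran_set N B) \<le> ennreal 0"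
      by (intro tendsto_lowerbound[of _ _ sequentially]) auto
    then show ?thesis by simp
  qed
  then show ?thesis by (simp add: hausdorff_measure_def)
qed

end

section \<open>Completeness of exponentials\<close>

definition finite_combinations :: "'i set \<Rightarrow> ('i \<Rightarrow> 'a \<Rightarrow> complex) \<Rightarrow> ('a \<Rightarrow> complex) set" where
  "finite_combinations I e = {h. \<exists>F c. finite F \<and> F \<subseteq> I \<and> (\<forall>x. h x = (\<Sum>i\<in>F. c i * e i x))}"

text \<open>Squared distances are used, so that the elementary \<open>cmod_add_square_le\<close>
  replaces Minkowski's inequality; its factor 2 is harmless since \<epsilon> is arbitrary.\<close>

definition L2_approximable :: "'a measure \<Rightarrow> 'i set \<Rightarrow> ('i \<Rightarrow> 'a \<Rightarrow> complex) \<Rightarrow> ('a \<Rightarrow> complex) \<Rightarrow> bool" where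
  "L2_approximable M I e f \<longleftrightarrow> square_integrable M f \<and>
     (\<forall>\<epsilon>>0. \<exists>h\<in>finite_combinations I e. (LINT x|M. (cmod (f x - h x))\<^sup>2) < \<epsilon>)"

lemma finite_combinations_add:
  assumes "g \<in> finite_combinations I e" "h \<in> finite_combinations I e"
  shows "(\<lambda>x. g x + h x) \<in> finite_combinations I e"
proof -
  obtain F c where F: "finite F" "F \<subseteq> I" and g: "\<And>x. g x = (\<Sum>i\<in>F. c i * e i x)"
    using assms(1) unfolding finite_combinations_def by blast
  obtain G d where G: "finite G" "G \<subseteq> I" and h: "\<And>x. h x = (\<Sum>i\<in>G. d i * e i x)"
    using assms(2) unfolding finite_combinations_def by blast
  define c' where "c' i = (if i \<in> F then c i else 0) + (if i \<in> G then d i else 0)" for i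
  have "g x + h x = (\<Sum>i\<in>F \<union> G. c' i * e i x)" for x
  proof -
    have "g x = (\<Sum>i\<in>F \<union> G. (if i \<in> F then c i else 0) * e i x)"
      unfolding g using F G by (intro sum.mono_neutral_cong_left) auto
    moreover have "h x = (\<Sum>i\<in>F \<union> G. (if i \<in> G then d i else 0) * e i x)"
      unfolding h using F G by (intro sum.mono_neutral_cong_left) auto
    ultimately show ?thesis by (simp add: c'_def distrib_right sum.distrib)
  qed
  then show ?thesis
    using F G unfolding finite_combinations_def
    by (intro CollectI exI[of _ "F \<union> G"] exI[of _ c']) simp
qed

lemma finite_combinations_cmult:
  assumes "h \<in> finite_combinations I e"
  shows "(\<lambda>x. a * h x) \<in> finite_combinations I e"
proof -
  obtain F c where F: "finite F" "F \<subseteq> I" and h: "\<And>x. h x = (\<Sum>i\<in>F. c i * e i x)"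
    using assms unfolding finite_combinations_def by blast
  have "a * h x = (\<Sum>i\<in>F. (a * c i) * e i x)" for x
    by (simp add: h sum_distrib_left mult.assoc)
  then show ?thesis
    using F unfolding finite_combinations_def
    by (intro CollectI exI[of _ F] exI[of _ "\<lambda>i. a * c i"]) simp
qed

lemma cmod_add_square_le: "(cmod (a + b))\<^sup>2 \<le> 2 * (cmod a)\<^sup>2 + 2 * (cmod b)\<^sup>2"
proof -
  have "(cmod (a + b))\<^sup>2 \<le> (cmod a + cmod b)\<^sup>2"
    by (intro power_mono norm_triangle_ineq) simp
  also have "\<dots> \<le> 2 * (cmod a)\<^sup>2 + 2 * (cmod b)\<^sup>2"
    using sum_squares_bound[of "cmod a" "cmod b"] by (simp add: power2_sum)
  finally show ?thesis .
qed

lemma square_integrable_add: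
  assumes "square_integrable M f" "square_integrable M g"
  shows "square_integrable M (\<lambda>x. f x + g x)"
  unfolding square_integrable_def
proof
  have [measurable]: "f \<in> borel_measurable M" "g \<in> borel_measurable M"
    using assms by (auto simp: square_integrable_def)
  show "(\<lambda>x. f x + g x) \<in> borel_measurable M" by measurable
  show "integrable M (\<lambda>x. (cmod (f x + g x))\<^sup>2)"
  proof (rule Bochner_Integration.integrable_bound)
    show "integrable M (\<lambda>x. 2 * (cmod (f x))\<^sup>2 + 2 * (cmod (g x))\<^sup>2)"
      using assms by (auto simp: square_integrable_def)
    show "AE x in M. norm ((cmod (f x + g x))\<^sup>2) \<le> norm (2 * (cmod (f x))\<^sup>2 + 2 * (cmod (g x))\<^sup>2)"
      using cmod_add_square_le by (intro AE_I2) auto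
  qed measurable
qed

lemma square_integrable_cmult:
  assumes "square_integrable M f"
  shows "square_integrable M (\<lambda>x. a * f x)"
  using assms unfolding square_integrable_def by (auto simp: norm_mult power_mult_distrib)

lemma square_integrable_diff:
  assumes "square_integrable M f" "square_integrable M g"
  shows "square_integrable M (\<lambda>x. f x - g x)"
  using square_integrable_add[OF assms(1) square_integrable_cmult[OF assms(2), of "-1"]] by simp

lemma square_integrable_sum:
  assumes "\<And>i. i \<in> F \<Longrightarrow> square_integrable M (f i)"
  shows "square_integrable M (\<lambda>x. \<Sum>i\<in>F. f i x)"
  using assms
proof (induction F rule: infinite_finite_induct)
  case (insert i F)
  then show ?case by (simp add: square_integrable_add)
qed (simp_all add: square_integrable_def)

lemma square_integrable_finite_combinations:
  assumes "\<And>i. i \<in> I \<Longrightarrow> square_integrable M (e i)" "h \<in> finite_combinations I e"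
  shows "square_integrable M h"
proof -
  obtain F c where F: "F \<subseteq> I" and h: "h = (\<lambda>x. \<Sum>i\<in>F. c i * e i x)"
    using assms(2) unfolding finite_combinations_def by blast
  show ?thesis
    unfolding h using F by (intro square_integrable_sum square_integrable_cmult assms(1)) auto
qed

lemma (in finite_measure) square_integrable_bounded:
  assumes "f \<in> borel_measurable M" "\<And>x. x \<in> space M \<Longrightarrow> cmod (f x) \<le> C"
  shows "square_integrable M f"
  unfolding square_integrable_def
proof
  show "integrable M (\<lambda>x. (cmod (f x))\<^sup>2)"
    using assms by (intro integrable_const_bound[where B = "C\<^sup>2"] AE_I2) (auto intro!: power_mono)
qed fact

lemma L2_dist_triangle:
  assumes "square_integrable M f" "square_integrable M g" "square_integrable M h"
  shows "(LINT x|M. (cmod (f x - h x))\<^sup>2) \<le>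
    2 * (LINT x|M. (cmod (f x - g x))\<^sup>2) + 2 * (LINT x|M. (cmod (g x - h x))\<^sup>2)"
proof -
  have int: "integrable M (\<lambda>x. (cmod (f x - h x))\<^sup>2)" "integrable M (\<lambda>x. (cmod (f x - g x))\<^sup>2)"
      "integrable M (\<lambda>x. (cmod (g x - h x))\<^sup>2)"
    using assms square_integrable_diff unfolding square_integrable_def[of _ "\<lambda>x. _ x - _ x"] by blast+
  have "(LINT x|M. (cmod (f x - h x))\<^sup>2) \<le> (LINT x|M. 2 * (cmod (f x - g x))\<^sup>2 + 2 * (cmod (g x - h x))\<^sup>2)"
  proof (rule integral_mono)
    fix x
    show "(cmod (f x - h x))\<^sup>2 \<le> 2 * (cmod (f x - g x))\<^sup>2 + 2 * (cmod (g x - h x))\<^sup>2"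
      using cmod_add_square_le[of "f x - g x" "g x - h x"] by simp
  qed (use int in auto)
  then show ?thesis using int by simp
qed

lemma L2_approximable_closed:
  assumes e: "\<And>i. i \<in> I \<Longrightarrow> square_integrable M (e i)"
    and f: "square_integrable M f"
    and approx: "\<And>\<epsilon>. \<epsilon> > 0 \<Longrightarrow> \<exists>g. L2_approximable M I e g \<and> (LINT x|M. (cmod (f x - g x))\<^sup>2) < \<epsilon>"
  shows "L2_approximable M I e f"
  unfolding L2_approximable_def
proof (intro conjI allI impI f)
  fix \<epsilon> :: real assume "\<epsilon> > 0"
  then obtain g where g: "L2_approximable M I e g" "(LINT x|M. (cmod (f x - g x))\<^sup>2) < \<epsilon> / 4"
    using approx[of "\<epsilon> / 4"] by auto
  then obtain h where h: "h \<in> finite_combinations I e" "(LINT x|M. (cmod (g x - h x))\<^sup>2) < \<epsilon> / 4"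
    using \<open>\<epsilon> > 0\<close> unfolding L2_approximable_def by (meson zero_less_divide_iff zero_less_numeral)
  have "(LINT x|M. (cmod (f x - h x))\<^sup>2) < \<epsilon>"
    using L2_dist_triangle[OF f _ square_integrable_finite_combinations[OF e h(1)], of g] g h
    by (simp add: L2_approximable_def)
  with h show "\<exists>h\<in>finite_combinations I e. (LINT x|M. (cmod (f x - h x))\<^sup>2) < \<epsilon>" by blast
qed

lemma L2_approximable_add:
  assumes e: "\<And>i. i \<in> I \<Longrightarrow> square_integrable M (e i)"
    and f: "L2_approximable M I e f" and g: "L2_approximable M I e g"
  shows "L2_approximable M I e (\<lambda>x. f x + g x)"
  unfolding L2_approximable_def
proof (intro conjI allI impI)
  show "square_integrable M (\<lambda>x. f x + g x)"
    using f g by (simp add: L2_approximable_def square_integrable_add)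
  fix \<epsilon> :: real assume "\<epsilon> > 0"
  then have "\<epsilon> / 4 > 0" by simp
  then obtain h k where h: "h \<in> finite_combinations I e" "(LINT x|M. (cmod (f x - h x))\<^sup>2) < \<epsilon> / 4"
      and k: "k \<in> finite_combinations I e" "(LINT x|M. (cmod (g x - k x))\<^sup>2) < \<epsilon> / 4"
    using f g unfolding L2_approximable_def by meson
  have sq: "square_integrable M f" "square_integrable M g" "square_integrable M h" "square_integrable M k"
    using f g square_integrable_finite_combinations[OF e] h k by (auto simp: L2_approximable_def)
  have "(LINT x|M. (cmod ((f x + g x) - (h x + k x)))\<^sup>2) \<le>
      2 * (LINT x|M. (cmod ((f x + g x) - (h x + g x)))\<^sup>2) + 2 * (LINT x|M. (cmod ((h x + g x) - (h x + k x)))\<^sup>2)"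
    by (intro L2_dist_triangle square_integrable_add sq)
  also have "\<dots> < \<epsilon>" using h k by simp
  finally show "\<exists>h\<in>finite_combinations I e. (LINT x|M. (cmod (f x + g x - h x))\<^sup>2) < \<epsilon>"
    by (rule bexI[OF _ finite_combinations_add[OF h(1) k(1)]])
qed

lemma L2_approximable_cmult:
  assumes f: "L2_approximable M I e f"
  shows "L2_approximable M I e (\<lambda>x. a * f x)"
  unfolding L2_approximable_def
proof (intro conjI allI impI)
  show "square_integrable M (\<lambda>x. a * f x)"
    using f by (simp add: L2_approximable_def square_integrable_cmult)
  fix \<epsilon> :: real assume \<epsilon>: "\<epsilon> > 0"
  then have "\<epsilon> / ((cmod a)\<^sup>2 + 1) > 0" by (simp add: add_nonneg_pos)
  then obtain h where h: "h \<in> finite_combinations I e" "(LINT x|M. (cmod (f x - h x))\<^sup>2) < \<epsilon> / ((cmod a)\<^sup>2 + 1)"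
    using f unfolding L2_approximable_def by meson
  have "(LINT x|M. (cmod (a * f x - a * h x))\<^sup>2) = (cmod a)\<^sup>2 * (LINT x|M. (cmod (f x - h x))\<^sup>2)"
    by (simp add: norm_mult power_mult_distrib flip: right_diff_distrib)
  also have "\<dots> \<le> ((cmod a)\<^sup>2 + 1) * (LINT x|M. (cmod (f x - h x))\<^sup>2)"
    by (intro mult_right_mono) auto
  also have "\<dots> < \<epsilon>"
    using h(2) by (simp add: pos_less_divide_eq add_nonneg_pos mult.commute)
  finally show "\<exists>h\<in>finite_combinations I e. (LINT x|M. (cmod (a * f x - h x))\<^sup>2) < \<epsilon>"
    by (rule bexI[OF _ finite_combinations_cmult[OF h(1)]])
qed

lemma L2_approximable_zero: "L2_approximable M I e (\<lambda>x. 0)"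
  unfolding L2_approximable_def
proof (intro conjI allI impI)
  fix \<epsilon> :: real assume "\<epsilon> > 0"
  moreover have "(\<lambda>x. 0) \<in> finite_combinations I e"
    unfolding finite_combinations_def by (rule CollectI, intro exI[of _ "{}"]) simp
  ultimately show "\<exists>h\<in>finite_combinations I e. (LINT x|M. (cmod (0 - h x))\<^sup>2) < \<epsilon>"
    by (intro bexI[of _ "\<lambda>x. 0"]) auto
qed (simp add: square_integrable_def)

lemma L2_approximable_sum:
  assumes e: "\<And>i. i \<in> I \<Longrightarrow> square_integrable M (e i)"
    and "\<And>j. j \<in> J \<Longrightarrow> L2_approximable M I e (f j)"
  shows "L2_approximable M I e (\<lambda>x. \<Sum>j\<in>J. f j x)"
  using assms(2)
  by (induction J rule: infinite_finite_induct) (auto intro!: L2_approximable_zero L2_approximable_add[OF e])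

lemma L2_approximable_AE_cong:
  assumes "AE x in M. f x = g x" "g \<in> borel_measurable M" "L2_approximable M I e f"
    and e: "\<And>i. i \<in> I \<Longrightarrow> square_integrable M (e i)"
  shows "L2_approximable M I e g"
proof (rule L2_approximable_closed[OF e])
  have f: "f \<in> borel_measurable M" "integrable M (\<lambda>x. (cmod (f x))\<^sup>2)"
    using assms by (auto simp: L2_approximable_def square_integrable_def)
  show "square_integrable M g"
    unfolding square_integrable_def
  proof
    show "integrable M (\<lambda>x. (cmod (g x))\<^sup>2)"
      using assms f by (subst integrable_cong_AE[where g = "\<lambda>x. (cmod (f x))\<^sup>2"]) auto
  qed fact
  fix \<epsilon> :: real assume "\<epsilon> > 0"
  moreover have "(LINT x|M. (cmod (g x - f x))\<^sup>2) = (LINT x|M. 0)"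
    using assms f by (intro integral_cong_AE) auto
  ultimately show "\<exists>h. L2_approximable M I e h \<and> (LINT x|M. (cmod (g x - h x))\<^sup>2) < \<epsilon>"
    using assms(3) by (intro exI[of _ f]) auto
qed

text \<open>Dominated convergence applied to |f - g_n|^2, with majorant 4 w^2. It serves to reach
  indicators from continuous functions and general functions from simple ones.\<close>

lemma L2_approximable_dominated_limit:
  assumes e: "\<And>i. i \<in> I \<Longrightarrow> square_integrable M (e i)"
    and f: "f \<in> borel_measurable M"
    and w: "integrable M (\<lambda>x. (w x)\<^sup>2)"
    and g: "\<And>n. L2_approximable M I e (g n)"
    and lim: "\<And>x. x \<in> space M \<Longrightarrow> (\<lambda>n. g n x) \<longlonglongrightarrow> f x"
    and bound: "\<And>n x. x \<in> space M \<Longrightarrow> cmod (g n x) \<le> w x"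
  shows "L2_approximable M I e f"
proof (rule L2_approximable_closed[OF e])
  have gm: "g n \<in> borel_measurable M" for n
    using g by (auto simp: L2_approximable_def square_integrable_def)
  have fw: "cmod (f x) \<le> w x" if "x \<in> space M" for x
    by (rule tendsto_upperbound[OF tendsto_norm[OF lim[OF that]]]) (auto simp: bound that)
  have w0: "0 \<le> w x" if "x \<in> space M" for x
    using bound[OF that, of 0] norm_ge_zero order_trans by blast
  show "square_integrable M f"
    unfolding square_integrable_def
  proof
    show "integrable M (\<lambda>x. (cmod (f x))\<^sup>2)"
      using f fw by (intro Bochner_Integration.integrable_bound[OF w] AE_I2) (auto intro!: power_mono)
  qed fact
  have "(\<lambda>n. LINT x|M. (cmod (f x - g n x))\<^sup>2) \<longlonglongrightarrow> (LINT x|M. 0)"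
  proof (rule integral_dominated_convergence[where w = "\<lambda>x. 4 * (w x)\<^sup>2"])
    show "integrable M (\<lambda>x. 4 * (w x)\<^sup>2)" using w by simp
    show "AE x in M. (\<lambda>n. (cmod (f x - g n x))\<^sup>2) \<longlonglongrightarrow> 0"
    proof (rule AE_I2)
      fix x assume "x \<in> space M"
      then have "(\<lambda>n. (cmod (f x - g n x))\<^sup>2) \<longlonglongrightarrow> (cmod (f x - f x))\<^sup>2"
        by (intro tendsto_intros lim)
      then show "(\<lambda>n. (cmod (f x - g n x))\<^sup>2) \<longlonglongrightarrow> 0" by simp
    qed
    show "AE x in M. norm ((cmod (f x - g n x))\<^sup>2) \<le> 4 * (w x)\<^sup>2" for n
    proof (rule AE_I2)
      fix x assume x: "x \<in> space M"
      have "cmod (f x - g n x) \<le> 2 * w x"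
        using norm_triangle_ineq4[of "f x" "g n x"] fw[OF x] bound[OF x, of n] by linarith
      then have "(cmod (f x - g n x))\<^sup>2 \<le> (2 * w x)\<^sup>2" by (intro power_mono) auto
      then show "norm ((cmod (f x - g n x))\<^sup>2) \<le> 4 * (w x)\<^sup>2" by (simp add: power_mult_distrib)
    qed
  qed (use f gm in \<open>auto intro!: borel_measurable_power borel_measurable_norm borel_measurable_diff\<close>)
  then have lim0: "(\<lambda>n. LINT x|M. (cmod (f x - g n x))\<^sup>2) \<longlonglongrightarrow> 0" by simp
  fix \<epsilon> :: real assume "\<epsilon> > 0"
  then have "eventually (\<lambda>n. (LINT x|M. (cmod (f x - g n x))\<^sup>2) < \<epsilon>) sequentially"
    by (rule order_tendstoD(2)[OF lim0])
  then obtain n where "(LINT x|M. (cmod (f x - g n x))\<^sup>2) < \<epsilon>"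
    by (auto simp: eventually_sequentially)
  then show "\<exists>g. L2_approximable M I e g \<and> (LINT x|M. (cmod (f x - g x))\<^sup>2) < \<epsilon>"
    using g by blast
qed

text \<open>
  Since \<open>cos\<close> is injective on \<open>[0, 1]\<close>, half-lines are superlevel sets of \<open>cos\<close> there; their
  indicators are limits of polynomials in \<open>cos x\<close>, which are trigonometric polynomials.
\<close>
lemma (in real_distribution) exponentials_dense_L2:
  assumes unit: "AE x in M. x \<in> {0..1}"
    and e: "\<And>i. i \<in> I \<Longrightarrow> square_integrable M (e i)"
    and exps: "\<And>\<xi>. L2_approximable M I e (\<lambda>x. iexp (\<xi> * x))"
    and f: "square_integrable M f"
  shows "L2_approximable M I e f"
proof -
  note add = L2_approximable_add[OF e] and cmult = L2_approximable_cmult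
  have powers: "L2_approximable M I e (\<lambda>x. iexp (\<xi> * x) * complex_of_real (cos x) ^ k)" for \<xi> k
  proof (induction k arbitrary: \<xi>)
    case 0
    then show ?case using exps by simp
  next
    case (Suc k)
    \<comment> \<open>By Euler's formula a factor cos x moves the frequency by 1 in either
      direction, which is why the induction runs over all \<xi>.\<close>
    have "L2_approximable M I e (\<lambda>x. (1 / 2) * (iexp ((\<xi> + 1) * x) * complex_of_real (cos x) ^ k) +
        (1 / 2) * (iexp ((\<xi> - 1) * x) * complex_of_real (cos x) ^ k))"
      by (intro add cmult Suc)
    also have "(\<lambda>x. (1 / 2) * (iexp ((\<xi> + 1) * x) * complex_of_real (cos x) ^ k) +
        (1 / 2) * (iexp ((\<xi> - 1) * x) * complex_of_real (cos x) ^ k)) =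
        (\<lambda>x. iexp (\<xi> * x) * complex_of_real (cos x) ^ Suc k)"
    proof
      fix x :: real
      have "complex_of_real (cos x) = (iexp x + iexp (- x)) / 2"
        by (simp add: cos_exp_eq cos_of_real[symmetric])
      moreover have "iexp ((\<xi> + 1) * x) = iexp (\<xi> * x) * iexp x" "iexp ((\<xi> - 1) * x) = iexp (\<xi> * x) * iexp (- x)"
        by (simp_all add: algebra_simps flip: exp_add)
      ultimately show "(1 / 2) * (iexp ((\<xi> + 1) * x) * complex_of_real (cos x) ^ k) +
        (1 / 2) * (iexp ((\<xi> - 1) * x) * complex_of_real (cos x) ^ k) =
        iexp (\<xi> * x) * complex_of_real (cos x) ^ Suc k"
        by (simp only: power_Suc) (simp add: algebra_simps)
    qed
    finally show ?case .
  qed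
  have polys: "L2_approximable M I e (\<lambda>x. complex_of_real (p (cos x)))" if "real_polynomial_function p" for p
  proof -
    from that obtain a n where p: "p = (\<lambda>x. \<Sum>i\<le>n. a i * x ^ i)"
      unfolding real_polynomial_function_iff_sum by (elim exE)
    have "L2_approximable M I e (\<lambda>x. \<Sum>i\<le>n. complex_of_real (a i) * (iexp (0 * x) * complex_of_real (cos x) ^ i))"
      by (intro L2_approximable_sum[OF e] cmult powers)
    then show ?thesis by (simp add: p)
  qed
  have cont: "L2_approximable M I e (\<lambda>x. complex_of_real (\<phi> (cos x)))" if \<phi>: "continuous_on UNIV \<phi>" for \<phi> :: "real \<Rightarrow> real"
  proof (rule L2_approximable_closed[OF e])
    have [measurable]: "\<phi> \<in> borel_measurable borel" using \<phi> by (rule borel_measurable_continuous_onI)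
    have "compact (\<phi> ` {-1..1})" using \<phi> by (intro compact_continuous_image) (auto intro: continuous_on_subset)
    then have "bounded (\<phi> ` {-1..1})" by (rule compact_imp_bounded)
    then obtain C where "\<forall>y\<in>\<phi> ` {-1..1}. \<bar>y\<bar> \<le> C"
      unfolding bounded_real by (elim exE)
    then have C: "\<bar>\<phi> u\<bar> \<le> C" if "u \<in> {-1..1}" for u
      using that by (meson imageI)
    show "square_integrable M (\<lambda>x. complex_of_real (\<phi> (cos x)))"
      by (rule square_integrable_bounded[where C = C]) (use C in auto)
    fix \<epsilon> :: real assume "\<epsilon> > 0"
    then have "sqrt (\<epsilon> / 2) > 0" by simp
    with \<phi> obtain p where p: "real_polynomial_function p" "\<And>u. u \<in> {-1..1} \<Longrightarrow> \<bar>\<phi> u - p u\<bar> < sqrt (\<epsilon> / 2)"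
      by (metis Stone_Weierstrass_real_polynomial_function compact_Icc continuous_on_subset top_greatest)
    have [measurable]: "p \<in> borel_measurable borel"
      using p(1) by (intro borel_measurable_continuous_onI continuous_on_polymonial_function)
        (simp add: real_polynomial_function_eq)
    have sq: "(cmod (complex_of_real (\<phi> (cos x)) - complex_of_real (p (cos x))))\<^sup>2 \<le> \<epsilon> / 2" for x
    proof -
      have "\<bar>\<phi> (cos x) - p (cos x)\<bar> \<le> sqrt (\<epsilon> / 2)" using p(2)[of "cos x"] by simp
      then have "\<bar>\<phi> (cos x) - p (cos x)\<bar>\<^sup>2 \<le> (sqrt (\<epsilon> / 2))\<^sup>2" by (intro power_mono) auto
      then show ?thesis using \<open>\<epsilon> > 0\<close> by (simp flip: of_real_diff)
    qed
    have "(LINT x|M. (cmod (complex_of_real (\<phi> (cos x)) - complex_of_real (p (cos x))))\<^sup>2) \<le> (LINT x|M. \<epsilon> / 2)"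
      using sq \<open>\<epsilon> > 0\<close> by (intro integral_mono integrable_const_bound[where B = "\<epsilon> / 2"]) auto
    also have "\<dots> < \<epsilon>" using \<open>\<epsilon> > 0\<close> prob_space by simp
    finally show "\<exists>g. L2_approximable M I e g \<and> (LINT x|M. (cmod (complex_of_real (\<phi> (cos x)) - g x))\<^sup>2) < \<epsilon>"
      using polys[OF p(1)] by blast
  qed
  \<comment> \<open>Continuous ramps of slope n increase to the indicator.\<close>
  have superlevel: "L2_approximable M I e (\<lambda>x. indicator {x. a < cos x} x)" for a :: real
  proof (rule L2_approximable_dominated_limit[OF e, where w = "\<lambda>_. 1"
        and g = "\<lambda>n x. complex_of_real (min 1 (real n * max 0 (cos x - a)))"])
    show "L2_approximable M I e (\<lambda>x. complex_of_real (min 1 (real n * max 0 (cos x - a))))" for n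
      by (rule cont[of "\<lambda>u. min 1 (real n * max 0 (u - a))"]) (intro continuous_intros)
    fix x :: real
    show "(\<lambda>n. complex_of_real (min 1 (real n * max 0 (cos x - a)))) \<longlonglongrightarrow> indicator {x. a < cos x} x"
    proof (cases "a < cos x")
      case True
      then obtain n0 where n0: "1 / (cos x - a) \<le> real n0" using real_arch_simple by blast
      have "min 1 (real n * max 0 (cos x - a)) = 1" if "n \<ge> n0" for n
      proof -
        have "1 / (cos x - a) \<le> real n" using n0 that by (meson of_nat_le_iff order_trans)
        then show ?thesis using True by (simp add: divide_le_eq)
      qed
      then have "eventually (\<lambda>n. complex_of_real (min 1 (real n * max 0 (cos x - a))) = 1) sequentially"
        unfolding eventually_sequentially by (intro exI[of _ n0]) auto
      then show ?thesis using True by (simp add: tendsto_eventually)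
    qed simp
    show "cmod (complex_of_real (min 1 (real n * max 0 (cos x - a)))) \<le> 1" for n
      by (simp only: norm_of_real) (auto simp: abs_le_iff intro: order_trans[of _ 0])
  qed auto
  have halfline: "L2_approximable M I e (\<lambda>x. indicator {..<b} x)" for b :: real
  proof (rule L2_approximable_AE_cong[OF _ _ superlevel e])
    \<comment> \<open>cos decreases on [0, \<pi>], so x < b becomes cos b < cos x. Outside (0, 1]
      the threshold is clamped: no cosine exceeds 1, and all cosines on [0, 1] exceed -1.\<close>
    define a where "a = (if b \<le> 0 then 1 else if b > 1 then -1 else cos b)"
    show "AE x in M. indicator {x. a < cos x} x = (indicator {..<b} x :: complex)"
      using unit
    proof eventually_elim
      case (elim x)
      have x: "0 \<le> x" "x \<le> pi" using elim pi_gt3 by auto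
      have "a < cos x \<longleftrightarrow> x < b"
      proof -
        consider "b \<le> 0" | "b > 1" | "0 < b" "b \<le> 1" by linarith
        then show ?thesis
        proof cases
          case 1
          then show ?thesis using x by (simp add: a_def not_less)
        next
          case 2
          have "cos pi < cos x" using x elim pi_gt3 by (intro cos_monotone_0_pi) auto
          then show ?thesis using 2 elim by (simp add: a_def)
        next
          case 3
          then show ?thesis using x pi_gt3 cos_mono_less_eq[of b x] by (simp add: a_def)
        qed
      qed
      then show ?case by (simp add: indicator_def)
    qed
  qed auto
  \<comment> \<open>Dynkin's argument: half-lines are stable under intersection and generate the
    Borel sets.\<close>
  have borel_sets: "L2_approximable M I e (\<lambda>x. indicator A x)" if "A \<in> sets borel" for A :: "real set"
  proof -
    have "{..<a} \<inter> {..<b} = {..<min a b}" for a b :: real by auto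
    then have "Int_stable (range (lessThan :: real \<Rightarrow> real set))"
      by (auto simp: Int_stable_def)
    moreover have "range lessThan \<subseteq> Pow (UNIV :: real set)" by simp
    moreover have "A \<in> sigma_sets UNIV (range lessThan)"
      using that by (simp add: borel_Iio sets_measure_of)
    ultimately show ?thesis
    proof (induct rule: sigma_sets_induct_disjoint)
      case (basic A)
      then show ?case using halfline by auto
    next
      case empty
      then show ?case using L2_approximable_zero by simp
    next
      case (compl A)
      have "L2_approximable M I e (\<lambda>x. iexp (0 * x) + (- 1) * indicator A x)"
        by (intro add cmult exps compl)
      then show ?case by (simp add: indicator_diff)
    next
      case (union A)
      have Am: "A i \<in> sets borel" for i
        using union(2) by (auto simp: borel_Iio sets_measure_of)
      have "L2_approximable M I e (\<lambda>x. \<Sum>i<n. indicator (A i) x)" for n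
        by (rule L2_approximable_sum[OF e union(3)])
      moreover have part: "(\<Sum>i<n. indicator (A i) x) = (indicator (\<Union>i<n. A i) x :: complex)" for n x
        using union(1) by (subst indicator_UN_disjoint) (auto simp: disjoint_family_on_def)
      ultimately have unions: "L2_approximable M I e (\<lambda>x. indicator (\<Union>i<n. A i) x)" for n
        by simp
      show ?case
      proof (rule L2_approximable_dominated_limit[OF e, where w = "\<lambda>_. 1"
            and g = "\<lambda>n x. indicator (\<Union>i<n. A i) x"])
        show "L2_approximable M I e (\<lambda>x. indicator (\<Union>i<n. A i) x)" for n by (rule unions)
        fix x :: real
        show "(\<lambda>n. indicator (\<Union>i<n. A i) x :: complex) \<longlonglongrightarrow> indicator (\<Union>i. A i) x"
          by (rule LIMSEQ_indicator_UN)
      qed (use Am in \<open>auto simp: indicator_def\<close>)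
    qed
  qed
  have simple: "L2_approximable M I e s" if s: "simple_function M s" for s :: "real \<Rightarrow> complex"
  proof -
    have "L2_approximable M I e (\<lambda>x. \<Sum>y\<in>s ` space M. y * indicator (s -` {y} \<inter> space M) x)"
      using simple_functionD(2)[OF s] by (intro L2_approximable_sum[OF e] cmult borel_sets) auto
    moreover have "s = (\<lambda>x. \<Sum>y\<in>s ` space M. y * indicator (s -` {y} \<inter> space M) x)"
    proof
      fix x
      have "s x = (\<Sum>y\<in>s ` space M. indicator (s -` {y} \<inter> space M) x *\<^sub>R y)"
        by (rule simple_function_indicator_representation_banach[OF s]) simp
      also have "\<dots> = (\<Sum>y\<in>s ` space M. y * indicator (s -` {y} \<inter> space M) x)"
        by (intro sum.cong refl) (simp split: split_indicator)
      finally show "s x = (\<Sum>y\<in>s ` space M. y * indicator (s -` {y} \<inter> space M) x)" .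
    qed
    ultimately show ?thesis by simp
  qed
  obtain s where s: "\<And>i. simple_function M (s i)" "\<And>x. x \<in> space M \<Longrightarrow> (\<lambda>i. s i x) \<longlonglongrightarrow> f x"
      "\<And>i x. x \<in> space M \<Longrightarrow> dist (s i x) 0 \<le> 2 * dist (f x) 0"
    using f borel_measurable_implies_sequence_metric[of f M 0] unfolding square_integrable_def by blast
  show ?thesis
    by (rule L2_approximable_dominated_limit[OF e, where w = "\<lambda>x. 2 * cmod (f x)" and g = s])
      (use f s simple in \<open>auto simp: square_integrable_def power_mult_distrib\<close>)
qed


section \<open>Bessel's identity and the Parseval criterion for a spectrum\<close>

context real_distribution
begin

lemma L2_inner_exponentials:
  "L2_inner M (\<lambda>x. iexp (2 * pi * \<xi> * x)) (\<lambda>x. iexp (2 * pi * \<eta> * x)) = fourier_transform M (\<eta> - \<xi>)"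
  unfolding L2_inner_def fourier_transform_def
  by (intro Bochner_Integration.integral_cong) (auto simp: exp_cnj algebra_simps simp flip: exp_add)

lemma integrable_exponentials: "integrable M (\<lambda>x. iexp (2 * pi * \<xi> * x) * cnj (iexp (2 * pi * \<eta> * x)))"
proof -
  have "(\<lambda>x. iexp (2 * pi * \<xi> * x) * cnj (iexp (2 * pi * \<eta> * x))) = (\<lambda>x. iexp (2 * pi * (\<xi> - \<eta>) * x))"
    by (auto simp: exp_cnj algebra_simps simp flip: exp_add)
  then show ?thesis by (simp only:) (rule integrable_iexp, auto)
qed

text \<open>The coefficients are the inner products of the exponential of frequency \<xi> with those
  of frequencies l, so this is Pythagoras for an orthogonal projection. It yields Bessel's
  inequality and also measures how well \<xi> is approximated.\<close>

lemma L2_dist_exponential_projection: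
  assumes F: "finite F"
    and orth: "\<And>l k. l \<in> F \<Longrightarrow> k \<in> F \<Longrightarrow> l \<noteq> k \<Longrightarrow> fourier_transform M (l - k) = 0"
  shows "(LINT x|M. (cmod (iexp (2 * pi * \<xi> * x) -
      (\<Sum>l\<in>F. fourier_transform M (l - \<xi>) * iexp (2 * pi * l * x))))\<^sup>2) =
    1 - (\<Sum>l\<in>F. (cmod (fourier_transform M (l - \<xi>)))\<^sup>2)"
proof -
  define e where "e = (\<lambda>\<xi> x. iexp (2 * pi * \<xi> * x))"
  define c where "c l = fourier_transform M (l - \<xi>)" for l
  have inner: "(CLINT x|M. e p x * cnj (e q x)) = fourier_transform M (q - p)" for p q
    using L2_inner_exponentials[of p q] by (simp add: e_def L2_inner_def)
  have int: "integrable M (\<lambda>x. e p x * cnj (e q x))" for p q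
    unfolding e_def by (rule integrable_exponentials)
  have cnj: "fourier_transform M (\<xi> - l) = cnj (c l)" for l
  proof -
    have "cnj (c l) = (CLINT x|M. cnj (e \<xi> x * cnj (e l x)))"
      by (simp only: c_def inner[symmetric] Bochner_Integration.integral_cnj)
    also have "\<dots> = (CLINT x|M. e l x * cnj (e \<xi> x))"
      by (simp add: mult.commute)
    finally show ?thesis by (simp add: inner)
  qed
  have zero: "fourier_transform M 0 = 1"
    by (simp add: fourier_transform_eq_char char_zero)
  have "complex_of_real (LINT x|M. (cmod (e \<xi> x - (\<Sum>l\<in>F. c l * e l x)))\<^sup>2) =
      (CLINT x|M. (e \<xi> x - (\<Sum>l\<in>F. c l * e l x)) * cnj (e \<xi> x - (\<Sum>l\<in>F. c l * e l x)))"
    by (simp only: integral_complex_of_real[symmetric] complex_norm_square)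
  also have "\<dots> = (CLINT x|M. e \<xi> x * cnj (e \<xi> x) - (\<Sum>l\<in>F. cnj (c l) * (e \<xi> x * cnj (e l x))) -
      (\<Sum>l\<in>F. c l * (e l x * cnj (e \<xi> x))) + (\<Sum>l\<in>F. \<Sum>k\<in>F. c l * cnj (c k) * (e l x * cnj (e k x))))"
  proof (intro Bochner_Integration.integral_cong refl)
    fix x
    define S where "S = (\<Sum>l\<in>F. c l * e l x)"
    have 1: "(\<Sum>l\<in>F. cnj (c l) * (e \<xi> x * cnj (e l x))) = e \<xi> x * cnj S"
      by (simp add: S_def sum_distrib_left mult_ac)
    have 2: "(\<Sum>l\<in>F. c l * (e l x * cnj (e \<xi> x))) = S * cnj (e \<xi> x)"
      by (simp add: S_def sum_distrib_left mult_ac)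
    have 3: "(\<Sum>l\<in>F. \<Sum>k\<in>F. c l * cnj (c k) * (e l x * cnj (e k x))) = S * cnj S"
      unfolding S_def cnj_sum sum_product by (intro sum.cong refl) (simp add: mult_ac)
    show "(e \<xi> x - (\<Sum>l\<in>F. c l * e l x)) * cnj (e \<xi> x - (\<Sum>l\<in>F. c l * e l x)) =
        e \<xi> x * cnj (e \<xi> x) - (\<Sum>l\<in>F. cnj (c l) * (e \<xi> x * cnj (e l x))) -
        (\<Sum>l\<in>F. c l * (e l x * cnj (e \<xi> x))) + (\<Sum>l\<in>F. \<Sum>k\<in>F. c l * cnj (c k) * (e l x * cnj (e k x)))"
      unfolding 1 2 3 S_def[symmetric] by (simp add: algebra_simps)
  qed
  also have "\<dots> = fourier_transform M 0 - (\<Sum>l\<in>F. cnj (c l) * fourier_transform M (l - \<xi>)) -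
      (\<Sum>l\<in>F. c l * fourier_transform M (\<xi> - l)) +
      (\<Sum>l\<in>F. \<Sum>k\<in>F. c l * cnj (c k) * fourier_transform M (k - l))"
    using int by (simp add: inner integral_sum)
  also have "(\<Sum>l\<in>F. \<Sum>k\<in>F. c l * cnj (c k) * fourier_transform M (k - l)) =
      (\<Sum>l\<in>F. \<Sum>k\<in>F. if k = l then c l * cnj (c k) else 0)"
    using orth by (intro sum.cong) (auto simp: zero)
  also have "\<dots> = (\<Sum>l\<in>F. c l * cnj (c l))"
    using F by simp
  also have "fourier_transform M 0 - (\<Sum>l\<in>F. cnj (c l) * fourier_transform M (l - \<xi>)) -
      (\<Sum>l\<in>F. c l * fourier_transform M (\<xi> - l)) + (\<Sum>l\<in>F. c l * cnj (c l)) =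
      1 - (\<Sum>l\<in>F. c l * cnj (c l))"
    by (simp add: cnj zero c_def mult.commute)
  also have "\<dots> = complex_of_real (1 - (\<Sum>l\<in>F. (cmod (c l))\<^sup>2))"
    by (simp only: complex_norm_square of_real_diff of_real_sum of_real_1)
  finally show ?thesis
    unfolding of_real_eq_iff by (simp add: e_def c_def)
qed

text \<open>The Jorgensen--Pedersen criterion: Parseval is demanded for exponentials only, since
  exponentials of all frequencies are total for a measure on [0, 1]. By Bessel the sums never exceed
  1.\<close>

lemma is_spectrumI:
  assumes unit: "AE x in M. x \<in> {0..1}"
    and "countable \<Lambda>"
    and orth: "\<And>l k. l \<in> \<Lambda> \<Longrightarrow> k \<in> \<Lambda> \<Longrightarrow> l \<noteq> k \<Longrightarrow> fourier_transform M (l - k) = 0"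
    and parseval: "\<And>\<xi> \<epsilon>. \<epsilon> > 0 \<Longrightarrow> \<exists>F. finite F \<and> F \<subseteq> \<Lambda> \<and> 1 - \<epsilon> < (\<Sum>l\<in>F. (cmod (fourier_transform M (l - \<xi>)))\<^sup>2)"
  shows "is_spectrum M \<Lambda>"
  unfolding is_spectrum_def orthonormal_basis_L2_def
proof (intro conjI ballI allI impI)
  define e where "e = (\<lambda>\<xi> x. iexp (2 * pi * \<xi> * x))"
  have e: "square_integrable M (e \<xi>)" for \<xi>
    unfolding e_def by (rule square_integrable_bounded[where C = 1]) auto
  then show "square_integrable M (\<lambda>x. iexp (2 * pi * \<xi> * x))" for \<xi>
    by (simp add: e_def)
  show "L2_inner M (\<lambda>x. iexp (2 * pi * l * x)) (\<lambda>x. iexp (2 * pi * k * x)) = (if l = k then 1 else 0)"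
    if "l \<in> \<Lambda>" "k \<in> \<Lambda>" for l k
    using that orth[of k l] unfolding L2_inner_exponentials
    by (auto simp: fourier_transform_eq_char char_zero)
  have exps: "L2_approximable M \<Lambda> e (\<lambda>x. iexp (\<zeta> * x))" for \<zeta>
  proof -
    define \<xi> where "\<xi> = \<zeta> / (2 * pi)"
    have "L2_approximable M \<Lambda> e (e \<xi>)"
      unfolding L2_approximable_def
    proof (intro conjI allI impI e)
      fix \<epsilon> :: real assume "\<epsilon> > 0"
      then obtain F where F: "finite F" "F \<subseteq> \<Lambda>" "1 - \<epsilon> < (\<Sum>l\<in>F. (cmod (fourier_transform M (l - \<xi>)))\<^sup>2)"
        using parseval[of \<epsilon> \<xi>] by auto
      have "(LINT x|M. (cmod (e \<xi> x - (\<Sum>l\<in>F. fourier_transform M (l - \<xi>) * e l x)))\<^sup>2) =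
          1 - (\<Sum>l\<in>F. (cmod (fourier_transform M (l - \<xi>)))\<^sup>2)"
        unfolding e_def by (rule L2_dist_exponential_projection) (use F orth in auto)
      also have "\<dots> < \<epsilon>" using F(3) by simp
      finally show "\<exists>h\<in>finite_combinations \<Lambda> e. (LINT x|M. (cmod (e \<xi> x - h x))\<^sup>2) < \<epsilon>"
        using F(1,2) unfolding finite_combinations_def
        by (intro bexI[of _ "\<lambda>x. \<Sum>l\<in>F. fourier_transform M (l - \<xi>) * e l x"] CollectI exI[of _ F]
            exI[of _ "\<lambda>l. fourier_transform M (l - \<xi>)"]) auto
    qed
    moreover have "e \<xi> = (\<lambda>x. iexp (\<zeta> * x))" by (simp add: e_def \<xi>_def fun_eq_iff)
    ultimately show ?thesis by simp
  qed
  fix f :: "real \<Rightarrow> complex" and \<epsilon> :: real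
  assume f: "square_integrable M f" and "\<epsilon> > 0"
  have "L2_approximable M \<Lambda> e f"
    by (rule exponentials_dense_L2[OF unit e exps f])
  then obtain h where h: "h \<in> finite_combinations \<Lambda> e" "(LINT x|M. (cmod (f x - h x))\<^sup>2) < \<epsilon>\<^sup>2"
    using \<open>\<epsilon> > 0\<close> unfolding L2_approximable_def by (meson zero_less_power)
  then obtain F c where F: "finite F" "F \<subseteq> \<Lambda>" "\<And>x. h x = (\<Sum>l\<in>F. c l * e l x)"
    unfolding finite_combinations_def by blast
  have "sqrt (LINT x|M. (cmod (f x - h x))\<^sup>2) < \<epsilon>"
    using h(2) \<open>\<epsilon> > 0\<close> by (intro real_less_lsqrt) auto
  then show "\<exists>F c. finite F \<and> F \<subseteq> \<Lambda> \<and>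
      sqrt (LINT x|M. (cmod (f x - (\<Sum>i\<in>F. c i * iexp (2 * pi * i * x))))\<^sup>2) < \<epsilon>"
    using F by (intro exI[of _ F] exI[of _ c]) (simp add: e_def)
qed fact

end

section \<open>The spectrum\<close>

context moran_digits
begin

lemma Q_nonzero [simp]: "Q n \<noteq> 0"
  using Q_pos[of n] by linarith

lemma mask_prod_0 [simp]: "mask_prod 0 \<xi> = 1"
  and mask_prod_Suc: "mask_prod (Suc n) \<xi> = mask_prod n \<xi> * digit_mask (B n) (\<xi> / real (Q (Suc n)))"
  by (simp_all add: mask_prod_def)

lemma mask_prod_at_0: "mask_prod n 0 = 1"
  by (simp add: mask_prod_def digit_mask_0 B_finite B_nonempty)

lemma norm_mask_prod_le_1: "cmod (mask_prod n \<xi>) \<le> 1"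
  unfolding mask_prod_def prod_norm[symmetric] by (intro prod_le_1) (auto simp: norm_digit_mask_le_1)

lemma Q_dvd: "m \<le> n \<Longrightarrow> Q m dvd Q n"
  unfolding Q_def by (intro prod_dvd_prod_subset) auto

text \<open>For k < n the denominator \<open>Q (Suc k)\<close> divides \<open>Q n\<close>, so every
  argument moves by an integer.\<close>

lemma mask_prod_periodic: "mask_prod n (\<xi> + real (Q n) * of_int l) = mask_prod n \<xi>"
  unfolding mask_prod_def
proof (intro prod.cong refl)
  fix k assume "k \<in> {..<n}"
  then obtain q where q: "Q n = Q (Suc k) * q" using Q_dvd[of "Suc k" n] by (auto elim: dvdE)
  have "(\<xi> + real (Q n) * of_int l) / real (Q (Suc k)) = \<xi> / real (Q (Suc k)) + of_int (int q * l)"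
    by (simp add: q add_divide_distrib)
  then show "digit_mask (B k) ((\<xi> + real (Q n) * of_int l) / real (Q (Suc k))) = digit_mask (B k) (\<xi> / real (Q (Suc k)))"
    by (simp only: digit_mask_add_int)
qed

lemma mask_prod_eq_0_mono:
  assumes "mask_prod n \<xi> = 0" "n \<le> m"
  shows "mask_prod m \<xi> = 0"
  using assms(2) by (induction m rule: dec_induct) (auto simp: assms(1) mask_prod_Suc)

text \<open>\<open>Q\<close> at least doubles at each step, so 1 / Q_k \<le> 2 / Q_k - 2 / Q_(k+1),
  which telescopes.\<close>

lemma sum_inverse_Q_le: "a \<le> m \<Longrightarrow> (\<Sum>k\<in>{a..<m}. 1 / real (Q k)) \<le> 2 / real (Q a) - 2 / real (Q m)"
proof (induction m rule: dec_induct)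
  case (step m)
  have "2 / real (Q (Suc m)) \<le> 1 / real (Q m)"
    using N_ge_2[of m] Q_pos[of m] by (simp add: Q_Suc divide_simps) 
  then show ?case using step by simp
qed simp

end

text \<open>Jordan's inequality: by concavity the sine lies above its chord from 0 to \<pi> /
  2.\<close>

lemma two_mult_le_sin_pi:
  fixes y :: real
  assumes "0 \<le> y" "y \<le> 1 / 2"
  shows "2 * y \<le> sin (pi * y)"
proof -
  have "convex_on {0..pi} (\<lambda>x. - sin x)"
    by (rule f''_ge0_imp_convex[where f' = "\<lambda>x. - cos x" and f'' = sin])
       (auto intro!: derivative_eq_intros sin_ge_zero)
  from convex_onD[OF this, of "2 * y" 0 "pi / 2"] show ?thesis
    using assms by (simp add: mult.commute)
qed

text \<open>In the Dirichlet kernel the denominator is at most \<pi> |x| and the numerator at least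
  |x|. The bound 2 / 3 arises here: beyond 1 / 2 the chord estimate is 2 (1 - y), which stays above
  y up to y = 2 / 3.\<close>

lemma norm_digit_mask_lessThan_ge:
  assumes N: "N > 0" and x: "\<bar>x\<bar> \<le> 2 / 3"
  shows "1 / pi \<le> cmod (digit_mask {..<N} (x / real N))"
proof (cases "x = 0")
  case True
  then show ?thesis using N pi_gt3 by (simp add: digit_mask_0 lessThan_empty_iff)
next
  case False
  have sin_ge: "\<bar>x\<bar> \<le> \<bar>sin (pi * x)\<bar>"
  proof -
    define y where "y = \<bar>x\<bar>"
    have y: "0 < y" "y \<le> 2 / 3" using False x by (auto simp: y_def)
    have "y \<le> sin (pi * y)"
    proof (cases "y \<le> 1 / 2")
      case True
      have "2 * y \<le> sin (pi * y)"
        by (rule two_mult_le_sin_pi) (use y True in auto)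
      then show ?thesis using y by simp
    next
      case False
      have "2 * (1 - y) \<le> sin (pi * (1 - y))"
        by (rule two_mult_le_sin_pi) (use y False in auto)
      also have "sin (pi * (1 - y)) = sin (pi * y)"
        by (simp add: right_diff_distrib sin_diff)
      finally show ?thesis using y by simp
    qed
    also have "\<dots> \<le> \<bar>sin (pi * y)\<bar>" by simp
    also have "\<dots> = \<bar>sin (pi * x)\<bar>" unfolding y_def by (auto simp: abs_if)
    finally show ?thesis by (simp add: y_def)
  qed
  have "\<bar>x\<bar> \<le> cmod (digit_mask {..<N} (x / real N)) * (real N * \<bar>sin (pi * (x / real N))\<bar>)"
    using sin_ge norm_digit_mask_lessThan[of N "x / real N"] N by simp
  also have "\<dots> \<le> cmod (digit_mask {..<N} (x / real N)) * (real N * \<bar>pi * (x / real N)\<bar>)"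
    by (intro mult_left_mono abs_sin_x_le_abs_x) auto
  also have "\<dots> = cmod (digit_mask {..<N} (x / real N)) * pi * \<bar>x\<bar>"
    using N by (simp add: abs_mult)
  finally show ?thesis using False by (simp add: divide_le_eq)
qed

text \<open>\<open>L_orth\<close> and \<open>L_parseval\<close> express the Hadamard triple, the
  latter at every translate y because the lower levels shift the argument. \<open>L_bound\<close>
  centres the frequencies, and \<open>deviation\<close> compares each mask with that of a full digit
  set.\<close>

locale hadamard_moran = moran_digits +
  fixes L :: "nat \<Rightarrow> int set" and \<epsilon> :: "nat \<Rightarrow> real"
  assumes L_finite: "finite (L n)" and L_zero: "0 \<in> L n"
    and L_orth: "\<And>l k. l \<in> L n \<Longrightarrow> k \<in> L n \<Longrightarrow> l \<noteq> k \<Longrightarrow> digit_mask (B n) (of_int (l - k) / real (N n)) = 0"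
    and L_parseval: "(\<Sum>l\<in>L n. (cmod (digit_mask (B n) (y + of_int l / real (N n))))\<^sup>2) = 1"
    and L_bound: "l \<in> L n \<Longrightarrow> 2 * \<bar>l\<bar> \<le> int (N n)"
    and deviation: "cmod (digit_mask (B n) x - digit_mask {..<N n} x) \<le> \<epsilon> n"
    and \<epsilon>_tendsto_0: "\<epsilon> \<longlonglongrightarrow> 0"
    and inverse_N_tendsto_0: "(\<lambda>n. 1 / real (N n)) \<longlonglongrightarrow> 0"
begin

primrec freq :: "nat \<Rightarrow> int set" where
  "freq 0 = {0}"
| "freq (Suc n) = (\<lambda>(x, l). x + int (Q n) * l) ` (freq n \<times> L n)"

lemma freq_finite: "finite (freq n)"
  by (induction n) (auto simp: L_finite)

lemma freq_mono: "m \<le> n \<Longrightarrow> freq m \<subseteq> freq n"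
proof (induction n rule: dec_induct)
  case (step n)
  have "x \<in> freq (Suc n)" if "x \<in> freq n" for x
    using that L_zero[of n] by (auto intro!: image_eqI[of _ _ "(x, 0)"])
  then show ?case using step by blast
qed simp

text \<open>A multiple of \<open>Q n\<close> is invisible to the first n factors and moves the last
  one by a multiple of 1 / N_n; this reduces orthogonality and Parseval to the one new
  level.\<close>

lemma mask_prod_shift:
  "mask_prod (Suc n) (\<xi> + real (Q n) * of_int l) = mask_prod n \<xi> * digit_mask (B n) (\<xi> / real (Q (Suc n)) + of_int l / real (N n))"
  unfolding mask_prod_Suc mask_prod_periodic by (simp add: Q_Suc add_divide_distrib)

lemma freq_orth:
  "x \<in> freq n \<Longrightarrow> y \<in> freq n \<Longrightarrow> x \<noteq> y \<Longrightarrow> mask_prod n (of_int (x - y)) = 0"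
proof (induction n arbitrary: x y)
  case (Suc n)
  obtain u l where x: "u \<in> freq n" "l \<in> L n" "x = u + int (Q n) * l" using Suc.prems(1) by auto
  obtain v k where y: "v \<in> freq n" "k \<in> L n" "y = v + int (Q n) * k" using Suc.prems(2) by auto
  have "of_int (x - y) = of_int (u - v) + real (Q n) * of_int (l - k)"
    by (simp add: x y algebra_simps)
  then have eq: "mask_prod (Suc n) (of_int (x - y)) =
      mask_prod n (of_int (u - v)) * digit_mask (B n) (of_int (u - v) / real (Q (Suc n)) + of_int (l - k) / real (N n))"
    by (simp only: mask_prod_shift)
  show ?case
  proof (cases "u = v")
    case True
    then have "l \<noteq> k" using Suc.prems x y by auto
    then show ?thesis using eq True L_orth x y by simp
  next
    case False
    then show ?thesis using eq Suc.IH[OF x(1) y(1)] by simp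
  qed
qed simp

text \<open>Two representations of one number would make u - v a multiple of \<open>Q n\<close>,
  where \<open>mask_prod n\<close> is 1, against the orthogonality of u and v; no size estimate is
  involved.\<close>

lemma freq_inj: "inj_on (\<lambda>(x, l). x + int (Q n) * l) (freq n \<times> L n)"
proof (rule inj_onI, safe)
  fix u v l k
  assume u: "u \<in> freq n" and v: "v \<in> freq n" and eq: "u + int (Q n) * l = v + int (Q n) * k"
  show uv: "u = v"
  proof (rule ccontr)
    assume "u \<noteq> v"
    have "u - v = int (Q n) * (k - l)" using eq by (simp add: algebra_simps)
    then have "real_of_int (u - v) = 0 + real (Q n) * of_int (k - l)"
      by simp
    then have "mask_prod n (of_int (u - v)) = 1"
      by (simp only: mask_prod_periodic mask_prod_at_0)
    with freq_orth[OF u v \<open>u \<noteq> v\<close>] show False by simp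
  qed
  show "l = k" using eq uv Q_pos[of n] by simp
qed

lemma freq_parseval: "(\<Sum>x\<in>freq n. (cmod (mask_prod n (of_int x + \<xi>)))\<^sup>2) = 1"
proof (induction n)
  case (Suc n)
  have "(\<Sum>x\<in>freq (Suc n). (cmod (mask_prod (Suc n) (of_int x + \<xi>)))\<^sup>2) =
      (\<Sum>(x, l)\<in>freq n \<times> L n. (cmod (mask_prod (Suc n) ((of_int x + \<xi>) + real (Q n) * of_int l)))\<^sup>2)"
    unfolding freq.simps(2) by (subst sum.reindex[OF freq_inj]) (simp add: split_beta add_ac)
  also have "\<dots> = (\<Sum>x\<in>freq n. (cmod (mask_prod n (of_int x + \<xi>)))\<^sup>2 *
      (\<Sum>l\<in>L n. (cmod (digit_mask (B n) ((of_int x + \<xi>) / real (Q (Suc n)) + of_int l / real (N n))))\<^sup>2))"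
    unfolding mask_prod_shift by (simp add: sum.cartesian_product[symmetric] norm_mult power_mult_distrib sum_distrib_left)
  also have "\<dots> = 1" by (simp add: L_parseval Suc)
  finally show ?case .
qed simp

text \<open>The induction carries the cruder bound |x| \<le> Q_n. Splitting off the last digit gives
  the sharper form, close to half of \<open>Q (Suc n)\<close>, which the window 2 / 3
  requires.\<close>

lemma freq_Suc_bound: "x \<in> freq (Suc n) \<Longrightarrow> 2 * \<bar>x\<bar> \<le> 2 * int (Q n) + int (Q (Suc n))"
proof -
  have step: "2 * \<bar>x\<bar> \<le> 2 * int (Q n) + int (Q (Suc n))"
    if xS: "x \<in> freq (Suc n)" and IH: "\<And>x. x \<in> freq n \<Longrightarrow> \<bar>x\<bar> \<le> int (Q n)" for x n
  proof -
    obtain u l where x: "u \<in> freq n" "l \<in> L n" "x = u + int (Q n) * l" using xS by auto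
    have "\<bar>x\<bar> \<le> \<bar>u\<bar> + int (Q n) * \<bar>l\<bar>"
      using abs_triangle_ineq[of u "int (Q n) * l"] by (simp add: x(3) abs_mult)
    moreover have "2 * (int (Q n) * \<bar>l\<bar>) \<le> int (Q n) * int (N n)"
    proof -
      have "2 * (int (Q n) * \<bar>l\<bar>) = int (Q n) * (2 * \<bar>l\<bar>)" by simp
      also have "\<dots> \<le> int (Q n) * int (N n)" by (intro mult_left_mono L_bound x) simp
      finally show ?thesis .
    qed
    ultimately show ?thesis using IH[OF x(1)] unfolding Q_Suc of_nat_mult by linarith
  qed
  have *: "x \<in> freq n \<Longrightarrow> \<bar>x\<bar> \<le> int (Q n)" for x n
  proof (induction n arbitrary: x)
    case (Suc n)
    have "int (Q n) * 2 \<le> int (Q n) * int (N n)"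
      using N_ge_2[of n] by (intro mult_left_mono) auto
    then show ?case using step[OF Suc.prems Suc.IH] unfolding Q_Suc of_nat_mult by linarith
  qed simp
  show "x \<in> freq (Suc n) \<Longrightarrow> 2 * \<bar>x\<bar> \<le> 2 * int (Q n) + int (Q (Suc n))" by (rule step[OF _ *])
qed

text \<open>Inside the window the factor following \<open>mask_prod n\<close> is close to a
  Dirichlet kernel bounded below by 1 / \<pi>, and all later factors are close to 1.\<close>

lemma norm_fourier_ge_mask_prod:
  assumes \<xi>: "\<bar>\<xi>\<bar> \<le> 2 / 3 * real (Q n)" and True: "0 \<le> 1 / pi - \<epsilon> n" "0 \<le> 1 - 9 / real (N n)"
  shows "cmod (mask_prod n \<xi>) * ((1 / pi - \<epsilon> n) * (1 - 9 / real (N n))) \<le> cmod (fourier_transform moran_measure \<xi>)"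
proof -
  have first: "1 / pi - \<epsilon> n \<le> cmod (digit_mask (B n) (\<xi> / real (Q (Suc n))))"
  proof -
    have "\<bar>\<xi> / real (Q n)\<bar> \<le> 2 / 3" using \<xi> by (simp add: divide_le_eq)
    then have "1 / pi \<le> cmod (digit_mask {..<N n} (\<xi> / real (Q n) / real (N n)))"
      by (rule norm_digit_mask_lessThan_ge[OF N_pos])
    also have "\<xi> / real (Q n) / real (N n) = \<xi> / real (Q (Suc n))" by (simp add: Q_Suc)
    finally show ?thesis
      using deviation[of n "\<xi> / real (Q (Suc n))"] norm_triangle_ineq2[of "digit_mask {..<N n} (\<xi> / real (Q (Suc n)))" "digit_mask (B n) (\<xi> / real (Q (Suc n)))"]
      by (simp add: norm_minus_commute)
  qed
  \<comment> \<open>The Lipschitz bound puts factor k within 2 \<pi> |\<xi>| / Q_k of 1; summed over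
    k > n this is at most (8 \<pi> / 3) / N_n, rounded up to 9 / N_n.\<close>
  have tail: "1 - 9 / real (N n) \<le> cmod (\<Prod>k\<in>{Suc n..<m}. digit_mask (B k) (\<xi> / real (Q (Suc k))))" if "Suc n \<le> m" for m
  proof -
    have "cmod ((\<Prod>k\<in>{Suc n..<m}. digit_mask (B k) (\<xi> / real (Q (Suc k)))) - (\<Prod>k\<in>{Suc n..<m}. 1)) \<le>
        (\<Sum>k\<in>{Suc n..<m}. cmod (digit_mask (B k) (\<xi> / real (Q (Suc k))) - 1))"
      by (rule norm_prod_diff) (auto simp: norm_digit_mask_le_1)
    also have "\<dots> \<le> (\<Sum>k\<in>{Suc n..<m}. 2 * pi * \<bar>\<xi>\<bar> * (1 / real (Q k)))"
    proof (rule sum_mono)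
      fix k
      have "cmod (digit_mask (B k) (\<xi> / real (Q (Suc k))) - digit_mask (B k) 0) \<le> 2 * pi * real (N k) * \<bar>\<xi> / real (Q (Suc k)) - 0\<bar>"
        by (rule digit_mask_lipschitz[OF B_subset])
      then show "cmod (digit_mask (B k) (\<xi> / real (Q (Suc k))) - 1) \<le> 2 * pi * \<bar>\<xi>\<bar> * (1 / real (Q k))"
        using N_pos[of k] by (simp add: digit_mask_0 B_finite B_nonempty Q_Suc abs_mult)
    qed
    also have "\<dots> = 2 * pi * \<bar>\<xi>\<bar> * (\<Sum>k\<in>{Suc n..<m}. 1 / real (Q k))"
      by (simp add: sum_distrib_left)
    also have "\<dots> \<le> 2 * pi * \<bar>\<xi>\<bar> * (2 / real (Q (Suc n)))"
    proof (intro mult_left_mono)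
      have "0 \<le> 2 / real (Q m)" by simp
      then show "(\<Sum>k\<in>{Suc n..<m}. 1 / real (Q k)) \<le> 2 / real (Q (Suc n))"
        using sum_inverse_Q_le[OF that] by linarith
    qed simp
    also have "\<dots> \<le> 2 * pi * (2 / 3 * real (Q n)) * (2 / real (Q (Suc n)))"
      using \<xi> by (intro mult_right_mono mult_left_mono) auto
    also have "\<dots> = 8 / 3 * pi / real (N n)"
      using Q_pos[of n] by (simp add: Q_Suc)
    also have "\<dots> \<le> 9 / real (N n)"
      using pi_approx by (intro divide_right_mono) auto
    finally show ?thesis
      using norm_triangle_ineq2[of 1 "\<Prod>k\<in>{Suc n..<m}. digit_mask (B k) (\<xi> / real (Q (Suc k)))"]
      by (simp add: norm_minus_commute)
  qed
  have "cmod (mask_prod n \<xi>) * ((1 / pi - \<epsilon> n) * (1 - 9 / real (N n))) \<le> cmod (mask_prod m \<xi>)" if m: "Suc n \<le> m" for m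
  proof -
    have "mask_prod m \<xi> = mask_prod (Suc n) \<xi> * (\<Prod>k\<in>{Suc n..<m}. digit_mask (B k) (\<xi> / real (Q (Suc k))))"
    proof -
      have "prod g {..<m} = prod g {..<Suc n} * prod g {Suc n..<m}" for g :: "nat \<Rightarrow> complex"
        using m prod.atLeastLessThan_concat[of 0 "Suc n" m g] by (simp add: atLeast0LessThan)
      then show ?thesis unfolding mask_prod_def .
    qed
    then have "cmod (mask_prod m \<xi>) = cmod (mask_prod n \<xi>) * (cmod (digit_mask (B n) (\<xi> / real (Q (Suc n)))) *
        cmod (\<Prod>k\<in>{Suc n..<m}. digit_mask (B k) (\<xi> / real (Q (Suc k)))))"
      by (simp only: mask_prod_Suc norm_mult mult.assoc)
    also have "\<dots> \<ge> cmod (mask_prod n \<xi>) * ((1 / pi - \<epsilon> n) * (1 - 9 / real (N n)))"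
      using first tail[OF m] True by (intro mult_left_mono mult_mono) auto
    finally show ?thesis .
  qed
  then show ?thesis
    by (intro tendsto_lowerbound[OF tendsto_norm[OF mask_prod_tendsto]])
       (auto simp: eventually_sequentially intro!: exI[of _ "Suc n"])
qed


lemma eventually_norm_fourier_ge_mask_prod:
  "eventually (\<lambda>n. \<forall>x\<in>freq n. cmod (mask_prod n (of_int x + \<xi>)) \<le>
     10 * cmod (fourier_transform moran_measure (of_int x + \<xi>))) sequentially"
proof (subst eventually_sequentially_Suc[symmetric])
  \<comment> \<open>With 1 / \<pi> \<ge> 3 / 10 the first two thresholds leave (1/5) (1/2) = 1/10,
    whence the constant 10. The window is 1/2 + 1/12 + 1/12 = 2/3: the last digit, the earlier
    digits, and \<xi>.\<close>
  have small: "eventually (\<lambda>n. \<epsilon> n < 1 / 10) sequentially" "eventually (\<lambda>n. 1 / real (N n) < 1 / 18) sequentially"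
    "eventually (\<lambda>n. 1 / real (Q n) < 1 / (12 * (\<bar>\<xi>\<bar> + 1))) sequentially"
    by (rule order_tendstoD(2)[OF \<epsilon>_tendsto_0] order_tendstoD(2)[OF inverse_N_tendsto_0]
        order_tendstoD(2)[OF inverse_Q_tendsto_0]; simp add: add_nonneg_pos)+
  have "eventually (\<lambda>n. \<epsilon> (Suc n) < 1 / 10) sequentially" "eventually (\<lambda>n. 1 / real (N (Suc n)) < 1 / 18) sequentially"
    "eventually (\<lambda>n. 1 / real (Q (Suc n)) < 1 / (12 * (\<bar>\<xi>\<bar> + 1))) sequentially"
    by (rule small[THEN eventually_sequentially_Suc[THEN iffD2]])+
  with small(2) show "eventually (\<lambda>n. \<forall>x\<in>freq (Suc n). cmod (mask_prod (Suc n) (of_int x + \<xi>)) \<le>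
     10 * cmod (fourier_transform moran_measure (of_int x + \<xi>))) sequentially"
  proof eventually_elim
    case (elim n)
    show ?case
    proof
      fix x assume x: "x \<in> freq (Suc n)"
      have "real_of_int (2 * \<bar>x\<bar>) \<le> real_of_int (2 * int (Q n) + int (Q (Suc n)))"
        using freq_Suc_bound[OF x] by (simp only: of_int_le_iff)
      then have "\<bar>real_of_int x\<bar> \<le> real (Q n) + 1 / 2 * real (Q (Suc n))"
        by simp
      also have "real (Q n) = real (Q (Suc n)) * (1 / real (N n))"
        using N_pos[of n] by (simp add: Q_Suc)
      also have "\<dots> \<le> real (Q (Suc n)) * (1 / 12)"
        using elim by (intro mult_left_mono) auto
      finally have x_le: "\<bar>real_of_int x\<bar> \<le> 7 / 12 * real (Q (Suc n))" by simp
      have "12 * (\<bar>\<xi>\<bar> + 1) < real (Q (Suc n))"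
        using elim(4) Q_pos[of "Suc n"] by (simp add: field_simps add_nonneg_pos)
      with x_le have le: "\<bar>of_int x + \<xi>\<bar> \<le> 2 / 3 * real (Q (Suc n))"
        using abs_triangle_ineq[of "real_of_int x" \<xi>] by argo
      have "1 / pi \<ge> 3 / 10" using pi_approx by (simp add: field_simps)
      then have pos: "1 / pi - \<epsilon> (Suc n) \<ge> 1 / 5" "1 - 9 / real (N (Suc n)) \<ge> 1 / 2"
        using elim by auto
      have "(1 / pi - \<epsilon> (Suc n)) * (1 - 9 / real (N (Suc n))) \<ge> 1 / 5 * (1 / 2)"
        by (rule mult_mono) (use pos in auto)
      then have "cmod (mask_prod (Suc n) (of_int x + \<xi>)) * (1 / 10) \<le> cmod (mask_prod (Suc n) (of_int x + \<xi>)) *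
          ((1 / pi - \<epsilon> (Suc n)) * (1 - 9 / real (N (Suc n))))"
        by (intro mult_left_mono) auto
      also have "\<dots> \<le> cmod (fourier_transform moran_measure (of_int x + \<xi>))"
        by (rule norm_fourier_ge_mask_prod[OF le]) (use pos in auto)
      finally show "cmod (mask_prod (Suc n) (of_int x + \<xi>)) \<le> 10 * cmod (fourier_transform moran_measure (of_int x + \<xi>))"
        by simp
    qed
  qed
qed

lemma fourier_transform_freq_diff:
  assumes "x \<in> freq n" "y \<in> freq n" "x \<noteq> y"
  shows "fourier_transform moran_measure (of_int x - of_int y) = 0"
proof (rule LIMSEQ_unique[OF mask_prod_tendsto])
  have "mask_prod m (of_int x - of_int y) = 0" if "n \<le> m" for m
    using mask_prod_eq_0_mono[OF freq_orth[OF assms] that] by simp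
  then show "(\<lambda>m. mask_prod m (of_int x - of_int y)) \<longlonglongrightarrow> 0"
    by (intro tendsto_eventually) (auto simp: eventually_sequentially)
qed

text \<open>
  Along \<open>freq n\<close> the finite-level Parseval identity is dominated by \<open>100\<close> times the partial sums of the
  limiting one, so no mass escapes in the limit.
\<close>
lemma freq_parseval_limit:
  assumes "e > 0"
  shows "\<exists>n. 1 - e < (\<Sum>x\<in>freq n. (cmod (fourier_transform moran_measure (of_int x + \<xi>)))\<^sup>2)"
proof -
  define f where "f x = (cmod (fourier_transform moran_measure (of_int x + \<xi>)))\<^sup>2" for x :: int
  define g where "g n x = (cmod (mask_prod n (of_int x + \<xi>)))\<^sup>2" for n and x :: int
  define S where "S n = sum f (freq n)" for n
  \<comment> \<open>Bessel's inequality for the exponential of frequency -\<xi>.\<close>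
  have S_le: "S n \<le> 1" for n
  proof -
    have inj: "inj_on real_of_int (freq n)" by (simp add: inj_on_def)
    have "0 \<le> (LINT x|moran_measure. (cmod (iexp (2 * pi * (- \<xi>) * x) -
        (\<Sum>l\<in>real_of_int ` freq n. fourier_transform moran_measure (l - (- \<xi>)) * iexp (2 * pi * l * x))))\<^sup>2)"
      by (intro integral_nonneg_AE) auto
    also have "\<dots> = 1 - (\<Sum>l\<in>real_of_int ` freq n. (cmod (fourier_transform moran_measure (l - (- \<xi>))))\<^sup>2)"
      by (rule L2_dist_exponential_projection) (auto simp: freq_finite intro: fourier_transform_freq_diff)
    also have "\<dots> = 1 - S n"
      by (subst sum.reindex[OF inj]) (simp add: S_def f_def)
    finally show ?thesis by simp
  qed
  have "incseq S"
    unfolding S_def by (intro monoI sum_mono2 freq_finite freq_mono) (auto simp: f_def)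
  then obtain T where T: "S \<longlonglongrightarrow> T" "\<And>n. S n \<le> T"
    using incseq_convergent[of S 1] S_le by auto
  \<comment> \<open>For fixed p the terms over \<open>freq p\<close> converge one by one, while the
    others are dominated; letting p grow then removes the constant 100.\<close>
  have key: "1 \<le> S p + 100 * (T - S p)" for p
  proof -
    have "(\<lambda>n. sum (g n) (freq p) + 100 * (S n - S p)) \<longlonglongrightarrow> S p + 100 * (T - S p)"
      unfolding S_def[of p] g_def f_def by (intro tendsto_intros mask_prod_tendsto T(1))
    then show ?thesis
    proof (rule tendsto_lowerbound)
      show "eventually (\<lambda>n. 1 \<le> sum (g n) (freq p) + 100 * (S n - S p)) sequentially"
        using eventually_norm_fourier_ge_mask_prod[of \<xi>] eventually_ge_at_top[of p]
      proof eventually_elim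
        case (elim n)
        have sub: "freq p \<subseteq> freq n" using elim by (intro freq_mono)
        have "1 = sum (g n) (freq n)" using freq_parseval[of n \<xi>] by (simp add: g_def)
        also have "\<dots> = sum (g n) (freq p) + sum (g n) (freq n - freq p)"
          using sum.subset_diff[OF sub freq_finite] by (simp add: add.commute)
        also have "sum (g n) (freq n - freq p) \<le> (\<Sum>x\<in>freq n - freq p. 100 * f x)"
        proof (rule sum_mono)
          fix x assume "x \<in> freq n - freq p"
          then have "g n x \<le> (10 * cmod (fourier_transform moran_measure (of_int x + \<xi>)))\<^sup>2"
            unfolding g_def using elim by (intro power_mono) auto
          then show "g n x \<le> 100 * f x" by (simp add: f_def power_mult_distrib)
        qed
        also have "\<dots> = 100 * (S n - S p)"
          using sum_diff[OF freq_finite sub, of f] by (simp add: S_def sum_distrib_left[symmetric])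
        finally show ?case by simp
      qed
    qed simp
  qed
  have "(\<lambda>p. S p + 100 * (T - S p)) \<longlonglongrightarrow> T + 100 * (T - T)"
    by (intro tendsto_intros T(1))
  then have "1 \<le> T + 100 * (T - T)"
    by (rule tendsto_lowerbound) (use key in auto)
  then have "1 - e < T" using \<open>e > 0\<close> by simp
  then have "eventually (\<lambda>n. 1 - e < S n) sequentially"
    by (rule order_tendstoD(1)[OF T(1)])
  then show ?thesis by (auto simp: eventually_sequentially S_def f_def)
qed

lemma AE_moran_unit_interval: "AE x in moran_measure. x \<in> {0..1}"
  using AE_moran_measure
proof eventually_elim
  case (elim x)
  then obtain d where d: "x = moran_sum d" "\<And>k. d k \<in> B k" by (auto simp: moran_set_eq)
  then have "d k < N k" for k using B_subset by blast
  from moran_sum_ge[of d 0, OF this] moran_sum_le[of d 0, OF this] show ?case by (simp add: d)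
qed

lemma spectral_moran_measure: "spectral_measure moran_measure"
  unfolding spectral_measure_def
proof (rule conjI[OF real_distribution_axioms], rule exI, rule is_spectrumI[OF AE_moran_unit_interval])
  show "countable (real_of_int ` (\<Union>n. freq n))" by simp
  fix l k assume "l \<in> real_of_int ` (\<Union>n. freq n)" "k \<in> real_of_int ` (\<Union>n. freq n)" "l \<noteq> k"
  then obtain x y m n where xy: "l = of_int x" "k = of_int y" "x \<in> freq m" "y \<in> freq n" "x \<noteq> y" by auto
  then have "x \<in> freq (max m n)" "y \<in> freq (max m n)"
    using freq_mono[of m "max m n"] freq_mono[of n "max m n"] by auto
  with xy show "fourier_transform moran_measure (l - k) = 0"
    using fourier_transform_freq_diff by blast
next
  fix \<xi> e :: real assume "e > 0"
  then obtain n where n: "1 - e < (\<Sum>x\<in>freq n. (cmod (fourier_transform moran_measure (of_int x + - \<xi>)))\<^sup>2)"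
    using freq_parseval_limit by blast
  have inj: "inj_on real_of_int (freq n)" by (simp add: inj_on_def)
  show "\<exists>F. finite F \<and> F \<subseteq> real_of_int ` (\<Union>n. freq n) \<and>
      1 - e < (\<Sum>l\<in>F. (cmod (fourier_transform moran_measure (l - \<xi>)))\<^sup>2)"
    using n by (intro exI[of _ "real_of_int ` freq n"]) (auto simp: freq_finite sum.reindex[OF inj])
qed

end

section \<open>Fourier decay and the choice of parameters\<close>

text \<open>A frequency shift a / M multiplies the term of the digit j + M c_j by a phase depending
  on j alone, since a c_j is an integer. This is what leaves the representatives free.\<close>

lemma digit_mask_residue_system:
  assumes "M > 0"
  shows "digit_mask ((\<lambda>j. j + M * c j) ` {..<M}) (y + of_int a / real M) =
    (\<Sum>j<M. iexp (- 2 * pi * y * real (j + M * c j)) * iexp (- 2 * pi * (of_int a / real M) * real j)) / of_nat M"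
proof -
  have inj: "inj_on (\<lambda>j. j + M * c j) {..<M}"
    by (rule inj_on_inverseI[where g = "\<lambda>d. d mod M"]) simp
  have "iexp (- 2 * pi * (y + of_int a / real M) * real (j + M * c j)) =
      iexp (- 2 * pi * y * real (j + M * c j)) * iexp (- 2 * pi * (of_int a / real M) * real j)" for j
  proof -
    have "- 2 * pi * (y + of_int a / real M) * real (j + M * c j) =
        - 2 * pi * y * real (j + M * c j) + (- 2 * pi * (of_int a / real M) * real j + 2 * pi * of_int (- a * int (c j)))"
      using assms by (simp add: field_simps)
    then show ?thesis by (simp only: iexp_add iexp_2pi_int mult_1_right)
  qed
  then show ?thesis
    unfolding digit_mask_def card_image[OF inj] by (subst sum.reindex[OF inj]) simp
qed

lemma digit_mask_lessThan_eq_0: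
  assumes "a \<noteq> 0" "\<bar>a\<bar> < int M"
  shows "digit_mask {..<M} (of_int a / real M) = 0"
proof -
  have M: "real M > 0" using assms by linarith
  have "\<bar>real_of_int a\<bar> < real M" using assms(2) by linarith
  then have "0 < pi * (\<bar>of_int a\<bar> / real M)" "pi * (\<bar>of_int a\<bar> / real M) < pi"
    using assms(1) M by (auto simp: divide_less_eq)
  then have "sin (pi * (\<bar>of_int a\<bar> / real M)) > 0" by (rule sin_gt_zero)
  then have "sin (pi * (of_int a / real M)) \<noteq> 0" by (auto simp: abs_if split: if_splits)
  moreover have "sin (pi * real M * (of_int a / real M)) = 0"
    using M sin_int_times_real[of a] by (simp add: mult.commute) 
  ultimately show ?thesis
    using norm_digit_mask_lessThan[of M "of_int a / real M"] M by simp
qed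

lemma digit_mask_residue_system_eq_0:
  assumes "a \<noteq> 0" "\<bar>a\<bar> < int M"
  shows "digit_mask ((\<lambda>j. j + M * c j) ` {..<M}) (of_int a / real M) = 0"
proof -
  have M: "M > 0" using assms by linarith
  have "digit_mask ((\<lambda>j. j + M * c j) ` {..<M}) (0 + of_int a / real M) = digit_mask {..<M} (of_int a / real M)"
    unfolding digit_mask_residue_system[OF M] unfolding digit_mask_def by simp
  then show ?thesis using digit_mask_lessThan_eq_0[OF assms] by simp
qed

text \<open>The masks at the M shifts are 1 / M times the discrete Fourier transform of the
  unimodular vector \<open>u\<close>, so this is Plancherel. The offset h is there for centring the
  frequencies.\<close>

lemma digit_mask_residue_system_parseval:
  assumes M: "M > 0"
  shows "(\<Sum>i<M. (cmod (digit_mask ((\<lambda>j. j + M * c j) ` {..<M}) (y + of_int (int i - h) / real M)))\<^sup>2) = 1"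
proof -
  define u where "u j = iexp (- 2 * pi * y * real (j + M * c j))" for j
  define w where "w i j = iexp (- 2 * pi * (of_int (int i - h) / real M) * real j)" for i j
  have u1: "u j * cnj (u j) = 1" for j
    by (simp add: u_def complex_norm_square[symmetric])
  have w: "(\<Sum>i<M. w i j * cnj (w i k)) = (if j = k then of_nat M else 0)" if jk: "j < M" "k < M" for j k
  proof -
    define d where "d = int j - int k"
    have "w i j * cnj (w i k) = iexp (2 * pi * of_int h * of_int d / real M) * iexp (- 2 * pi * (of_int d / real M) * real i)" for i
      by (simp add: w_def d_def exp_cnj diff_divide_distrib algebra_simps flip: exp_add)
    then have "(\<Sum>i<M. w i j * cnj (w i k)) = iexp (2 * pi * of_int h * of_int d / real M) *
        (digit_mask {..<M} (of_int d / real M) * of_nat M)"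
      using M by (simp only: digit_mask_def sum_distrib_left[symmetric]) simp
    also have "\<dots> = (if j = k then of_nat M else 0)"
    proof (cases "j = k")
      case True
      then show ?thesis using M by (simp add: d_def digit_mask_0 lessThan_empty_iff)
    next
      case False
      then have "digit_mask {..<M} (of_int d / real M) = 0"
        using jk by (intro digit_mask_lessThan_eq_0) (auto simp: d_def)
      then show ?thesis using False by simp
    qed
    finally show ?thesis .
  qed
  have "complex_of_real (\<Sum>i<M. (cmod (digit_mask ((\<lambda>j. j + M * c j) ` {..<M}) (y + of_int (int i - h) / real M)))\<^sup>2) =
      (\<Sum>i<M. ((\<Sum>j<M. u j * w i j) / of_nat M) * cnj ((\<Sum>k<M. u k * w i k) / of_nat M))"
    unfolding digit_mask_residue_system[OF M] u_def w_def of_real_sum complex_norm_square ..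
  also have "\<dots> = (\<Sum>i<M. \<Sum>j<M. \<Sum>k<M. u j * cnj (u k) * (w i j * cnj (w i k))) / (of_nat M)\<^sup>2"
    by (simp add: sum_product sum_divide_distrib[symmetric] power2_eq_square mult_ac)
  also have "(\<Sum>i<M. \<Sum>j<M. \<Sum>k<M. u j * cnj (u k) * (w i j * cnj (w i k))) =
      (\<Sum>j<M. \<Sum>k<M. \<Sum>i<M. u j * cnj (u k) * (w i j * cnj (w i k)))"
    by (subst sum.swap, rule sum.cong[OF refl], rule sum.swap)
  also have "\<dots> = (\<Sum>j<M. \<Sum>k<M. u j * cnj (u k) * (\<Sum>i<M. w i j * cnj (w i k)))"
    by (simp only: sum_distrib_left)
  also have "\<dots> = (\<Sum>j<M. \<Sum>k<M. if j = k then of_nat M else 0)"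
    by (intro sum.cong refl) (auto simp: w u1)
  also have "\<dots> / (of_nat M)\<^sup>2 = 1"
    using M by (simp add: power2_eq_square)
  finally show ?thesis unfolding of_real_eq_1_iff .
qed

section \<open>Fourier decay between consecutive scales\<close>

context moran_digits
begin

text \<open>
  The zeros of the Dirichlet kernel of \<open>N (Suc k)\<close> compensate for the periodicity of the mask of
  \<open>B k\<close>: near the integers \<open>\<bar>sin (\<pi> x)\<bar>\<close> is small where the mask of \<open>B k\<close> is not.
\<close>
lemma norm_fourier_le_deviation:
  assumes dev: "\<And>n x. cmod (digit_mask (B n) x - digit_mask {..<N n} x) \<le> \<epsilon> n"
    and \<xi>: "\<xi> \<noteq> 0" "2 * \<bar>\<xi>\<bar> \<le> real (Q (Suc (Suc k)))"
  shows "cmod (fourier_transform moran_measure \<xi>) \<le>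
    (1 / real (N k) + \<epsilon> k) * (real (Q (Suc k)) / (2 * \<bar>\<xi>\<bar>)) + \<epsilon> (Suc k)"
proof -
  \<comment> \<open>Factor k is evaluated at x and factor k + 1 at x / N_(k+1): the sine in the
    numerator of the latter's Dirichlet kernel is the one in the denominator of the former's, and
    they cancel.\<close>
  define x where "x = \<xi> / real (Q (Suc k))"
  have x: "x \<noteq> 0" using \<xi> by (simp add: x_def)
  have dev': "cmod (digit_mask (B n) y) \<le> cmod (digit_mask {..<N n} y) + \<epsilon> n" for n y
    using dev[of n y] norm_triangle_ineq2[of "digit_mask (B n) y" "digit_mask {..<N n} y"] by linarith
  have \<epsilon>: "0 \<le> \<epsilon> n" for n using dev[of n 0] norm_ge_zero order_trans by blast
  have xN: "\<xi> / real (Q (Suc (Suc k))) = x / real (N (Suc k))"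
    by (simp add: x_def Q_Suc[of "Suc k"])
  have "cmod (digit_mask {..<N (Suc k)} (x / real (N (Suc k)))) * (2 * \<bar>x\<bar>) \<le> \<bar>sin (pi * x)\<bar>"
  proof -
    \<comment> \<open>The upper bound on |\<xi>| keeps y within [0, 1/2], the range of Jordan's
      inequality.\<close>
    define y where "y = \<bar>x / real (N (Suc k))\<bar>"
    have "y \<le> 1 / 2"
      using \<xi>(2) Q_pos[of "Suc (Suc k)"] unfolding y_def xN[symmetric] by (simp add: divide_le_eq)
    then have "2 * y \<le> sin (pi * y)" by (intro two_mult_le_sin_pi) (auto simp: y_def)
    also have "\<dots> \<le> \<bar>sin (pi * y)\<bar>" by simp
    also have "\<dots> = \<bar>sin (pi * (x / real (N (Suc k))))\<bar>" unfolding y_def by (auto simp: abs_if)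
    finally have "2 * \<bar>x\<bar> \<le> real (N (Suc k)) * \<bar>sin (pi * (x / real (N (Suc k))))\<bar>"
      using N_pos[of "Suc k"] by (simp add: y_def field_simps)
    then have "cmod (digit_mask {..<N (Suc k)} (x / real (N (Suc k)))) * (2 * \<bar>x\<bar>) \<le>
        cmod (digit_mask {..<N (Suc k)} (x / real (N (Suc k)))) * (real (N (Suc k)) * \<bar>sin (pi * (x / real (N (Suc k))))\<bar>)"
      by (intro mult_left_mono) auto
    also have "\<dots> = \<bar>sin (pi * x)\<bar>"
      using norm_digit_mask_lessThan[of "N (Suc k)" "x / real (N (Suc k))"] N_pos[of "Suc k"] by simp
    finally show ?thesis .
  qed
  then have outer: "cmod (digit_mask (B (Suc k)) (x / real (N (Suc k)))) \<le> \<bar>sin (pi * x)\<bar> / (2 * \<bar>x\<bar>) + \<epsilon> (Suc k)"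
    using dev'[of "Suc k" "x / real (N (Suc k))"] x by (simp add: pos_le_divide_eq[symmetric])
  have inner: "cmod (digit_mask (B k) x) * \<bar>sin (pi * x)\<bar> \<le> 1 / real (N k) + \<epsilon> k"
  proof -
    have "cmod (digit_mask {..<N k} x) * \<bar>sin (pi * x)\<bar> * real (N k) \<le> 1"
      using norm_digit_mask_lessThan[of "N k" x] by (simp add: mult_ac)
    then have 1: "cmod (digit_mask {..<N k} x) * \<bar>sin (pi * x)\<bar> \<le> 1 / real (N k)"
      using N_pos[of k] by (simp add: pos_le_divide_eq)
    have "cmod (digit_mask (B k) x) * \<bar>sin (pi * x)\<bar> \<le> (cmod (digit_mask {..<N k} x) + \<epsilon> k) * \<bar>sin (pi * x)\<bar>"
      by (intro mult_right_mono dev') simp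
    also have "\<dots> \<le> cmod (digit_mask {..<N k} x) * \<bar>sin (pi * x)\<bar> + \<epsilon> k * 1"
      unfolding distrib_right using \<epsilon> by (intro add_left_mono mult_left_mono) auto
    finally show ?thesis using 1 by simp
  qed
  have "cmod (mask_prod m \<xi>) \<le> cmod (mask_prod (Suc (Suc k)) \<xi>)" if "Suc (Suc k) \<le> m" for m
    using that
  proof (induction m rule: dec_induct)
    case (step m)
    have "cmod (mask_prod (Suc m) \<xi>) \<le> cmod (mask_prod m \<xi>)"
      unfolding mask_prod_Suc norm_mult by (intro mult_right_le_one_le norm_digit_mask_le_1) auto
    then show ?case using step by simp
  qed simp
  then have "cmod (fourier_transform moran_measure \<xi>) \<le> cmod (mask_prod (Suc (Suc k)) \<xi>)"
    by (intro tendsto_upperbound[OF tendsto_norm[OF mask_prod_tendsto]])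
       (auto simp: eventually_sequentially intro!: exI[of _ "Suc (Suc k)"])
  also have "\<dots> = cmod (mask_prod k \<xi>) * (cmod (digit_mask (B k) x) * cmod (digit_mask (B (Suc k)) (x / real (N (Suc k)))))"
    by (simp add: mask_prod_Suc norm_mult xN x_def[symmetric] mult.assoc)
  also have "\<dots> \<le> 1 * (cmod (digit_mask (B k) x) * cmod (digit_mask (B (Suc k)) (x / real (N (Suc k)))))"
    by (intro mult_right_mono norm_mask_prod_le_1) auto
  also have "\<dots> \<le> cmod (digit_mask (B k) x) * (\<bar>sin (pi * x)\<bar> / (2 * \<bar>x\<bar>) + \<epsilon> (Suc k))"
    using outer by (simp add: mult_left_mono)
  also have "\<dots> \<le> (cmod (digit_mask (B k) x) * \<bar>sin (pi * x)\<bar>) / (2 * \<bar>x\<bar>) + 1 * \<epsilon> (Suc k)"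
    unfolding distrib_left times_divide_eq_right
    by (intro add_left_mono mult_right_mono norm_digit_mask_le_1 \<epsilon>)
  also have "\<dots> \<le> (1 / real (N k) + \<epsilon> k) / (2 * \<bar>x\<bar>) + \<epsilon> (Suc k)"
    using inner by (simp add: divide_right_mono)
  also have "(1 / real (N k) + \<epsilon> k) / (2 * \<bar>x\<bar>) = (1 / real (N k) + \<epsilon> k) * (real (Q (Suc k)) / (2 * \<bar>\<xi>\<bar>))"
    by (simp add: x_def)
  finally show ?thesis .
qed

text \<open>The hypothesis on \<open>C\<close> weighs the error of a level against the product of
  all N up to and including it; every \<xi> beyond the first scale lies between two scales, where
  the preceding estimate applies.\<close>

lemma fourier_decay_moran_measure:
  assumes dev: "\<And>n x. cmod (digit_mask (B n) x - digit_mask {..<N n} x) \<le> \<epsilon> n"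
    and t: "0 \<le> t" "t \<le> 1"
    and C: "\<And>n. 1 / real (N n) + \<epsilon> n \<le> C * real (Q (Suc n)) powr (- t / 2)"
  shows "\<exists>D>0. \<forall>\<xi>. cmod (fourier_transform moran_measure \<xi>) \<le> D * (1 + \<bar>\<xi>\<bar>) powr (- t / 2)"
proof -
  have \<epsilon>: "0 \<le> \<epsilon> n" for n using dev[of n 0] norm_ge_zero order_trans by blast
  have "0 < C * real (Q 1) powr (- t / 2)"
  proof -
    have "0 < 1 / real (N 0)" using N_pos[of 0] by simp
    then show ?thesis unfolding One_nat_def using C[of 0] \<epsilon>[of 0] by linarith
  qed
  then have C0: "0 < C" by (simp add: zero_less_mult_iff)
  \<comment> \<open>The second summand covers |\<xi>| < \<open>Q 1\<close>, where only the trivial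
    bound 1 is used.\<close>
  define D where "D = 2 * C + (1 + real (Q 1)) powr (t / 2)"
  have D: "D > 0" using C0 by (simp add: D_def add_pos_nonneg)
  have "cmod (fourier_transform moran_measure \<xi>) \<le> D * (1 + \<bar>\<xi>\<bar>) powr (- t / 2)" for \<xi>
  proof (cases "\<bar>\<xi>\<bar> < real (Q 1)")
    case True
    have "cmod (fourier_transform moran_measure \<xi>) \<le> 1"
      by (simp add: fourier_transform_eq_char cmod_char_le_1)
    also have "1 = (1 + \<bar>\<xi>\<bar>) powr (t / 2) * (1 + \<bar>\<xi>\<bar>) powr (- t / 2)"
      by (simp flip: powr_add)
    also have "\<dots> \<le> D * (1 + \<bar>\<xi>\<bar>) powr (- t / 2)"
    proof (rule mult_right_mono)
      have "(1 + \<bar>\<xi>\<bar>) powr (t / 2) \<le> (1 + real (Q 1)) powr (t / 2)"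
        using True t by (intro powr_mono2) auto
      then show "(1 + \<bar>\<xi>\<bar>) powr (t / 2) \<le> D" using C0 by (simp add: D_def)
    qed simp
    finally show ?thesis .
  next
    case False
    have Q1: "1 \<le> real (Q 1)" using Q_pos[of 1] by linarith
    have "\<exists>n. 2 * \<bar>\<xi>\<bar> \<le> real (Q n)"
    proof -
      obtain n where "2 * \<bar>\<xi>\<bar> < 2 ^ n" using real_arch_pow[of 2 "2 * \<bar>\<xi>\<bar>"] by auto
      also have "(2 :: real) ^ n \<le> real (Q n)"
        using Q_ge_power[of n] by (metis of_nat_le_iff of_nat_numeral of_nat_power)
      finally show ?thesis by (intro exI[of _ n]) simp
    qed
    then have n: "2 * \<bar>\<xi>\<bar> \<le> real (Q (LEAST n. 2 * \<bar>\<xi>\<bar> \<le> real (Q n)))" by (rule LeastI_ex)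
    \<comment> \<open>Since 2 |\<xi>| \<ge> 2 \<open>Q 1\<close> exceeds both \<open>Q 0\<close> and
      \<open>Q 1\<close>, this n is at least 2 and so has two levels below it.\<close>
    define n where "n = (LEAST n. 2 * \<bar>\<xi>\<bar> \<le> real (Q n))"
    have n: "2 * \<bar>\<xi>\<bar> \<le> real (Q n)" using n unfolding n_def .
    have "n \<noteq> 0"
    proof
      assume "n = 0"
      with n have "2 * \<bar>\<xi>\<bar> \<le> 1" by simp
      with False Q1 show False by linarith
    qed
    have "n \<noteq> 1"
    proof
      assume "n = 1"
      with n have "2 * \<bar>\<xi>\<bar> \<le> real (Q 1)" by simp
      with False Q1 show False by linarith
    qed
    with \<open>n \<noteq> 0\<close> obtain k where k: "n = Suc (Suc k)" by (metis One_nat_def not0_implies_Suc)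
    have up: "2 * \<bar>\<xi>\<bar> \<le> real (Q (Suc (Suc k)))" using n unfolding k .
    have low: "real (Q (Suc k)) < 2 * \<bar>\<xi>\<bar>"
      using not_less_Least[of "Suc k" "\<lambda>n. 2 * \<bar>\<xi>\<bar> \<le> real (Q n)"] k unfolding n_def[symmetric] by simp
    have pos: "0 < 2 * \<bar>\<xi>\<bar>" using False Q1 by linarith
    define r where "r = real (Q (Suc k)) / (2 * \<bar>\<xi>\<bar>)"
    have r: "0 < r" "r \<le> 1" using low pos Q_pos[of "Suc k"] by (auto simp: r_def)
    have "cmod (fourier_transform moran_measure \<xi>) \<le> (1 / real (N k) + \<epsilon> k) * r + \<epsilon> (Suc k)"
      unfolding r_def by (rule norm_fourier_le_deviation[OF dev _ up]) (use pos in auto)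
    also have "(1 / real (N k) + \<epsilon> k) * r \<le> C * (2 * \<bar>\<xi>\<bar>) powr (- t / 2)"
    proof -
      \<comment> \<open>As r \<le> 1 and t / 2 \<le> 1, weakening r to r^(t/2) exchanges the power
        of \<open>Q (Suc k)\<close> for the same power of 2 |\<xi>|.\<close>
      have "(1 / real (N k) + \<epsilon> k) * r \<le> (C * real (Q (Suc k)) powr (- t / 2)) * r powr (t / 2)"
      proof (intro mult_mono C)
        have "r powr 1 \<le> r powr (t / 2)" using r t by (intro powr_mono') auto
        then show "r \<le> r powr (t / 2)" using r by simp
      qed (use C0 r in auto)
      also have "\<dots> = C * (2 * \<bar>\<xi>\<bar>) powr (- t / 2)"
        using pos Q_pos[of "Suc k"] unfolding r_def
        by (simp add: powr_divide powr_minus divide_simps)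
      finally show ?thesis .
    qed
    also have "\<epsilon> (Suc k) \<le> C * (2 * \<bar>\<xi>\<bar>) powr (- t / 2)"
    proof -
      have "\<epsilon> (Suc k) \<le> 1 / real (N (Suc k)) + \<epsilon> (Suc k)" by simp
      also have "\<dots> \<le> C * real (Q (Suc (Suc k))) powr (- t / 2)" by (rule C)
      also have "\<dots> \<le> C * (2 * \<bar>\<xi>\<bar>) powr (- t / 2)"
        using up pos t C0 by (intro mult_left_mono powr_mono2') auto
      finally show ?thesis .
    qed
    also have "C * (2 * \<bar>\<xi>\<bar>) powr (- t / 2) + C * (2 * \<bar>\<xi>\<bar>) powr (- t / 2) = 2 * C * (2 * \<bar>\<xi>\<bar>) powr (- t / 2)"
      by simp
    also have "\<dots> \<le> D * (1 + \<bar>\<xi>\<bar>) powr (- t / 2)"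
    proof (rule mult_mono)
      show "(2 * \<bar>\<xi>\<bar>) powr (- t / 2) \<le> (1 + \<bar>\<xi>\<bar>) powr (- t / 2)"
        using False Q1 t by (intro powr_mono2') auto
    qed (use D in \<open>auto simp: D_def\<close>)
    finally show ?thesis by simp
  qed
  with D show ?thesis by blast
qed

end


lemma sum_fact_le_fact: "(\<Sum>k<n. fact k) \<le> (fact n :: nat)"
proof (induction n)
  case (Suc n)
  then show ?case
  proof (cases "n = 0")
    case False
    have "(\<Sum>k<Suc n. fact k) \<le> fact n + (fact n :: nat)" using Suc by simp
    also have "\<dots> \<le> fact (Suc n)" using False by simp
    finally show ?thesis .
  qed simp
qed simp

text \<open>With N_n = 2^(n!) this bounds the ratio of the logarithm of the product of the earlier N
  to that of N_n by 2 / n.\<close>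

lemma mult_sum_fact_le: "n * (\<Sum>k<n. fact k) \<le> 2 * (fact n :: nat)"
proof (cases n)
  case (Suc k)
  have "(\<Sum>k<n. fact k) \<le> 2 * (fact k :: nat)"
    using sum_fact_le_fact[of k] by (simp add: Suc)
  then have "n * (\<Sum>k<n. fact k) \<le> n * (2 * fact k)" by (rule mult_le_mono2)
  then show ?thesis by (simp add: Suc)
qed simp

theorem theorem1p1:
  fixes s :: real
  assumes "0 < s" and "s \<le> 1"
  shows "\<exists>(N :: nat \<Rightarrow> nat) (B :: nat \<Rightarrow> nat set) (\<mu> :: real measure).
           (\<forall>n. 2 \<le> N n \<and> B n \<noteq> {} \<and> B n \<subseteq> {0..N n - 1}) \<and>
           is_cantor_moran_measure N B \<mu> \<and>
           fourier_dim_measure \<mu> = s \<and>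
           hausdorff_dim (moran_set N B) = s \<and>
           spectral_measure \<mu> \<and>
           salem_set (moran_set N B)"
proof -
  \<comment> \<open>Rounding s n! up makes M_n \<ge> N_n^s, and \<open>a n\<close> \<le>
    \<open>m n\<close> because s \<le> 1, so M_n divides N_n. Also \<open>a n\<close> \<ge> 1, so
    M_n is even with half \<open>h n\<close>.\<close>
  define m :: "nat \<Rightarrow> nat" where "m n = fact n" for n
  define a where "a n = nat \<lceil>s * real (m n)\<rceil>" for n
  define N :: "nat \<Rightarrow> nat" where "N n = 2 ^ m n" for n
  define M :: "nat \<Rightarrow> nat" where "M n = 2 ^ a n" for n
  define K :: "nat \<Rightarrow> nat" where "K n = 2 ^ (m n - a n)" for n
  define h :: "nat \<Rightarrow> nat" where "h n = 2 ^ (a n - 1)" for n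
  have m1: "1 \<le> m n" for n by (simp add: m_def)
  have m1': "1 \<le> real (m n)" for n using m1[of n] by simp
  have sm: "0 < s * real (m n)" "s * real (m n) \<le> real (m n)" for n
    using assms m1'[of n] by (auto simp: mult_left_le_one_le mult_pos_pos)
  have a_ge: "s * real (m n) \<le> real (a n)" and a_le: "real (a n) \<le> s * real (m n) + 1" for n
    using sm(1)[of n] unfolding a_def by linarith+
  have a1: "1 \<le> a n" for n using sm(1)[of n] unfolding a_def by linarith
  have am: "a n \<le> m n" for n using sm(2)[of n] unfolding a_def by linarith
  have NMK: "N n = M n * K n" for n using am[of n] by (simp add: N_def M_def K_def flip: power_add)
  have M2h: "M n = 2 * h n" for n using a1[of n] by (simp add: M_def h_def flip: power_Suc)
  have N2: "2 \<le> N n" for n using power_increasing[OF m1[of n], of "2 :: nat"] by (simp add: N_def)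
  have pos: "0 < M n" "0 < K n" "0 < h n" for n by (simp_all add: M_def K_def h_def)
  define \<epsilon> where "\<epsilon> n = 8 * sqrt (ln (4 * real (N n) ^ 2) / real (M n)) + 4 * pi / real (N n)" for n
  have "\<exists>c. (\<forall>j. c j < K n) \<and>
      (\<forall>x. cmod (digit_mask ((\<lambda>j. j + M n * c j) ` {..<M n}) x - digit_mask {..<N n} x) \<le> \<epsilon> n)" for n
    using digit_set_small_deviation[OF pos(1,2) NMK N2, of n] unfolding \<epsilon>_def by metis
  then obtain c where c: "\<And>n j. c n j < K n"
    and dev: "\<And>n x. cmod (digit_mask ((\<lambda>j. j + M n * c n j) ` {..<M n}) x - digit_mask {..<N n} x) \<le> \<epsilon> n"
    by metis
  define B where "B n = (\<lambda>j. j + M n * c n j) ` {..<M n}" for n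
  \<comment> \<open>The indices i - h run from -M_n / 2 to M_n / 2 - 1, so the multiples of N_n /
    M_n are centred and contain 0.\<close>
  define L where "L n = (\<lambda>i. int (K n) * (int i - int (h n))) ` {..<M n}" for n
  have B_less: "B n \<subseteq> {..<N n}" for n
  proof
    fix d assume "d \<in> B n"
    then obtain j where j: "j < M n" "d = j + M n * c n j" by (auto simp: B_def)
    have "M n * Suc (c n j) \<le> M n * K n" using c[of n j] by (intro mult_le_mono2) simp
    then show "d \<in> {..<N n}" using j by (simp add: NMK)
  qed
  have cardB: "card (B n) = M n" for n
    unfolding B_def by (subst card_image) (auto intro!: inj_on_inverseI[where g = "\<lambda>d. d mod M n"])
  interpret moran_digits N B
    by unfold_locales (use N2 B_less pos in \<open>auto simp: B_def lessThan_empty_iff\<close>)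
  have quotient: "of_int (int (K n) * b) / real (N n) = of_int b / real (M n)" for n b
    using pos by (simp add: NMK)
  \<comment> \<open>Both 1 / N_n and the deviation are at most of order sqrt (m) 2^(-s m / 2); the
    factor 30 bounds 17 + 4 \<pi>.\<close>
  define E where "E x = sqrt x * 2 powr (- (s * x / 2))" for x :: real
  have \<delta>: "1 / real (N n) + \<epsilon> n \<le> 30 * E (real (m n))" for n
  proof -
    define p where "p = 2 powr (- (s * real (m n) / 2))"
    have inv_M: "1 / real (M n) \<le> p\<^sup>2"
    proof -
      have "1 / real (M n) = 2 powr (- real (a n))"
        by (simp add: M_def powr_minus powr_realpow divide_inverse)
      also have "\<dots> \<le> 2 powr (- (s * real (m n)))" using a_ge[of n] by (intro powr_mono) auto
      also have "\<dots> = p\<^sup>2" by (simp add: p_def power2_eq_square flip: powr_add)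
      finally show ?thesis .
    qed
    have p0: "p > 0" by (simp add: p_def)
    have inv_N: "1 / real (N n) \<le> sqrt (real (m n)) * p"
    proof -
      have "1 / real (N n) = 2 powr (- real (m n))"
        by (simp add: N_def powr_minus powr_realpow divide_inverse)
      also have "\<dots> \<le> p" unfolding p_def by (rule powr_mono) (use sm[of n] in linarith, simp)
      also have "\<dots> \<le> sqrt (real (m n)) * p" using m1'[of n] p0 by simp
      finally show ?thesis .
    qed
    have "ln (4 * real (N n) ^ 2) = (2 + 2 * real (m n)) * ln 2"
    proof -
      have eq: "4 * real (N n) ^ 2 = 2 ^ (2 + 2 * m n)"
        by (simp add: N_def power_add power_mult mult.commute)
      have "ln (2 ^ (2 + 2 * m n)) = real (2 + 2 * m n) * ln (2 :: real)" by (rule ln_realpow)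
      then show ?thesis unfolding eq by simp
    qed
    also have "\<dots> \<le> (2 + 2 * real (m n)) * 1" using ln_2_less_1 by (intro mult_left_mono) auto
    also have "\<dots> \<le> 4 * real (m n)" using m1'[of n] by simp
    finally have "ln (4 * real (N n) ^ 2) * (1 / real (M n)) \<le> 4 * real (m n) * p\<^sup>2"
      using inv_M by (intro mult_mono) auto
    then have "sqrt (ln (4 * real (N n) ^ 2) / real (M n)) \<le> sqrt (4 * real (m n) * p\<^sup>2)"
      by (intro real_sqrt_le_mono) simp
    also have "\<dots> = 2 * (sqrt (real (m n)) * p)"
      using p0 by (simp add: real_sqrt_mult)
    finally have "1 / real (N n) + \<epsilon> n \<le> (1 + 4 * pi) * (1 / real (N n)) + 16 * (sqrt (real (m n)) * p)"
      unfolding \<epsilon>_def by (simp add: algebra_simps)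
    also have "\<dots> \<le> (1 + 4 * pi) * (sqrt (real (m n)) * p) + 16 * (sqrt (real (m n)) * p)"
      using inv_N by (intro add_right_mono mult_left_mono) auto
    also have "\<dots> = (17 + 4 * pi) * (sqrt (real (m n)) * p)" by (simp add: algebra_simps)
    also have "\<dots> \<le> 30 * (sqrt (real (m n)) * p)"
      using pi_approx p0 by (intro mult_right_mono) auto
    finally show ?thesis by (simp add: E_def p_def)
  qed
  have m_at_top: "filterlim (\<lambda>n. real (m n)) at_top sequentially"
  proof (rule filterlim_at_top_mono[OF filterlim_real_sequentially])
    have "real n \<le> real (m n)" for n
      unfolding m_def of_nat_le_iff by (rule fact_ge_self)
    then show "eventually (\<lambda>n. real n \<le> real (m n)) sequentially" by (intro always_eventually allI)
  qed
  have E0: "(\<lambda>n. 30 * E (real (m n))) \<longlonglongrightarrow> 0"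
  proof (rule filterlim_compose[OF _ m_at_top])
    show "((\<lambda>x. 30 * E x) \<longlongrightarrow> 0) at_top"
      unfolding E_def using assms(1) by real_asymp
  qed
  have \<epsilon>0: "0 \<le> \<epsilon> n" for n using dev[of n 0] norm_ge_zero order_trans by blast
  have small: "\<epsilon> n \<le> 30 * E (real (m n))" "1 / real (N n) \<le> 30 * E (real (m n))" for n
  proof -
    have "0 \<le> 1 / real (N n)" by simp
    then show "\<epsilon> n \<le> 30 * E (real (m n))" "1 / real (N n) \<le> 30 * E (real (m n))"
      using \<delta>[of n] \<epsilon>0[of n] by linarith+
  qed
  interpret hadamard_moran N B L \<epsilon>
  proof
    fix n
    show "finite (L n)" by (simp add: L_def)
    show "0 \<in> L n" using M2h[of n] pos(3)[of n] by (auto simp: L_def intro!: image_eqI[of _ _ "h n"])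
    show "digit_mask (B n) (of_int (l - k) / real (N n)) = 0" if "l \<in> L n" "k \<in> L n" "l \<noteq> k" for l k
    proof -
      obtain i j where ij: "i < M n" "j < M n" "l = int (K n) * (int i - int (h n))" "k = int (K n) * (int j - int (h n))"
        using \<open>l \<in> L n\<close> \<open>k \<in> L n\<close> by (auto simp: L_def)
      have "l - k = int (K n) * (int i - int j)" by (simp add: ij algebra_simps)
      then have "digit_mask (B n) (of_int (l - k) / real (N n)) = digit_mask (B n) (of_int (int i - int j) / real (M n))"
        by (simp only: quotient)
      also have "\<dots> = 0"
        unfolding B_def by (rule digit_mask_residue_system_eq_0) (use ij \<open>l \<noteq> k\<close> in auto)
      finally show ?thesis .
    qed
    show "(\<Sum>l\<in>L n. (cmod (digit_mask (B n) (y + of_int l / real (N n))))\<^sup>2) = 1" for y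
    proof -
      have "inj_on (\<lambda>i. int (K n) * (int i - int (h n))) {..<M n}"
        using pos(2)[of n] by (auto simp: inj_on_def)
      then show ?thesis
        unfolding L_def by (subst sum.reindex) (simp_all only: o_def quotient B_def digit_mask_residue_system_parseval[OF pos(1)])
    qed
    show "2 * \<bar>l\<bar> \<le> int (N n)" if "l \<in> L n" for l
    proof -
      obtain i where i: "i < M n" "l = int (K n) * (int i - int (h n))"
        using \<open>l \<in> L n\<close> by (auto simp: L_def)
      have "\<bar>int i - int (h n)\<bar> \<le> int (h n)" using i(1) M2h[of n] by linarith
      then have "int (K n) * \<bar>int i - int (h n)\<bar> \<le> int (K n) * int (h n)" by (intro mult_left_mono) auto
      then show ?thesis by (simp add: i(2) abs_mult NMK M2h mult_ac)
    qed
    show "cmod (digit_mask (B n) x - digit_mask {..<N n} x) \<le> \<epsilon> n" for x unfolding B_def by (rule dev)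
    show "\<epsilon> \<longlonglongrightarrow> 0"
      by (rule tendsto_sandwich[OF _ _ tendsto_const E0]) (use \<epsilon>0 small in auto)
    show "(\<lambda>n. 1 / real (N n)) \<longlonglongrightarrow> 0"
      by (rule tendsto_sandwich[OF _ _ tendsto_const E0]) (use small in auto)
  qed
  define S :: "nat \<Rightarrow> nat" where "S n = (\<Sum>k<n. m k)" for n
  have Q_S: "Q n = 2 ^ S n" for n by (simp add: Q_def N_def S_def power_sum)
  have Q_powr: "real (Q n) powr u = 2 powr (real (S n) * u)" for n u
    by (simp add: Q_S powr_powr flip: powr_realpow)
  have decay: "\<exists>D>0. \<forall>\<xi>. cmod (fourier_transform moran_measure \<xi>) \<le> D * (1 + \<bar>\<xi>\<bar>) powr (- t / 2)"
    if t: "0 \<le> t" "t < s" for t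
  proof -
    \<comment> \<open>The error bound relative to the target order -t / 2; its boundedness supplies
      the constant \<open>C\<close>. Since t (1 + 2 / n) < (s + t) / 2 eventually, an exponent of at
      most -(s - t) / 4 times \<open>m n\<close> remains.\<close>
    define g where "g n = 30 * E (real (m n)) * real (Q (Suc n)) powr (t / 2)" for n
    have "(\<lambda>n. t * (1 + 2 / real n)) \<longlonglongrightarrow> t" by real_asymp
    then have "eventually (\<lambda>n. t * (1 + 2 / real n) < (s + t) / 2) sequentially"
      by (rule order_tendstoD(2)) (use t in auto)
    then have ev: "eventually (\<lambda>n. norm (g n) \<le> 30 * (sqrt (real (m n)) * 2 powr (- ((s - t) / 4 * real (m n))))) sequentially"
      using eventually_gt_at_top[of 0]
    proof eventually_elim
      case (elim n)
      have "real (n * (\<Sum>k<n. fact k)) \<le> real (2 * fact n)"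
        using mult_sum_fact_le[of n] by (simp only: of_nat_le_iff)
      then have "real n * real (S n) \<le> 2 * real (m n)" by (simp add: S_def m_def)
      then have "real (S n) \<le> 2 / real n * real (m n)" using elim(2) by (simp add: field_simps)
      then have "real (S (Suc n)) \<le> (1 + 2 / real n) * real (m n)" by (simp add: S_def algebra_simps)
      then have "t * real (S (Suc n)) \<le> t * ((1 + 2 / real n) * real (m n))" using t by (intro mult_left_mono)
      also have "\<dots> \<le> (s + t) / 2 * real (m n)"
        unfolding mult.assoc[symmetric] using elim by (intro mult_right_mono) auto
      finally have le: "- (s * real (m n) / 2) + real (S (Suc n)) * (t / 2) \<le> - ((s - t) / 4 * real (m n))"
        by (simp add: field_simps)
      have "norm (g n) = 30 * (sqrt (real (m n)) * (2 powr (- (s * real (m n) / 2)) * 2 powr (real (S (Suc n)) * (t / 2))))"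
        by (simp add: g_def E_def Q_powr abs_mult)
      also have "\<dots> = 30 * (sqrt (real (m n)) * 2 powr (- (s * real (m n) / 2) + real (S (Suc n)) * (t / 2)))"
        by (simp only: powr_add)
      also have "\<dots> \<le> 30 * (sqrt (real (m n)) * 2 powr (- ((s - t) / 4 * real (m n))))"
        using le by (intro mult_left_mono powr_mono) auto
      finally show ?case .
    qed
    have "(\<lambda>n. 30 * (sqrt (real (m n)) * 2 powr (- ((s - t) / 4 * real (m n))))) \<longlonglongrightarrow> 0"
    proof (rule filterlim_compose[OF _ m_at_top])
      define \<gamma> where "\<gamma> = (s - t) / 4"
      have "\<gamma> > 0" using t by (simp add: \<gamma>_def)
      then have "((\<lambda>x. 30 * (sqrt x * 2 powr (- (\<gamma> * x)))) \<longlongrightarrow> 0) at_top" by real_asymp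
      then show "((\<lambda>x. 30 * (sqrt x * 2 powr (- ((s - t) / 4 * x)))) \<longlongrightarrow> 0) at_top" by (simp add: \<gamma>_def)
    qed
    from Lim_null_comparison[OF ev this] have "Bseq g" by (intro convergent_imp_Bseq convergentI)
    then obtain C where "\<And>n. norm (g n) \<le> C" by (auto simp: Bseq_def)
    then have C: "g n \<le> C" for n by (simp add: abs_le_iff)
    show ?thesis
    proof (rule fourier_decay_moran_measure[OF deviation])
      fix n
      have "1 / real (N n) + \<epsilon> n \<le> g n * real (Q (Suc n)) powr (- t / 2)"
        using \<delta>[of n] by (simp add: g_def mult.assoc flip: powr_add)
      also have "\<dots> \<le> C * real (Q (Suc n)) powr (- t / 2)" by (intro mult_right_mono C) auto
      finally show "1 / real (N n) + \<epsilon> n \<le> C * real (Q (Suc n)) powr (- t / 2)" .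
    qed (use t assms in auto)
  qed
  have null: "hausdorff_measure u (moran_set N B) = 0" if u: "s < u" for u
  proof (rule hausdorff_measure_moran_set_eq_0)
    show "0 < u" using u assms by simp
    have card_eq: "real (\<Prod>k<n. card (B k)) = 2 powr real (\<Sum>k<n. a k)" for n
    proof -
      have "(\<Prod>k<n. card (B k)) = 2 ^ (\<Sum>k<n. a k)" by (simp add: cardB M_def power_sum)
      then have "real (\<Prod>k<n. card (B k)) = 2 ^ (\<Sum>k<n. a k)" by (simp only: of_nat_power of_nat_numeral)
      then show ?thesis by (simp only: powr_realpow zero_less_numeral)
    qed
    \<comment> \<open>Rounding up in \<open>a\<close> costs at most one binary digit per level,
      hence the factor 2^(n+1). The crude quadratic lower bound for \<open>S (Suc n)\<close> already
      beats it.\<close>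
    have le: "real (\<Prod>k<Suc n. card (B k)) * real (Q (Suc n)) powr (- u) \<le>
        2 powr (real n + 1 - (u - s) * (real n * (real n - 1)))" for n
    proof -
      have "real (\<Sum>k<Suc n. a k) \<le> (\<Sum>k<Suc n. s * real (m k) + 1)"
        unfolding of_nat_sum by (intro sum_mono a_le)
      also have "\<dots> = s * real (S (Suc n)) + (real n + 1)"
        by (simp add: S_def sum.distrib sum_distrib_left algebra_simps)
      finally have 1: "real (\<Sum>k<Suc n. a k) \<le> s * real (S (Suc n)) + (real n + 1)" .
      have "real n * (real n - 1) \<le> real (S (Suc n))"
      proof (cases n)
        case (Suc i)
        have "n * i \<le> n * fact i" by (intro mult_le_mono2 fact_ge_self)
        also have "\<dots> \<le> S (Suc n)" by (simp add: S_def m_def Suc)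
        finally have "real (n * i) \<le> real (S (Suc n))" by (simp only: of_nat_le_iff)
        then show ?thesis by (simp add: Suc algebra_simps)
      qed simp
      then have 2: "(u - s) * (real n * (real n - 1)) \<le> (u - s) * real (S (Suc n))"
        using u by (intro mult_left_mono) auto
      show ?thesis
        unfolding card_eq Q_powr powr_add[symmetric]
        by (rule powr_mono) (use 1 2 in \<open>auto simp: algebra_simps\<close>)
    qed
    have "(\<lambda>n. real (\<Prod>k<Suc n. card (B k)) * real (Q (Suc n)) powr (- u)) \<longlonglongrightarrow> 0"
    proof (rule tendsto_sandwich[OF _ _ tendsto_const])
      define \<gamma> where "\<gamma> = u - s"
      have "\<gamma> > 0" using u by (simp add: \<gamma>_def)
      then have "(\<lambda>n. 2 powr (real n + 1 - \<gamma> * (real n * (real n - 1)))) \<longlonglongrightarrow> 0" by real_asymp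
      then show "(\<lambda>n. 2 powr (real n + 1 - (u - s) * (real n * (real n - 1)))) \<longlonglongrightarrow> 0" by (simp add: \<gamma>_def)
    qed (intro always_eventually allI le mult_nonneg_nonneg of_nat_0_le_iff powr_ge_zero)+
    then show "(\<lambda>n. real (\<Prod>k<n. card (B k)) * real (Q n) powr (- u)) \<longlonglongrightarrow> 0"
      by (rule LIMSEQ_imp_Suc)
  qed
  have "hausdorff_dim (moran_set N B) \<le> u" if "s < u" for u
    unfolding hausdorff_dim_def
  proof (rule cInf_lower)
    show "u \<in> {u. 0 \<le> u \<and> hausdorff_measure u (moran_set N B) = 0}"
      using null[OF that] that assms by simp
    show "bdd_below {u. 0 \<le> u \<and> hausdorff_measure u (moran_set N B) = 0}"
      by (rule bdd_belowI[of _ 0]) simp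
  qed
  then have H_le: "hausdorff_dim (moran_set N B) \<le> s" by (rule dense_ge)
  have le_H: "fourier_dim_measure \<nu> \<le> hausdorff_dim (moran_set N B)"
    if "real_distribution \<nu>" "emeasure \<nu> (moran_set N B) = 1" for \<nu>
    by (rule fourier_dim_measure_le_hausdorff_dim[OF that _ null[of "s + 1"]]) (use assms in auto)
  have "t \<le> fourier_dim_measure moran_measure" if "0 < t" "t < s" for t
    unfolding fourier_dim_measure_def
  proof (rule cSup_upper)
    show "t \<in> {t \<in> {0..1}. \<exists>C>0. \<forall>\<xi>. cmod (fourier_transform moran_measure \<xi>) \<le> C * (1 + \<bar>\<xi>\<bar>) powr (- t / 2)}"
      using decay[of t] that assms by simp
    show "bdd_above {t \<in> {0..1}. \<exists>C>0. \<forall>\<xi>. cmod (fourier_transform moran_measure \<xi>) \<le> C * (1 + \<bar>\<xi>\<bar>) powr (- t / 2)}"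
      by (rule bdd_aboveI[of _ 1]) simp
  qed
  \<comment> \<open>Orders strictly below s suffice, as the dimension is a supremum; order s itself
    is not claimed.\<close>
  then have F_ge: "s \<le> fourier_dim_measure moran_measure"
    by (rule dense_le_bounded[OF assms(1)])
  note F_le = le_H[OF real_distribution_axioms emeasure_moran_set]
  have F: "fourier_dim_measure moran_measure = s" and H: "hausdorff_dim (moran_set N B) = s"
    using F_ge F_le H_le by auto
  have "salem_set (moran_set N B)"
    unfolding salem_set_def fourier_dim_def
  proof
    show "moran_set N B \<in> sets borel" using compact_moran_set by (simp add: borel_compact)
    show "Sup {fourier_dim_measure \<mu> |\<mu>. real_distribution \<mu> \<and> emeasure \<mu> (moran_set N B) = 1} =
        hausdorff_dim (moran_set N B)"
    \<comment> \<open>The supremum is attained by \<open>moran_measure\<close> itself, and every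
      other measure of full mass obeys the Hausdorff bound.\<close>
    proof (rule cSup_eq_maximum)
      show "hausdorff_dim (moran_set N B) \<in>
          {fourier_dim_measure \<mu> |\<mu>. real_distribution \<mu> \<and> emeasure \<mu> (moran_set N B) = 1}"
        unfolding H F[symmetric] using real_distribution_axioms emeasure_moran_set by blast
    qed (use le_H in auto)
  qed
  moreover have "2 \<le> N n \<and> B n \<noteq> {} \<and> B n \<subseteq> {0..N n - 1}" for n
  proof -
    have "d \<le> N n - 1" if "d \<in> B n" for d using that B_less[of n] by fastforce
    then show ?thesis using N2 B_nonempty by auto
  qed
  ultimately show ?thesis
    using is_cantor_moran_moran_measure F H spectral_moran_measure by blast
qed

end
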